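(* Let $d\ge 1$ be an integer and let $T\colon L_2(\mathbb{T}^d)\to L_2(\mathbb{T}^d)$ be a bounded linear operator which admits an invariant factorization through the Sobolev space $W^1_1(\mathbb{T}^d)$. Then $\sigma_p(T)<\infty$ for every $p>2d+4$, where $\sigma_p$ denotes the $p$-th Schatten norm.
   Context: $\mathbb{T}^d=\mathbb{R}^d/\mathbb{Z}^d$ is the $d$-dimensional torus with normalized Haar measure. $W^1_1(\mathbb{T}^d)$ is the Sobolev space of (complex-valued) functions $f\in L_1(\mathbb{T}^d)$ whose first-order weak partial derivatives belong to $L_1(\mathbb{T}^d)$, with norm $\|f\|_{1,1}=\|f\|_1+\sum_{j=1}^d\left\|\frac{\partial f}{\partial x_j}\right\|_1$. An operator between translation invariant function spaces on $\mathbb{T}^d$ is translation invariant if it commutes with all translations of $\mathbb{T}^d$. Let $X(\mathbb{T}^d),Y(\mathbb{T}^d),Z(\mathbb{T}^d)$ be translation invariant spaces on $\mathbb{T}^d$. A bounded linear operator $T\colon X(\mathbb{T}^d)\to Y(\mathbb{T}^d)$ admits an invariant factorization through $Z(\mathbb{T}^d)$ if there exist translation invariant bounded linear operators $A\colon X(\mathbb{T}^d)\to Z(\mathbb{T}^d)$ and $B\colon Z(\mathbb{T}^d)\to Y(\mathbb{T}^d)$ such that $T=B\circ A$. *)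

theory Defs
  imports "HOL-Analysis.Analysis"
begin

text \<open>
  A function on the torus \<open>T^d = R^d / Z^d\<close> is a \<open>Z^d\<close>-periodic function on \<open>real ^ 'd\<close>, with
  \<open>d = CARD('d)\<close>; Haar measure is Lebesgue measure on the unit cube, whose boundary is a null set.
  Function spaces are given by representatives: elements equal almost everywhere are identified
  through \<open>ae_eq\<close>, and an operator is a map on representatives that respects \<open>ae_eq\<close>.
\<close>

type_synonym 'd tfun = "real ^ 'd \<Rightarrow> complex"

definition torus_measure :: "(real ^ 'd) measure" where
  "torus_measure = restrict_space lborel (cbox 0 1)"

definition torus_fun :: "'d::finite tfun \<Rightarrow> bool" where
  "torus_fun f \<longleftrightarrow> f \<in> borel_measurable borel \<and>
     (\<forall>k. (\<forall>i. k $ i \<in> \<int>) \<longrightarrow> (\<forall>x. f (x + k) = f x))"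

definition ae_eq :: "'d::finite tfun \<Rightarrow> 'd tfun \<Rightarrow> bool" where
  "ae_eq f g \<longleftrightarrow> (AE x in torus_measure. f x = g x)"

definition translate :: "real ^ 'd \<Rightarrow> 'd::finite tfun \<Rightarrow> 'd tfun" where
  "translate h f = (\<lambda>x. f (x - h))"

record 'f function_space =
  elems :: "'f set"
  size_of :: "'f \<Rightarrow> real"

definition Lp :: "real \<Rightarrow> 'd::finite tfun function_space" where
  "Lp p = \<lparr>elems = {f. torus_fun f \<and> integrable torus_measure (\<lambda>x. norm (f x) powr p)},
           size_of = (\<lambda>f. (LINT x|torus_measure. norm (f x) powr p) powr (1 / p))\<rparr>"


definition partial :: "'d::finite \<Rightarrow> 'd tfun \<Rightarrow> 'd tfun" where
  "partial j f = (\<lambda>x. frechet_derivative f (at x) (axis j 1))"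

primrec C_k :: "nat \<Rightarrow> 'd::finite tfun \<Rightarrow> bool" where
  "C_k 0 f \<longleftrightarrow> continuous_on UNIV f"
| "C_k (Suc k) f \<longleftrightarrow> (\<forall>x. f differentiable (at x)) \<and> (\<forall>j. C_k k (partial j f))"

definition test_fun :: "'d::finite tfun \<Rightarrow> bool" where
  "test_fun \<phi> \<longleftrightarrow> torus_fun \<phi> \<and> (\<forall>k. C_k k \<phi>)"

definition is_weak_partial :: "'d::finite \<Rightarrow> 'd tfun \<Rightarrow> 'd tfun \<Rightarrow> bool" where
  "is_weak_partial j f g \<longleftrightarrow> g \<in> elems (Lp 1) \<and>
     (\<forall>\<phi>. test_fun \<phi> \<longrightarrow>
        (LINT x|torus_measure. f x * partial j \<phi> x) = - (LINT x|torus_measure. g x * \<phi> x))"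

text \<open>Weak derivatives are unique up to \<open>ae_eq\<close>, so the norm below does not depend on the choice.\<close>

definition weak_partial :: "'d::finite \<Rightarrow> 'd tfun \<Rightarrow> 'd tfun" where
  "weak_partial j f = (SOME g. is_weak_partial j f g)"

definition Sobolev11 :: "'d::finite tfun function_space" where
  "Sobolev11 = \<lparr>elems = {f \<in> elems (Lp 1). \<forall>j. \<exists>g. is_weak_partial j f g},
     size_of = (\<lambda>f. size_of (Lp 1) f + (\<Sum>j\<in>UNIV. size_of (Lp 1) (weak_partial j f)))\<rparr>"


definition bounded_operator ::
    "'d::finite tfun function_space \<Rightarrow> 'd tfun function_space \<Rightarrow> ('d tfun \<Rightarrow> 'd tfun) \<Rightarrow> bool" where
  "bounded_operator X Y T \<longleftrightarrow>
     (\<forall>f\<in>elems X. T f \<in> elems Y) \<and>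
     (\<forall>f\<in>elems X. \<forall>g\<in>elems X. ae_eq f g \<longrightarrow> ae_eq (T f) (T g)) \<and>
     (\<forall>f\<in>elems X. \<forall>g\<in>elems X. ae_eq (T (\<lambda>x. f x + g x)) (\<lambda>x. T f x + T g x)) \<and>
     (\<forall>c. \<forall>f\<in>elems X. ae_eq (T (\<lambda>x. c * f x)) (\<lambda>x. c * T f x)) \<and>
     (\<exists>C. \<forall>f\<in>elems X. size_of Y (T f) \<le> C * size_of X f)"

definition translation_invariant ::
    "'d::finite tfun function_space \<Rightarrow> ('d tfun \<Rightarrow> 'd tfun) \<Rightarrow> bool" where
  "translation_invariant X T \<longleftrightarrow>
     (\<forall>h. \<forall>f\<in>elems X. ae_eq (T (translate h f)) (translate h (T f)))"

definition admits_invariant_factorization ::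
    "'d::finite tfun function_space \<Rightarrow> 'd tfun function_space \<Rightarrow> 'd tfun function_space \<Rightarrow>
     ('d tfun \<Rightarrow> 'd tfun) \<Rightarrow> bool" where
  "admits_invariant_factorization X Z Y T \<longleftrightarrow>
     (\<exists>A B. bounded_operator X Z A \<and> translation_invariant X A \<and>
            bounded_operator Z Y B \<and> translation_invariant Z B \<and>
            (\<forall>f\<in>elems X. ae_eq (T f) (B (A f))))"


text \<open>
  Schatten norms of operators on \<open>L\<^sub>2\<close>: the singular values of a compact operator \<open>T\<close> are the
  positive square roots \<open>s\<close> of the eigenvalues of \<open>T\<^sup>* T\<close>, each repeated according to the dimension
  of the eigenspace. The norm of a non-compact operator is infinite.
\<close>

definition L2_inner :: "'d::finite tfun \<Rightarrow> 'd tfun \<Rightarrow> complex" where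
  "L2_inner f g = (LINT x|torus_measure. f x * cnj (g x))"

definition is_adjoint :: "('d::finite tfun \<Rightarrow> 'd tfun) \<Rightarrow> ('d tfun \<Rightarrow> 'd tfun) \<Rightarrow> bool" where
  "is_adjoint T S \<longleftrightarrow> bounded_operator (Lp 2) (Lp 2) S \<and>
     (\<forall>f\<in>elems (Lp 2). \<forall>g\<in>elems (Lp 2). L2_inner (T f) g = L2_inner f (S g))"

text \<open>Unique up to \<open>ae_eq\<close>; it exists for bounded \<open>T\<close> by the Riesz representation theorem.\<close>

definition adjoint_op :: "('d::finite tfun \<Rightarrow> 'd tfun) \<Rightarrow> 'd tfun \<Rightarrow> 'd tfun" where
  "adjoint_op T = (SOME S. is_adjoint T S)"

definition compact_operator :: "('d::finite tfun \<Rightarrow> 'd tfun) \<Rightarrow> bool" where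
  "compact_operator T \<longleftrightarrow> bounded_operator (Lp 2) (Lp 2) T \<and>
     (\<forall>f. (\<forall>n. f n \<in> elems (Lp 2) \<and> size_of (Lp 2) (f n) \<le> 1) \<longrightarrow>
        (\<exists>(r :: nat \<Rightarrow> nat) g. strict_mono r \<and> g \<in> elems (Lp 2) \<and>
           (\<lambda>n. size_of (Lp 2) (\<lambda>x. T (f (r n)) x - g x)) \<longlonglongrightarrow> 0))"

definition eigenspace :: "('d::finite tfun \<Rightarrow> 'd tfun) \<Rightarrow> complex \<Rightarrow> 'd tfun set" where
  "eigenspace S c = {f \<in> elems (Lp 2). ae_eq (S f) (\<lambda>x. c * f x)}"

text \<open>Complex dimension modulo \<open>ae_eq\<close>.\<close>

definition ae_independent :: "nat \<Rightarrow> (nat \<Rightarrow> 'd::finite tfun) \<Rightarrow> bool" where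
  "ae_independent n f \<longleftrightarrow>
     (\<forall>c. ae_eq (\<lambda>x. \<Sum>i<n. c i * f i x) (\<lambda>x. 0) \<longrightarrow> (\<forall>i<n. c i = 0))"

definition ae_dim :: "'d::finite tfun set \<Rightarrow> enat" where
  "ae_dim V = Sup {enat n | n. \<exists>f. (\<forall>i<n. f i \<in> V) \<and> ae_independent n f}"

definition singular_mult :: "('d::finite tfun \<Rightarrow> 'd tfun) \<Rightarrow> real \<Rightarrow> enat" where
  "singular_mult T s = ae_dim (eigenspace (\<lambda>f. adjoint_op T (T f)) (of_real (s\<^sup>2)))"

definition singular_power_sum :: "real \<Rightarrow> ('d::finite tfun \<Rightarrow> 'd tfun) \<Rightarrow> ennreal" where
  "singular_power_sum p T =
     (\<Sum>\<^sub>\<infinity>s\<in>{0<..}. ennreal_of_enat (singular_mult T s) * ennreal (s powr p))"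

definition schatten_norm :: "real \<Rightarrow> ('d::finite tfun \<Rightarrow> 'd tfun) \<Rightarrow> ennreal" where
  "schatten_norm p T =
     (if compact_operator T \<and> singular_power_sum p T < \<infinity>
      then ennreal (enn2real (singular_power_sum p T) powr (1 / p)) else \<infinity>)"

end

theory Submission
  imports Defs "HOL-Complex_Analysis.Great_Picard"
begin

text \<open>
  A translation invariant operator is a Fourier multiplier, so \<open>T\<close> has multipliers \<open>m n = a n * b n\<close>,
  where \<open>a\<close> belongs to \<open>L\<^sub>2 \<rightarrow> W\<^sub>1\<^sup>1\<close> and \<open>b\<close> to \<open>W\<^sub>1\<^sup>1 \<rightarrow> L\<^sub>2\<close>. Testing on characters gives
  \<open>\<bar>a n\<bar> \<le> C / \<bar>n\<bar>\<close>, hence \<open>\<bar>m n\<bar> \<ge> \<delta>\<close> forces \<open>\<bar>b n\<bar> \<ge> c \<delta> \<bar>n\<bar>\<close>. The number of such frequencies is bounded by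
  testing \<open>b\<close> on two kinds of functions. A de la Vallee Poussin type kernel shows that a dyadic shell
  contains at most \<open>C \<delta>\<^sup>-\<^sup>2\<close> of them. Among \<open>K\<close> of them in pairwise far apart shells and with directions equal
  up to \<open>1 / K\<close>, one takes a primitive \<open>f\<close> of the Riesz product along the common direction: its
  gradient is bounded in \<open>L\<^sub>1\<close> while its Fourier coefficients at these frequencies are \<open>1 / (2 \<bar>n\<bar>)\<close>,
  so \<open>K \<le> C \<delta>\<^sup>-\<^sup>2\<close>. Splitting the frequencies according to direction and to the shell index modulo \<open>K + 3\<close>
  shows that there are at most \<open>C \<delta> powr - (2 d + 4)\<close> of them, and \<open>\<Sum>n. \<bar>m n\<bar> powr p\<close> converges for
  \<open>p > 2 d + 4\<close>.
\<close>

section \<open>Functions on the torus\<close>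

text \<open>The exponent is a count in powers of 1/\<delta>. With K of order \<delta>^-2 there are
  about K^(d-1) directions, K + 3 residues, at most K occupied shells in a class and \<delta>^-2
  frequencies in a shell: 2(d-1) + 2 + 2 + 2 = 2d + 4. The obstacle is that a Riesz product has L1
  norm 1 at every length, but as a gradient it has to carry one constant vector, while the
  directions of its frequencies vary. An error 1/K in each of K terms still sums to O(1), and this
  fixes the precision of the directions. Derivatives that fall on earlier factors of the product
  cause a second error; growth by a factor 4 * 2^K between consecutive frequencies makes it O(2^-K)
  per term, and this fixes the modulus K + 3. Operators act on representatives, and the Schatten
  norm is built from a chosen adjoint and from dimensions of eigenspaces modulo
  \<open>ae_eq\<close>. Computing either one requires the uniqueness of Fourier coefficients and the
  Riesz-Fischer theorem, which take up the first half.\<close>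

lemma torus_measurable [intro, simp]:
  "f \<in> borel_measurable borel \<Longrightarrow> f \<in> borel_measurable torus_measure"
  unfolding torus_measure_def by (intro measurable_restrict_space1) simp

lemma torus_measurable_to_borel [intro, simp]:
  "f \<in> measurable borel borel \<Longrightarrow> f \<in> measurable torus_measure borel"
  unfolding torus_measure_def by (intro measurable_restrict_space1) simp

lemma emeasure_torus_space: "emeasure torus_measure (space (torus_measure :: (real ^ 'd::finite) measure)) = 1"
proof -
  have "b \<in> Basis \<Longrightarrow> (1 :: real ^ 'd) \<bullet> b = 1" for b
    by (auto simp: Basis_vec_def inner_axis)
  then show ?thesis
    by (simp add: torus_measure_def emeasure_restrict_space space_restrict_space
        emeasure_lborel_cbox_eq inner_diff_left)
qed

interpretation torus: finite_measure "torus_measure :: (real ^ 'd::finite) measure"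
  by standard (simp add: emeasure_torus_space)

lemma measure_torus_space [simp]: "measure torus_measure (space (torus_measure :: (real ^ 'd::finite) measure)) = 1"
  by (simp add: measure_def emeasure_torus_space)

lemma torus_integrable_bounded:
  fixes f :: "real ^ 'd::finite \<Rightarrow> 'b::{banach, second_countable_topology}"
  assumes "f \<in> borel_measurable borel" "\<And>x. norm (f x) \<le> C"
  shows "integrable torus_measure f"
  using assms by (intro torus.integrable_const_bound[where B=C]) auto

text \<open>The half-open cube is an exact fundamental domain, unlike the closed cube carrying
  \<open>torus_measure\<close>.\<close>

definition unit_cube :: "(real ^ 'd) set" where
  "unit_cube = {x. \<forall>i. 0 \<le> x $ i \<and> x $ i < 1}"

lemma unit_cube_borel [measurable]: "(unit_cube :: (real ^ 'd::finite) set) \<in> sets borel"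
  unfolding unit_cube_def by measurable

lemma AE_lborel_cube: "AE x in lborel. x \<in> cbox 0 (1 :: real ^ 'd::finite) \<longleftrightarrow> x \<in> unit_cube"
proof -
  have "AE x in lborel. \<forall>i\<in>UNIV. (x :: real ^ 'd) $ i \<noteq> 1"
  proof (rule AE_finite_allI)
    fix i :: 'd
    have "AE x in lborel. (x :: real ^ 'd) \<bullet> axis i 1 \<noteq> 1"
      by (rule AE_lborel_inner_neq) simp
    then show "AE x in lborel. (x :: real ^ 'd) $ i \<noteq> 1"
      by (simp add: inner_axis)
  qed simp
  then show ?thesis
    by eventually_elim (auto simp: mem_box_cart unit_cube_def less_le)
qed

lemma AE_torus_cube: "AE x in torus_measure. (x :: real ^ 'd::finite) \<in> unit_cube"
  unfolding torus_measure_def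
  by (subst AE_restrict_space_iff) (use AE_lborel_cube in \<open>auto elim!: eventually_mono\<close>)

lemma nn_integral_torus:
  fixes u :: "real ^ 'd::finite \<Rightarrow> ennreal"
  shows "(\<integral>\<^sup>+x. u x \<partial>torus_measure) = (\<integral>\<^sup>+x. u x * indicator unit_cube x \<partial>lborel)"
proof -
  have "(\<integral>\<^sup>+x. u x \<partial>torus_measure) = (\<integral>\<^sup>+x. u x * indicator (cbox 0 1) x \<partial>lborel)"
    unfolding torus_measure_def by (subst nn_integral_restrict_space) auto
  also have "\<dots> = (\<integral>\<^sup>+x. u x * indicator unit_cube x \<partial>lborel)"
    using AE_lborel_cube by (intro nn_integral_cong_AE) (auto elim!: eventually_mono split: split_indicator)
  finally show ?thesis .
qed

definition lattice_vec :: "int ^ 'd \<Rightarrow> real ^ 'd" where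
  "lattice_vec k = (\<chi> i. of_int (k $ i))"

lemma lattice_vec_nth [simp]: "lattice_vec k $ i = of_int (k $ i)"
  by (simp add: lattice_vec_def)

lemma unit_cube_translate_iff:
  "y - lattice_vec k \<in> unit_cube \<longleftrightarrow> k = (\<chi> i. \<lfloor>y $ i\<rfloor>)"
  by (auto simp: unit_cube_def vec_eq_iff) (smt (verit) floor_unique, linarith+)

lemma countable_int_vec [simp]: "countable (A :: (int ^ 'd::finite) set)"
proof -
  have "countable (UNIV :: (int ^ 'd) set)"
  proof (rule countableI')
    show "inj_on (\<lambda>x :: int ^ 'd. to_nat_on (Pi\<^sub>E UNIV (\<lambda>_::'d. UNIV :: int set)) (\<lambda>i. x $ i)) UNIV"
    proof (rule inj_onI)
      fix x y :: "int ^ 'd"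
      have c: "countable (Pi\<^sub>E UNIV (\<lambda>_::'d. UNIV :: int set))"
        by (rule countable_PiE) auto
      assume "to_nat_on (Pi\<^sub>E UNIV (\<lambda>_::'d. UNIV :: int set)) (($) x) = to_nat_on (Pi\<^sub>E UNIV (\<lambda>_::'d. UNIV :: int set)) (($) y)"
      then have "($) x = ($) y"
        using inj_on_to_nat_on[OF c] by (auto simp: inj_on_def)
      then show "x = y" by (simp add: vec_eq_iff)
    qed
  qed
  then show ?thesis by (rule countable_subset[rotated]) simp
qed

section \<open>Translation invariance of the integral over the torus\<close>

lemma nn_integral_lborel_shift:
  fixes f :: "real ^ 'd::finite \<Rightarrow> ennreal"
  assumes [measurable]: "f \<in> borel_measurable borel"
  shows "(\<integral>\<^sup>+x. f (x + c) \<partial>lborel) = (\<integral>\<^sup>+x. f x \<partial>lborel)"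
proof -
  have "(\<integral>\<^sup>+x. f x \<partial>lborel) = (\<integral>\<^sup>+x. f x \<partial>distr lborel borel ((+) c))"
    by (simp add: lborel_distr_plus)
  also have "\<dots> = (\<integral>\<^sup>+x. f (x + c) \<partial>lborel)"
    by (subst nn_integral_distr) (auto simp: add.commute)
  finally show ?thesis ..
qed

lemma nn_integral_cube_partition:
  fixes y :: "real ^ 'd::finite"
  shows "(\<integral>\<^sup>+k. indicator unit_cube (y - lattice_vec k) \<partial>count_space UNIV) = 1"
proof -
  have "indicator unit_cube (y - lattice_vec k) = (indicator {\<chi> i. \<lfloor>y $ i\<rfloor>} k :: ennreal)" for k
    by (simp add: indicator_def unit_cube_translate_iff)
  then show ?thesis by simp
qed

text \<open>The translated cube is cut by the lattice translates of \<open>unit_cube\<close>;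
  periodicity moves each piece back by its lattice vector, and after reindexing k by -k the pieces
  tile \<open>unit_cube\<close>. Tonelli with the counting measure on the lattice exchanges sum and
  integral.\<close>

lemma nn_integral_torus_shift:
  fixes u :: "real ^ 'd::finite \<Rightarrow> ennreal"
  assumes [measurable]: "u \<in> borel_measurable borel"
    and per: "\<And>k x. u (x + lattice_vec k) = u x"
  shows "(\<integral>\<^sup>+x. u (x + h) \<partial>torus_measure) = (\<integral>\<^sup>+x. u x \<partial>torus_measure)"
proof -
  let ?C = "indicator unit_cube :: real ^ 'd \<Rightarrow> ennreal"
  have *: "(\<integral>\<^sup>+x. u x * ?C (x - lattice_vec k) * ?C (x - h) \<partial>lborel)
      = (\<integral>\<^sup>+x. u x * ?C x * ?C ((x - h) - lattice_vec (- k)) \<partial>lborel)" for k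
  proof -
    have "(\<integral>\<^sup>+x. u x * ?C (x - lattice_vec k) * ?C (x - h) \<partial>lborel)
       = (\<integral>\<^sup>+x. u (x + lattice_vec k) * ?C (x + lattice_vec k - lattice_vec k) * ?C (x + lattice_vec k - h) \<partial>lborel)"
      by (subst nn_integral_lborel_shift) simp_all
    moreover have "x + lattice_vec k - h = (x - h) - lattice_vec (- k)" for x :: "real ^ 'd"
      by (simp add: vec_eq_iff)
    ultimately show ?thesis by (simp add: per)
  qed
  have "(\<integral>\<^sup>+x. u (x + h) \<partial>torus_measure) = (\<integral>\<^sup>+x. u (x + h) * ?C (x + h - h) \<partial>lborel)"
    by (simp add: nn_integral_torus)
  also have "\<dots> = (\<integral>\<^sup>+x. u x * ?C (x - h) \<partial>lborel)"
    by (subst nn_integral_lborel_shift[of "\<lambda>x. u x * ?C (x - h)"]) simp_all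
  also have "\<dots> = (\<integral>\<^sup>+x. (\<integral>\<^sup>+k. ?C (x - lattice_vec k) * (u x * ?C (x - h)) \<partial>count_space UNIV) \<partial>lborel)"
    by (subst nn_integral_multc) (simp_all add: nn_integral_cube_partition)
  also have "\<dots> = (\<integral>\<^sup>+x. (\<integral>\<^sup>+k. u x * ?C (x - lattice_vec k) * ?C (x - h) \<partial>count_space UNIV) \<partial>lborel)"
    by (simp add: mult_ac)
  also have "\<dots> = (\<integral>\<^sup>+k. (\<integral>\<^sup>+x. u x * ?C (x - lattice_vec k) * ?C (x - h) \<partial>lborel) \<partial>count_space UNIV)"
    by (intro nn_integral_count_space_nn_integral) simp_all
  also have "\<dots> = (\<integral>\<^sup>+k. (\<integral>\<^sup>+x. u x * ?C x * ?C ((x - h) - lattice_vec (- k)) \<partial>lborel) \<partial>count_space UNIV)"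
    by (simp add: *)
  also have "\<dots> = (\<integral>\<^sup>+k. (\<integral>\<^sup>+x. u x * ?C x * ?C ((x - h) - lattice_vec k) \<partial>lborel) \<partial>count_space UNIV)"
    by (rule nn_integral_bij_count_space[of uminus]) (auto intro!: bij_betw_byWitness[where f'=uminus])
  also have "\<dots> = (\<integral>\<^sup>+x. (\<integral>\<^sup>+k. u x * ?C x * ?C ((x - h) - lattice_vec k) \<partial>count_space UNIV) \<partial>lborel)"
    by (intro nn_integral_count_space_nn_integral[symmetric]) simp_all
  also have "\<dots> = (\<integral>\<^sup>+x. u x * ?C x \<partial>lborel)"
    by (subst nn_integral_cmult) (simp_all add: nn_integral_cube_partition)
  finally show ?thesis by (simp add: nn_integral_torus)
qed

text \<open>The projection to the torus, with values in the fundamental domain. A periodic f equals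
  f composed with \<open>wrap\<close>, so translation invariance becomes equality of two image
  measures and thereby passes from nonnegative to complex integrands.\<close>

definition wrap :: "real ^ 'd \<Rightarrow> real ^ 'd" where
  "wrap x = (\<chi> i. frac (x $ i))"

lemma borel_measurable_vecI:
  fixes f :: "'a \<Rightarrow> real ^ 'd::finite"
  assumes "\<And>i. (\<lambda>x. f x $ i) \<in> borel_measurable M"
  shows "f \<in> borel_measurable M"
  unfolding borel_measurable_euclidean_space[of f] using assms
  by (auto simp: Basis_vec_def inner_axis)

lemma wrap_measurable [measurable]: "(wrap :: real ^ 'd::finite \<Rightarrow> _) \<in> borel \<rightarrow>\<^sub>M borel"
  by (rule borel_measurable_vecI) (simp add: wrap_def frac_def)

lemma wrap_add_lattice_vec [simp]: "wrap (x + lattice_vec k) = wrap x"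
  by (simp add: wrap_def vec_eq_iff)

lemma torus_fun_lattice_vec: "torus_fun f \<Longrightarrow> f (x + lattice_vec k) = f x"
  by (auto simp: torus_fun_def)

lemma torus_fun_wrap:
  assumes "torus_fun f"
  shows "f (wrap x) = f x"
proof -
  have "x = wrap x + lattice_vec (\<chi> i. \<lfloor>x $ i\<rfloor>)"
    by (simp add: wrap_def vec_eq_iff frac_def)
  then show ?thesis using torus_fun_lattice_vec[OF assms] by metis
qed

lemma torus_fun_measurable [simp]: "torus_fun f \<Longrightarrow> f \<in> borel_measurable borel"
  by (simp add: torus_fun_def)

lemma distr_wrap_shift:
  fixes h :: "real ^ 'd::finite"
  shows "distr torus_measure borel (\<lambda>x. wrap (x + h)) = distr torus_measure borel wrap"
proof (rule measure_eqI)
  fix A assume "A \<in> sets (distr torus_measure borel (\<lambda>x. wrap (x + h)))"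
  then have [measurable]: "A \<in> sets borel" by simp
  have 1: "(\<lambda>x. wrap (x + h)) \<in> torus_measure \<rightarrow>\<^sub>M borel" "wrap \<in> torus_measure \<rightarrow>\<^sub>M (borel :: (real ^ 'd) measure)"
    by (auto intro!: torus_measurable_to_borel)
  have "emeasure (distr torus_measure borel (\<lambda>x. wrap (x + h))) A
      = (\<integral>\<^sup>+x. indicator A x \<partial>distr torus_measure borel (\<lambda>x. wrap (x + h)))"
    by simp
  also have "\<dots> = (\<integral>\<^sup>+x. indicator A (wrap (x + h)) \<partial>torus_measure)"
    by (rule nn_integral_distr) (use 1 in auto)
  also have "\<dots> = (\<integral>\<^sup>+x. indicator A (wrap x) \<partial>torus_measure)"
    by (rule nn_integral_torus_shift) auto
  also have "\<dots> = (\<integral>\<^sup>+x. indicator A x \<partial>distr torus_measure borel wrap)"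
    by (rule nn_integral_distr[symmetric]) (use 1 in auto)
  also have "\<dots> = emeasure (distr torus_measure borel wrap) A"
    by simp
  finally show "emeasure (distr torus_measure borel (\<lambda>x. wrap (x + h))) A = emeasure (distr torus_measure borel wrap) A" .
qed simp

lemma wrap_shift_measurable_torus [simp]:
  "(\<lambda>x. wrap (x + h)) \<in> torus_measure \<rightarrow>\<^sub>M (borel :: (real ^ 'd::finite) measure)"
  "wrap \<in> torus_measure \<rightarrow>\<^sub>M (borel :: (real ^ 'd::finite) measure)"
  by (auto intro!: torus_measurable_to_borel)

lemma torus_integral_shift:
  fixes f :: "'d::finite tfun"
  assumes "torus_fun f"
  shows "(LINT x|torus_measure. f (x + h)) = (LINT x|torus_measure. f x)"
proof -
  have [measurable]: "f \<in> borel_measurable borel" using assms by simp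
  have "(LINT x|torus_measure. f (x + h)) = (LINT x|torus_measure. f (wrap (x + h)))"
    by (simp add: torus_fun_wrap[OF assms])
  also have "\<dots> = (LINT x|torus_measure. f (wrap x))"
    using integral_distr[of "\<lambda>x. wrap (x + h)" torus_measure borel f]
      integral_distr[of wrap torus_measure borel f] by (simp add: distr_wrap_shift)
  finally show ?thesis by (simp add: torus_fun_wrap[OF assms])
qed

lemma torus_integrable_shift_imp:
  fixes f :: "'d::finite tfun"
  assumes "torus_fun f" "integrable torus_measure f"
  shows "integrable torus_measure (\<lambda>x. f (x + h))"
proof -
  have [measurable]: "f \<in> borel_measurable borel" using assms by simp
  have "integrable torus_measure (\<lambda>x. f (wrap (x + h)))"
    using integrable_distr_eq[of "\<lambda>x. wrap (x + h)" torus_measure borel f]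
      integrable_distr_eq[of wrap torus_measure borel f] assms
    by (simp add: distr_wrap_shift torus_fun_wrap)
  then show ?thesis by (simp add: torus_fun_wrap[OF assms(1)])
qed

lemma torus_fun_translate: "torus_fun f \<Longrightarrow> torus_fun (translate h f)"
proof -
  assume a: "torus_fun f"
  then have [measurable]: "f \<in> borel_measurable borel" by simp
  have "f (x + k - h) = f (x - h)" if "\<And>i. k $ i \<in> \<int>" for x k
  proof -
    have "f ((x - h) + k) = f (x - h)" using a that unfolding torus_fun_def by blast
    moreover have "x + k - h = (x - h) + k" by simp
    ultimately show ?thesis by (simp only:)
  qed
  then show ?thesis
    unfolding torus_fun_def translate_def by auto
qed

lemma ae_eq_refl [simp, intro]: "ae_eq f f"
  by (simp add: ae_eq_def)

lemma ae_eq_sym: "ae_eq f g \<Longrightarrow> ae_eq g f"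
  by (auto simp: ae_eq_def elim!: eventually_mono)

lemma ae_eq_trans [trans]: "ae_eq f g \<Longrightarrow> ae_eq g h \<Longrightarrow> ae_eq f h"
  unfolding ae_eq_def by (rule eventually_elim2) auto

lemma ae_eq_cmult: "ae_eq f g \<Longrightarrow> ae_eq (\<lambda>x. c * f x) (\<lambda>x. c * g x)"
  unfolding ae_eq_def by (rule eventually_mono) auto

section \<open>Characters and Fourier coefficients\<close>

definition chi :: "int ^ 'd \<Rightarrow> 'd::finite tfun" where
  "chi n x = cis (2 * pi * (\<Sum>i\<in>UNIV. of_int (n $ i) * x $ i))"

lemma norm_chi [simp]: "norm (chi n x) = 1"
  by (simp add: chi_def)

lemma chi_nonzero [simp]: "chi n x \<noteq> 0"
  by (simp add: chi_def)

lemma chi_add: "chi (m + n) x = chi m x * chi n x"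
  by (simp add: chi_def cis_mult algebra_simps sum.distrib)

lemma chi_zero [simp]: "chi 0 x = 1"
  by (simp add: chi_def)

lemma chi_minus: "chi (- n) x = cnj (chi n x)"
  by (simp add: chi_def cis_cnj sum_negf)

lemma chi_shift: "chi n (x + y) = chi n x * chi n y"
  by (simp add: chi_def cis_mult algebra_simps sum.distrib)

lemma chi_cancel [simp]: "chi n x * chi (- n) x = 1" "chi (- n) x * chi n x = 1"
  by (simp_all flip: chi_add)

lemma chi_lattice: "(\<And>i. k $ i \<in> \<int>) \<Longrightarrow> chi n k = 1"
proof -
  assume "\<And>i. k $ i \<in> \<int>"
  then have "(\<Sum>i\<in>UNIV. of_int (n $ i) * k $ i) \<in> \<int>"
    by (intro Ints_sum Ints_mult) auto
  then show ?thesis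
    unfolding chi_def by (auto elim!: Ints_cases simp: cis_multiple_2pi)
qed

lemma chi_continuous [continuous_intros]: "continuous_on A (chi n)"
  unfolding chi_def cis_conv_exp by (intro continuous_intros)

lemma chi_measurable [measurable]: "chi n \<in> borel_measurable borel"
  by (rule borel_measurable_continuous_onI) (rule chi_continuous)

lemma torus_fun_chi [simp, intro]: "torus_fun (chi n)"
  unfolding torus_fun_def by (auto simp: chi_shift chi_lattice)

lemma torus_fun_mult: "torus_fun f \<Longrightarrow> torus_fun g \<Longrightarrow> torus_fun (\<lambda>x. f x * g x)"
  unfolding torus_fun_def by auto

lemma torus_fun_add: "torus_fun f \<Longrightarrow> torus_fun g \<Longrightarrow> torus_fun (\<lambda>x. f x + g x)"
  unfolding torus_fun_def by auto

lemma torus_fun_const [simp]: "torus_fun (\<lambda>x. c)"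
  unfolding torus_fun_def by auto

lemma torus_fun_cmult: "torus_fun f \<Longrightarrow> torus_fun (\<lambda>x. c * f x)"
  unfolding torus_fun_def by auto

lemma torus_fun_diff: "torus_fun f \<Longrightarrow> torus_fun g \<Longrightarrow> torus_fun (\<lambda>x. f x - g x)"
  unfolding torus_fun_def by auto

text \<open>Half a period in a coordinate where n does not vanish. Such a shift yields the
  orthogonality of characters and, applied to a difference of frequencies, the diagonality of
  invariant operators.\<close>

lemma chi_eq_minus_1: "n \<noteq> 0 \<Longrightarrow> \<exists>h. chi n h = - 1" for n :: "int ^ 'd::finite"
proof -
  assume "n \<noteq> 0"
  then obtain i where i: "n $ i \<noteq> 0" by (auto simp: vec_eq_iff)
  define h :: "real ^ 'd" where "h = axis i (1 / (2 * of_int (n $ i)))"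
  have "(\<Sum>j\<in>UNIV. of_int (n $ j) * h $ j) = of_int (n $ i) * h $ i"
    by (subst sum.remove[of _ i]) (auto simp: h_def axis_def intro!: sum.neutral)
  then have "(\<Sum>j\<in>UNIV. of_int (n $ j) * h $ j) = 1 / 2"
    using i by (simp add: h_def)
  then have "chi n h = - 1" unfolding chi_def by (simp only:) simp
  then show ?thesis by blast
qed

text \<open>For nonzero n the substitution x + h with \<open>chi n h = - 1\<close> changes the sign
  of the integral but not its value.\<close>

lemma integral_chi: "(LINT x|torus_measure. chi n x) = (if n = 0 then 1 else 0)" for n :: "int ^ 'd::finite"
proof (cases "n = 0")
  case False
  then obtain h where h: "chi n h = - 1" using chi_eq_minus_1 by blast
  have "(LINT x|torus_measure. chi n x) = (LINT x|torus_measure. chi n (x + h))"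
    by (simp add: torus_integral_shift)
  also have "\<dots> = - (LINT x|torus_measure. chi n x)"
    by (simp add: chi_shift h)
  finally show ?thesis using False by simp
qed simp

definition coef :: "'d::finite tfun \<Rightarrow> int ^ 'd \<Rightarrow> complex" where
  "coef f n = (LINT x|torus_measure. f x * chi (- n) x)"

lemma integrable_mult_chi [simp]:
  assumes "integrable torus_measure f"
  shows "integrable torus_measure (\<lambda>x. f x * chi n x)"
proof (rule Bochner_Integration.integrable_bound[OF assms])
  show "(\<lambda>x. f x * chi n x) \<in> borel_measurable torus_measure"
    using assms by (intro borel_measurable_times) auto
qed (simp add: norm_mult)

lemma coef_chi: "coef (chi m) n = (if m = n then 1 else 0)"
proof -
  have "coef (chi m) n = (LINT x|torus_measure. chi (m - n) x)"
    by (simp add: coef_def flip: chi_add)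
  then show ?thesis by (auto simp: integral_chi)
qed

lemma coef_add:
  "integrable torus_measure f \<Longrightarrow> integrable torus_measure g \<Longrightarrow> coef (\<lambda>x. f x + g x) n = coef f n + coef g n"
  by (simp add: coef_def algebra_simps)

lemma coef_diff:
  "integrable torus_measure f \<Longrightarrow> integrable torus_measure g \<Longrightarrow> coef (\<lambda>x. f x - g x) n = coef f n - coef g n"
  by (simp add: coef_def algebra_simps)

lemma coef_cmult: "coef (\<lambda>x. c * f x) n = c * coef f n"
  by (simp add: coef_def mult.assoc)

lemma coef_sum:
  "(\<And>i. i \<in> I \<Longrightarrow> integrable torus_measure (f i)) \<Longrightarrow> coef (\<lambda>x. \<Sum>i\<in>I. f i x) n = (\<Sum>i\<in>I. coef (f i) n)"
  by (simp add: coef_def sum_distrib_right)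

lemma coef_mult_chi: "coef (\<lambda>x. f x * chi m x) n = coef f (n - m)"
proof -
  have "chi (- (n - m)) x = chi m x * chi (- n) x" for x
    by (simp flip: chi_add)
  then show ?thesis by (simp add: coef_def mult.assoc)
qed

lemma coef_cong:
  assumes "torus_fun f" "torus_fun g" "ae_eq f g"
  shows "coef f n = coef g n"
  unfolding coef_def using assms
  by (intro integral_cong_AE) (auto simp: ae_eq_def elim!: eventually_mono intro!: torus_measurable borel_measurable_times)

lemma coef_translate:
  assumes "torus_fun f"
  shows "coef (translate h f) n = chi n (- h) * coef f n"
proof -
  have "coef (translate h f) n = (LINT x|torus_measure. f (x + - h) * (chi (- n) (x + - h) * chi n (- h)))"
    unfolding coef_def translate_def
  proof (rule Bochner_Integration.integral_cong)
    fix x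
    have "chi (- n) x = chi (- n) (x + - h) * chi (- n) h" by (simp flip: chi_shift)
    moreover have "chi (-n) h = chi n (- h)"
      by (simp add: chi_def sum_negf)
    ultimately show "f (x - h) * chi (- n) x = f (x + - h) * (chi (- n) (x + - h) * chi n (- h))"
      by simp
  qed simp
  also have "\<dots> = (LINT x|torus_measure. f x * (chi (- n) x * chi n (- h)))"
    by (rule torus_integral_shift) (intro torus_fun_mult assms torus_fun_chi torus_fun_const)
  also have "\<dots> = chi n (- h) * coef f n"
    by (simp add: coef_def flip: mult.assoc)
  finally show ?thesis .
qed

lemma norm_coef_le:
  assumes "integrable torus_measure f"
  shows "norm (coef f n) \<le> (LINT x|torus_measure. norm (f x))"
proof -
  have "norm (coef f n) \<le> (LINT x|torus_measure. norm (f x * chi (- n) x))"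
    unfolding coef_def by (rule integral_norm_bound)
  then show ?thesis by (simp add: norm_mult)
qed

section \<open>Trigonometric polynomials and uniqueness of Fourier coefficients\<close>

text \<open>A trigonometric polynomial together with its gradient.\<close>

inductive tpoly :: "'d::finite tfun \<Rightarrow> ('d \<Rightarrow> 'd tfun) \<Rightarrow> bool" where
  tpoly_chi: "tpoly (chi n) (\<lambda>l x. 2 * pi * \<i> * of_int (n $ l) * chi n x)"
| tpoly_add: "tpoly f F \<Longrightarrow> tpoly g G \<Longrightarrow> tpoly (\<lambda>x. f x + g x) (\<lambda>l x. F l x + G l x)"
| tpoly_cmult: "tpoly f F \<Longrightarrow> tpoly (\<lambda>x. c * f x) (\<lambda>l x. c * F l x)"

lemma tpoly_cong:
  "tpoly f F \<Longrightarrow> (\<And>x. f x = g x) \<Longrightarrow> (\<And>l x. F l x = G l x) \<Longrightarrow> tpoly g G"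
proof -
  assume "tpoly f F" "\<And>x. f x = g x" "\<And>l x. F l x = G l x"
  moreover from this have "f = g" "F = G" by (auto simp: fun_eq_iff)
  ultimately show ?thesis by simp
qed

lemma tpoly_const: "tpoly (\<lambda>x. c) (\<lambda>l x. 0)"
  by (rule tpoly_cong[OF tpoly_cmult[OF tpoly_chi[of 0], of c]]) auto

lemma tpoly_chi_mult:
  assumes "tpoly g G"
  shows "tpoly (\<lambda>x. chi n x * g x) (\<lambda>l x. chi n x * G l x + 2 * pi * \<i> * of_int (n $ l) * chi n x * g x)"
  using assms
proof induction
  case (tpoly_chi m)
  show ?case
    by (rule tpoly_cong[OF tpoly.tpoly_chi[of "n + m"]]) (auto simp: chi_add algebra_simps)
next
  case (tpoly_add f F g G)
  show ?case
    by (rule tpoly_cong[OF tpoly.tpoly_add[OF tpoly_add.IH]]) (auto simp: algebra_simps)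
next
  case (tpoly_cmult f F c)
  show ?case
    by (rule tpoly_cong[OF tpoly.tpoly_cmult[OF tpoly_cmult.IH]]) (auto simp: algebra_simps)
qed

lemma tpoly_mult:
  assumes "tpoly f F" "tpoly g G"
  shows "tpoly (\<lambda>x. f x * g x) (\<lambda>l x. f x * G l x + F l x * g x)"
  using assms(1)
proof induction
  case (tpoly_chi m)
  show ?case
    by (rule tpoly_chi_mult[OF assms(2)])
next
  case (tpoly_add f F h H)
  show ?case
    by (rule tpoly_cong[OF tpoly.tpoly_add[OF tpoly_add.IH]]) (auto simp: algebra_simps)
next
  case (tpoly_cmult f F c)
  show ?case
    by (rule tpoly_cong[OF tpoly.tpoly_cmult[OF tpoly_cmult.IH]]) (auto simp: algebra_simps)
qed

lemma tpoly_sum: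
  "(\<And>i. i \<in> I \<Longrightarrow> tpoly (f i) (F i)) \<Longrightarrow> tpoly (\<lambda>x. \<Sum>i\<in>I. f i x) (\<lambda>l x. \<Sum>i\<in>I. F i l x)"
  by (induction I rule: infinite_finite_induct) (simp_all add: tpoly_const tpoly_add)

lemma tpoly_prod:
  "(\<And>i. i \<in> I \<Longrightarrow> \<exists>F. tpoly (f i) F) \<Longrightarrow> \<exists>F. tpoly (\<lambda>x. \<Prod>i\<in>I. f i x) F"
proof (induction I rule: infinite_finite_induct)
  case (insert i I)
  then obtain F G where "tpoly (f i) F" "tpoly (\<lambda>x. \<Prod>i\<in>I. f i x) G" by blast
  with insert(1,2) show ?case using tpoly_mult by fastforce
qed (auto intro: tpoly_const)

lemma tpoly_torus_fun: "tpoly f F \<Longrightarrow> torus_fun f"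
  by (induction rule: tpoly.induct) (auto intro: torus_fun_add torus_fun_cmult)

lemma tpoly_torus_fun': "tpoly f F \<Longrightarrow> torus_fun (F l)"
  by (induction rule: tpoly.induct) (auto intro: torus_fun_add torus_fun_cmult)

lemma tpoly_bounded: "tpoly f F \<Longrightarrow> \<exists>C. \<forall>x. norm (f x) \<le> C"
proof (induction rule: tpoly.induct)
  case (tpoly_add f F g G)
  then obtain C D where "\<forall>x. norm (f x) \<le> C" "\<forall>x. norm (g x) \<le> D" by auto
  then have "\<forall>x. norm (f x + g x) \<le> C + D" by (auto intro: norm_triangle_mono)
  then show ?case by blast
next
  case (tpoly_cmult f F c)
  then obtain C where "\<forall>x. norm (f x) \<le> C" by auto
  then have "\<forall>x. norm (c * f x) \<le> norm c * C" by (auto simp: norm_mult intro: mult_left_mono)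
  then show ?case by blast
qed auto

lemma tpoly_bounded': "tpoly f F \<Longrightarrow> \<exists>C. \<forall>x. norm (F l x) \<le> C"
proof (induction rule: tpoly.induct)
  case (tpoly_chi n)
  show ?case by (auto simp: norm_mult)
next
  case (tpoly_add f F g G)
  then obtain C D where "\<forall>x. norm (F l x) \<le> C" "\<forall>x. norm (G l x) \<le> D" by auto
  then have "\<forall>x. norm (F l x + G l x) \<le> C + D" by (auto intro: norm_triangle_mono)
  then show ?case by blast
next
  case (tpoly_cmult f F c)
  then obtain C where "\<forall>x. norm (F l x) \<le> C" by auto
  then have "\<forall>x. norm (c * F l x) \<le> norm c * C" by (auto simp: norm_mult intro: mult_left_mono)
  then show ?case by blast
qed

lemma tpoly_integrable: "tpoly f F \<Longrightarrow> integrable torus_measure f"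
  using tpoly_bounded[of f F] tpoly_torus_fun[of f F] by (auto intro: torus_integrable_bounded)

lemma tpoly_integrable': "tpoly f F \<Longrightarrow> integrable torus_measure (F l)"
  using tpoly_bounded'[of f F l] tpoly_torus_fun'[of f F l] by (auto intro: torus_integrable_bounded)

section \<open>Uniqueness of Fourier coefficients of integrable functions\<close>

lemma integral_mult_tpoly_eq_0:
  assumes "integrable torus_measure f" "\<And>n. coef f n = 0" "tpoly g G"
  shows "integrable torus_measure (\<lambda>x. f x * g x) \<and> (LINT x|torus_measure. f x * g x) = 0"
  using assms(3)
proof induction
  case (tpoly_chi n)
  then show ?case using assms(1) assms(2)[of "- n"] by (auto simp: coef_def)
qed (auto simp: algebra_simps)

text \<open>The angles 2 pi x with 0 \<le> x \<le> c form the arc of radius pi c about pi c, and an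
  arc is a superlevel set of the cosine. Membership in an interval thus becomes a sign condition on
  a trigonometric polynomial.\<close>

lemma cos_ge_iff:
  fixes x c :: real
  assumes "0 \<le> x" "x < 1" "0 \<le> c" "c \<le> 1"
  shows "cos (2 * pi * (x - c / 2)) \<ge> cos (pi * c) \<longleftrightarrow> x \<le> c"
proof
  assume "x \<le> c"
  have "cos (pi * c) \<le> cos \<bar>2 * pi * (x - c / 2)\<bar>"
  proof (rule cos_monotone_0_pi_le)
    have "\<bar>2 * pi * (x - c / 2)\<bar> = pi * \<bar>2 * x - c\<bar>"
    proof -
      have "2 * pi * (x - c / 2) = pi * (2 * x - c)" by (simp add: algebra_simps)
      then show ?thesis by (simp only: abs_mult) simp
    qed
    also have "\<dots> \<le> pi * c"
      using \<open>x \<le> c\<close> assms by (intro mult_left_mono) auto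
    finally show "\<bar>2 * pi * (x - c / 2)\<bar> \<le> pi * c" .
  qed (use assms in auto)
  then show "cos (2 * pi * (x - c / 2)) \<ge> cos (pi * c)" by simp
next
  assume *: "cos (2 * pi * (x - c / 2)) \<ge> cos (pi * c)"
  show "x \<le> c"
  proof (rule ccontr)
    assume "\<not> x \<le> c"
    then have 1: "pi * c < 2 * pi * (x - c / 2)" by (simp add: algebra_simps)
    have "pi * x < pi" using assms by simp
    then have 2: "2 * pi * (x - c / 2) < 2 * pi - pi * c" by (simp add: algebra_simps)
    have "0 \<le> pi * c" using assms by simp
    show False
    proof (cases "2 * pi * (x - c / 2) \<le> pi")
      case True
      with 1 \<open>0 \<le> pi * c\<close> have "cos (2 * pi * (x - c / 2)) < cos (pi * c)"
        by (intro cos_monotone_0_pi) auto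
      with * show False by simp
    next
      case False
      have "cos (2 * pi * (x - c / 2)) = cos (2 * pi - 2 * pi * (x - c / 2))"
        by (metis cos_2pi_minus)
      also have "\<dots> < cos (pi * c)"
        using False 2 \<open>0 \<le> pi * c\<close> by (intro cos_monotone_0_pi) auto
      finally show False using * by simp
    qed
  qed
qed

lemma tpoly_cos_coordinate: "\<exists>F. tpoly (\<lambda>x. complex_of_real (cos (2 * pi * (x $ i - a)) - b)) F"
proof -
  define k :: "int ^ 'a" where "k = axis i 1"
  have k: "(\<Sum>j\<in>UNIV. of_int (k $ j) * x $ j) = x $ i" for x :: "real ^ 'a"
    by (subst sum.remove[of _ i]) (auto simp: k_def axis_def intro!: sum.neutral)
  have "complex_of_real (cos (2 * pi * (x $ i - a)) - b)
      = cis (- (2 * pi * a)) / 2 * chi k x + (cis (2 * pi * a) / 2 * chi (- k) x + - of_real b)" for x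
    unfolding chi_minus unfolding chi_def k
    by (simp add: complex_eq_iff cos_diff algebra_simps add_divide_distrib diff_divide_distrib)
  moreover have "\<exists>F. tpoly (\<lambda>x. cis (- (2 * pi * a)) / 2 * chi k x + (cis (2 * pi * a) / 2 * chi (- k) x + - of_real b)) F"
    by (intro exI, rule tpoly_add, rule tpoly_cmult, rule tpoly_chi, rule tpoly_add, rule tpoly_cmult, rule tpoly_chi, rule tpoly_const)
  ultimately show ?thesis by (simp only:)
qed

lemma tpoly_polynomial:
  assumes "real_polynomial_function p" "\<exists>F. tpoly (\<lambda>x. complex_of_real (q x)) F"
  shows "\<exists>F. tpoly (\<lambda>x. complex_of_real (p (q x))) F"
  using assms(1)
proof (induction rule: real_polynomial_function.induct)
  case (linear f)
  then have "f t = f 1 * t" for t :: real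
    by (metis linear_simps(5) mult.commute mult.right_neutral real_scaleR_def)
  then have "complex_of_real (f (q x)) = of_real (f 1) * of_real (q x)" for x
    by (metis of_real_mult)
  moreover have "\<exists>F. tpoly (\<lambda>x. of_real (f 1) * complex_of_real (q x)) F"
    using assms(2) tpoly_cmult by blast
  ultimately show ?case by (simp only:)
next
  case (const c)
  show ?case using tpoly_const by blast
next
  case (add f g)
  then show ?case using tpoly_add by (fastforce simp: of_real_add)
next
  case (mult f g)
  then show ?case using tpoly_mult by (fastforce simp: of_real_mult)
qed

text \<open>Inside the cube, \<open>{..a}\<close> is where finitely many real trigonometric polynomials \<open>q i\<close> are
  nonnegative, so its indicator is a bounded limit of products of polynomials in the \<open>q i\<close>.\<close>

lemma integral_atMost_eq_0:
  fixes f :: "'d::finite tfun"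
  assumes f: "torus_fun f" "integrable torus_measure f" "\<And>n. coef f n = 0"
  shows "(LINT x|torus_measure. indicator {..a} x *\<^sub>R f x) = 0"
proof (cases "\<forall>i. 0 \<le> a $ i")
  case False
  then obtain i where i: "\<not> 0 \<le> a $ i" by auto
  have "indicator {..a} x *\<^sub>R f x = 0" if "x \<in> unit_cube" for x
  proof -
    have "\<not> x \<le> a"
      using that i unfolding unit_cube_def less_eq_vec_def by (metis (mono_tags, lifting) mem_Collect_eq order_trans)
    then show ?thesis by simp
  qed
  note * = this
  have "(LINT x|torus_measure. indicator {..a} x *\<^sub>R f x) = (LINT x|(torus_measure :: (real ^ 'd) measure). 0)"
  proof (rule integral_cong_AE)
    show "AE x in torus_measure. indicator {..a} x *\<^sub>R f x = 0"
      using AE_torus_cube by (rule eventually_mono) (rule *)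
  qed (use f(1) in \<open>auto intro!: torus_measurable borel_measurable_scaleR\<close>)
  then show ?thesis by simp
next
  case True
  \<comment> \<open>Coordinates in the cube stay below 1, so capping at 1 changes nothing there and
    brings the bound into the range of \<open>cos_ge_iff\<close>.\<close>
  define c where "c i = min 1 (a $ i)" for i
  define q where "q i x = cos (2 * pi * (x $ i - c i / 2)) - cos (pi * c i)" for i and x :: "real ^ 'd"
  \<comment> \<open>A ramp that equals 1 for t \<ge> 0 and vanishes for t \<le> -1/m. Weierstrass
    approximation up to 1/(m+1) on [-2,2], the range of the \<open>q i\<close>, gives polynomials
    bounded by 2 that converge pointwise to the indicator of t \<ge> 0.\<close>
  define \<phi> where "\<phi> m t = max 0 (min 1 (1 + real m * t))" for m t
  have "\<exists>p. real_polynomial_function p \<and> (\<forall>t\<in>{-2..2}. \<bar>\<phi> m t - p t\<bar> < 1 / (real m + 1))" for m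
  proof -
    have "continuous_on {-2..2} (\<phi> m)" unfolding \<phi>_def by (intro continuous_intros)
    from Stone_Weierstrass_real_polynomial_function[OF compact_Icc this, of "1 / (real m + 1)"]
    show ?thesis by (metis of_nat_0_le_iff zero_less_divide_1_iff add_nonneg_pos zero_less_one)
  qed
  then obtain p where p: "\<And>m. real_polynomial_function (p m)"
      "\<And>m t. t \<in> {-2..2} \<Longrightarrow> \<bar>\<phi> m t - p m t\<bar> < 1 / (real m + 1)" by metis
  have q: "q i x \<in> {-2..2}" for i x
  proof -
    have "- 1 \<le> cos u \<and> cos u \<le> 1" for u :: real by simp
    from this[of "2 * pi * (x $ i - c i / 2)"] this[of "pi * c i"]
    show ?thesis unfolding q_def atLeastAtMost_iff by linarith
  qed
  have lim: "(\<lambda>m. p m t) \<longlonglongrightarrow> indicator {0..} t" if "t \<in> {-2..2}" for t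
  proof -
    have 1: "(\<lambda>m. p m t - \<phi> m t) \<longlonglongrightarrow> 0"
    proof (rule tendsto_rabs_zero_cancel, rule real_tendsto_sandwich[where f="\<lambda>_. 0"])
      show "(\<lambda>m. 1 / (real m + 1)) \<longlonglongrightarrow> 0"
        using LIMSEQ_inverse_real_of_nat by (simp add: inverse_eq_divide add.commute)
      show "eventually (\<lambda>m. \<bar>p m t - \<phi> m t\<bar> \<le> 1 / (real m + 1)) sequentially"
        using p(2)[OF that] by (auto simp: abs_minus_commute intro!: always_eventually less_imp_le)
    qed auto
    have 2: "(\<lambda>m. \<phi> m t) \<longlonglongrightarrow> indicator {0..} t"
    proof (cases "t \<ge> 0")
      case True
      then have "\<phi> m t = 1" for m by (simp add: \<phi>_def)
      then show ?thesis using True by simp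
    next
      case False
      have "eventually (\<lambda>m. \<phi> m t = 0) sequentially"
      proof -
        obtain N :: nat where N: "1 / (- t) < real N" using reals_Archimedean2 by blast
        have "\<phi> m t = 0" if "m \<ge> N" for m
        proof -
          have "1 / (- t) < real m" using N that by linarith
          moreover have "0 < - t" using False by simp
          ultimately have "1 < real m * (- t)" by (simp only: pos_divide_less_eq)
          then show ?thesis by (simp add: \<phi>_def)
        qed
        then show ?thesis by (auto simp: eventually_sequentially)
      qed
      then show ?thesis using False by (auto intro: tendsto_eventually)
    qed
    show ?thesis using tendsto_add[OF 1 2] by simp
  qed
  have bd: "\<bar>p m t\<bar> \<le> 2" if "t \<in> {-2..2}" for m t
  proof -
    have "1 / (real m + 1) \<le> 1" by simp
    moreover have "\<bar>\<phi> m t\<bar> \<le> 1" by (auto simp: \<phi>_def)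
    ultimately show ?thesis using p(2)[OF that, of m] by linarith
  qed
  define g where "g m x = complex_of_real (\<Prod>i\<in>UNIV. p m (q i x))" for m x
  have tpg: "\<exists>G. tpoly (g m) G" for m
    unfolding g_def of_real_prod q_def
    by (intro tpoly_prod tpoly_polynomial[OF p(1)] tpoly_cos_coordinate)
  have meas: "(\<lambda>x. g m x) \<in> borel_measurable borel" for m
    using tpg tpoly_torus_fun torus_fun_measurable by blast
  have ind: "complex_of_real (\<Prod>i\<in>UNIV. indicator {0..} (q i x)) * f x = indicator {..a} x *\<^sub>R f x"
    if "x \<in> unit_cube" for x
  proof -
    have "indicator {0..} (q i x) = (if x $ i \<le> a $ i then 1 else 0 :: real)" for i
    proof -
      have "q i x \<ge> 0 \<longleftrightarrow> x $ i \<le> c i"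
      proof -
        have "0 \<le> x $ i" "x $ i < 1" "0 \<le> c i" "c i \<le> 1"
          using that True by (simp_all add: unit_cube_def c_def)
        from cos_ge_iff[OF this] show ?thesis unfolding q_def by (simp only: diff_ge_0_iff_ge)
      qed
      moreover have "x $ i \<le> c i \<longleftrightarrow> x $ i \<le> a $ i"
      proof -
        have "x $ i < 1" using that by (simp add: unit_cube_def)
        then show ?thesis by (simp add: c_def)
      qed
      ultimately show ?thesis by (simp add: indicator_def)
    qed
    then have "(\<Prod>i\<in>UNIV. indicator {0..} (q i x)) = (indicator {..a} x :: real)"
      by (auto simp: indicator_def less_eq_vec_def)
    then show ?thesis by (simp add: scaleR_conv_of_real)
  qed
  have "(\<lambda>m. LINT x|torus_measure. g m x * f x) \<longlonglongrightarrow> (LINT x|torus_measure. indicator {..a} x *\<^sub>R f x)"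
  proof (rule integral_dominated_convergence[where w="\<lambda>x. 2 ^ CARD('d) * norm (f x)"])
    show "AE x in torus_measure. (\<lambda>m. g m x * f x) \<longlonglongrightarrow> indicator {..a} x *\<^sub>R f x"
      using AE_torus_cube
    proof (rule eventually_mono)
      fix x :: "real ^ 'd" assume x: "x \<in> unit_cube"
      have "(\<lambda>m. g m x * f x) \<longlonglongrightarrow> complex_of_real (\<Prod>i\<in>UNIV. indicator {0..} (q i x)) * f x"
        unfolding g_def by (intro tendsto_intros lim q)
      then show "(\<lambda>m. g m x * f x) \<longlonglongrightarrow> indicator {..a} x *\<^sub>R f x" by (simp only: ind[OF x])
    qed
    show "AE x in torus_measure. norm (g m x * f x) \<le> 2 ^ CARD('d) * norm (f x)" for m
    proof (rule AE_I2)
      fix x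
      have "norm (g m x) \<le> (\<Prod>i\<in>(UNIV :: 'd set). 2)"
        unfolding g_def norm_of_real abs_prod by (intro prod_mono conjI bd q) auto
      then show "norm (g m x * f x) \<le> 2 ^ CARD('d) * norm (f x)"
        by (simp add: norm_mult mult_right_mono)
    qed
  qed (use f meas in \<open>auto intro!: torus_measurable borel_measurable_times borel_measurable_scaleR\<close>)
  moreover have "(LINT x|torus_measure. g m x * f x) = 0" for m
    using tpg[of m] integral_mult_tpoly_eq_0[OF f(2,3)] by (subst mult.commute) blast
  ultimately show ?thesis by (simp add: LIMSEQ_const_iff)
qed

text \<open>The sets \<open>{..a}\<close> form an intersection-stable generator of the Borel sets.
  Vanishing of the integral passes to complements because the coefficient at 0 is the full integral,
  and to disjoint unions by dominated convergence.\<close>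

lemma integral_indicator_eq_0:
  fixes f :: "'d::finite tfun"
  assumes f: "torus_fun f" "integrable torus_measure f" "\<And>n. coef f n = 0" and A: "A \<in> sets borel"
  shows "(LINT x|torus_measure. indicator A x *\<^sub>R f x) = 0"
proof -
  have int: "integrable torus_measure (\<lambda>x. indicator A x *\<^sub>R f x)" if [measurable]: "A \<in> sets borel" for A
    by (rule Bochner_Integration.integrable_bound[OF f(2)])
      (use f in \<open>auto intro!: torus_measurable borel_measurable_scaleR simp: indicator_def\<close>)
  have borel: "sets borel = sigma_sets UNIV (range (\<lambda>a. {..a :: real ^ 'd}))"
    by (subst borel_eq_atMost) (simp add: sets_measure_of_conv)
  have "Int_stable (range (\<lambda>a. {..a :: real ^ 'd}))"
    proof (rule Int_stableI)
      fix a b assume "a \<in> range (\<lambda>a. {..a :: real ^ 'd})" "b \<in> range (\<lambda>a. {..a :: real ^ 'd})"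
      then obtain u v where "a = {..u}" "b = {..v}" by auto
      then have "a \<inter> b = {..(\<chi> i. min (u $ i) (v $ i))}" by (auto simp: less_eq_vec_def)
      then show "a \<inter> b \<in> range (\<lambda>a. {..a :: real ^ 'd})" by blast
    qed
  moreover have "range (\<lambda>a. {..a :: real ^ 'd}) \<subseteq> Pow UNIV" by simp
  moreover have "A \<in> sigma_sets UNIV (range (\<lambda>a. {..a :: real ^ 'd}))" using A borel by simp
  ultimately show ?thesis
  proof (induction rule: sigma_sets_induct_disjoint)
    case (basic A)
    then show ?case using integral_atMost_eq_0[OF f] by auto
  next
    case empty
    show ?case by simp
  next
    case (compl A)
    then have "A \<in> sets borel" using borel by simp
    have "(LINT x|torus_measure. indicator (UNIV - A) x *\<^sub>R f x) = (LINT x|torus_measure. f x - indicator A x *\<^sub>R f x)"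
      by (intro Bochner_Integration.integral_cong) (auto simp: indicator_def)
    also have "\<dots> = (LINT x|torus_measure. f x) - (LINT x|torus_measure. indicator A x *\<^sub>R f x)"
      by (intro Bochner_Integration.integral_diff f int \<open>A \<in> sets borel\<close>)
    also have "\<dots> = 0" using compl f(3)[of 0] by (simp add: coef_def)
    finally show ?case .
  next
    case (union A)
    have A: "A i \<in> sets borel" for i using union(2) borel by auto
    define B where "B N = (\<Union>i<N. A i)" for N :: nat
    have B: "B N \<in> sets borel" for N unfolding B_def using A by auto
    have "(LINT x|torus_measure. indicator (B N) x *\<^sub>R f x) = 0" for N
    proof (induction N)
      case (Suc N)
      have "A i \<inter> A N = {}" if "i < N" for i
        using union(1) that unfolding disjoint_family_on_def by (metis UNIV_I less_irrefl)
      then have "B N \<inter> A N = {}" unfolding B_def by auto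
      then have "indicator (B (Suc N)) x *\<^sub>R f x = indicator (B N) x *\<^sub>R f x + indicator (A N) x *\<^sub>R f x" for x
        by (auto simp: B_def lessThan_Suc indicator_def)
      then show ?case using Suc union(3) int[OF A] int[OF B] by simp
    qed (simp add: B_def)
    moreover have "(\<lambda>N. LINT x|torus_measure. indicator (B N) x *\<^sub>R f x)
        \<longlonglongrightarrow> (LINT x|torus_measure. indicator (\<Union>i. A i) x *\<^sub>R f x)"
    proof (rule integral_dominated_convergence[where w="\<lambda>x. norm (f x)"])
      show "AE x in torus_measure. (\<lambda>N. indicator (B N) x *\<^sub>R f x) \<longlonglongrightarrow> indicator (\<Union>i. A i) x *\<^sub>R f x"
        unfolding B_def by (intro AE_I2 tendsto_intros LIMSEQ_indicator_UN)
    qed (use f A B in \<open>auto intro!: torus_measurable borel_measurable_scaleR simp: indicator_def\<close>)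
    ultimately show ?case by (simp add: LIMSEQ_const_iff)
  qed
qed

text \<open>Integrating over the set where the real part is positive gives a vanishing integral of a
  nonnegative function.\<close>

lemma coef_eq_0_imp_Re_le:
  fixes f :: "'d::finite tfun"
  assumes f: "torus_fun f" "integrable torus_measure f" "\<And>n. coef f n = 0"
  shows "AE x in torus_measure. Re (f x) \<le> 0"
proof -
  have [measurable]: "f \<in> borel_measurable borel" using f by simp
  define A where "A = {x. Re (f x) > 0}"
  have A[measurable]: "A \<in> sets borel" unfolding A_def by measurable
  have int: "integrable torus_measure (\<lambda>x. indicator A x *\<^sub>R f x)"
    by (rule Bochner_Integration.integrable_bound[OF f(2)])
      (use f in \<open>auto intro!: torus_measurable borel_measurable_scaleR simp: indicator_def\<close>)
  have "(LINT x|torus_measure. Re (indicator A x *\<^sub>R f x)) = Re (LINT x|torus_measure. indicator A x *\<^sub>R f x)"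
    by (rule integral_Re[OF int])
  also have "\<dots> = 0" by (simp add: integral_indicator_eq_0[OF f A])
  finally have "(LINT x|torus_measure. Re (indicator A x *\<^sub>R f x)) = 0" .
  then have "AE x in torus_measure. Re (indicator A x *\<^sub>R f x) = 0"
    using integrable_Re[OF int]
    by (subst (asm) integral_nonneg_eq_0_iff_AE) (auto simp: A_def indicator_def)
  then show ?thesis
    by (rule eventually_mono) (auto simp: A_def indicator_def split: if_splits)
qed

theorem coef_eq_0_imp_ae_eq_0:
  assumes f: "torus_fun f" "integrable torus_measure f" "\<And>n. coef f n = 0"
  shows "ae_eq f (\<lambda>x. 0)"
proof -
  \<comment> \<open>The four phases 1, -1, i and -i bound the real and the imaginary part from both
    sides.\<close>
  have *: "AE x in torus_measure. Re (c * f x) \<le> 0" for c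
    using f by (intro coef_eq_0_imp_Re_le) (auto intro: torus_fun_cmult simp: coef_cmult)
  show ?thesis unfolding ae_eq_def
    using *[of 1] *[of "- 1"] *[of \<i>] *[of "- \<i>"]
    by eventually_elim (auto simp: complex_eq_iff)
qed

corollary coef_eq_imp_ae_eq:
  assumes "torus_fun f" "integrable torus_measure f" "torus_fun g" "integrable torus_measure g"
    "\<And>n. coef f n = coef g n"
  shows "ae_eq f g"
proof -
  have "ae_eq (\<lambda>x. f x - g x) (\<lambda>x. 0)"
    using assms by (intro coef_eq_0_imp_ae_eq_0) (auto intro: torus_fun_diff simp: coef_diff)
  then show ?thesis by (auto simp: ae_eq_def)
qed

section \<open>The Hilbert space of square integrable functions\<close>

abbreviation L2 :: "'d::finite tfun set" where
  "L2 \<equiv> elems (Lp 2)"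

definition l1 :: "'d::finite tfun \<Rightarrow> real" where
  "l1 f = (LINT x|torus_measure. norm (f x))"

definition l2sq :: "'d::finite tfun \<Rightarrow> real" where
  "l2sq f = (LINT x|torus_measure. (norm (f x))\<^sup>2)"

lemma powr_2: "0 \<le> x \<Longrightarrow> x powr 2 = x\<^sup>2" for x :: real
  by (cases "x = 0") auto

lemma L2_iff: "f \<in> L2 \<longleftrightarrow> torus_fun f \<and> integrable torus_measure (\<lambda>x. (norm (f x))\<^sup>2)"
  by (simp add: Lp_def powr_2)

lemma L2_torus_fun: "f \<in> L2 \<Longrightarrow> torus_fun f"
  by (simp add: L2_iff)

lemma L2_integrable_l2sq: "f \<in> L2 \<Longrightarrow> integrable torus_measure (\<lambda>x. (norm (f x))\<^sup>2)"
  by (simp add: L2_iff)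

lemma size_of_L2: "size_of (Lp 2) f = sqrt (l2sq f)"
  by (simp add: Lp_def powr_2 l2sq_def powr_half_sqrt)

lemma size_of_L1: "size_of (Lp 1) f = l1 f"
proof -
  have "0 \<le> l1 f" by (simp add: l1_def)
  then show ?thesis by (simp add: Lp_def l1_def)
qed

lemma L1_iff: "f \<in> elems (Lp 1) \<longleftrightarrow> torus_fun f \<and> integrable torus_measure f"
  by (auto simp: Lp_def integrable_norm_iff)

lemma l2sq_nonneg [simp]: "0 \<le> l2sq f"
  by (simp add: l2sq_def)

lemma l1_nonneg [simp]: "0 \<le> l1 f"
  by (simp add: l1_def)

lemma torus_fun_norm_measurable [simp]:
  "torus_fun f \<Longrightarrow> (\<lambda>x. norm (f x)) \<in> borel_measurable borel"
  by (rule measurable_compose[OF torus_fun_measurable borel_measurable_norm])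

lemma cnj_measurable:
  assumes "f \<in> borel_measurable M"
  shows "(\<lambda>x. cnj (f x)) \<in> borel_measurable M"
  by (rule borel_measurable_continuous_on[OF _ assms]) (intro continuous_intros)

lemma l2sq_cong: "torus_fun f \<Longrightarrow> torus_fun g \<Longrightarrow> ae_eq f g \<Longrightarrow> l2sq f = l2sq g"
  unfolding l2sq_def ae_eq_def
  by (rule integral_cong_AE) (auto elim!: eventually_mono intro!: torus_measurable borel_measurable_power borel_measurable_norm)

lemma l1_cong: "torus_fun f \<Longrightarrow> torus_fun g \<Longrightarrow> ae_eq f g \<Longrightarrow> l1 f = l1 g"
  unfolding l1_def ae_eq_def
  by (rule integral_cong_AE) (auto elim!: eventually_mono intro!: torus_measurable borel_measurable_norm)

lemma L2_mult_integrable: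
  assumes "f \<in> L2" "g \<in> L2"
  shows "integrable torus_measure (\<lambda>x. norm (f x) * norm (g x))"
proof (rule Bochner_Integration.integrable_bound)
  show "integrable torus_measure (\<lambda>x. (norm (f x))\<^sup>2 + (norm (g x))\<^sup>2)"
    using assms by (intro Bochner_Integration.integrable_add L2_integrable_l2sq)
  show "AE x in torus_measure. norm (norm (f x) * norm (g x)) \<le> norm ((norm (f x))\<^sup>2 + (norm (g x))\<^sup>2)"
  proof (rule AE_I2)
    fix x
    have "2 * (norm (f x) * norm (g x)) \<le> (norm (f x))\<^sup>2 + (norm (g x))\<^sup>2"
      using sum_squares_bound[of "norm (f x)" "norm (g x)"] by (simp add: mult.assoc)
    moreover have "0 \<le> norm (f x) * norm (g x)" by simp
    ultimately have "norm (f x) * norm (g x) \<le> (norm (f x))\<^sup>2 + (norm (g x))\<^sup>2" by linarith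
    then show "norm (norm (f x) * norm (g x)) \<le> norm ((norm (f x))\<^sup>2 + (norm (g x))\<^sup>2)" by simp
  qed
qed (use assms in \<open>auto simp: L2_iff intro!: torus_measurable borel_measurable_times borel_measurable_norm\<close>)

lemma L2_mult_integrable':
  assumes "f \<in> L2" "g \<in> L2"
  shows "integrable torus_measure (\<lambda>x. f x * g x)" "integrable torus_measure (\<lambda>x. f x * cnj (g x))"
proof -
  have [measurable]: "f \<in> borel_measurable borel" "g \<in> borel_measurable borel"
    using assms by (auto simp: L2_iff)
  show "integrable torus_measure (\<lambda>x. f x * g x)"
    by (rule Bochner_Integration.integrable_bound[OF L2_mult_integrable[OF assms]])
      (auto simp: norm_mult intro!: torus_measurable)
  show "integrable torus_measure (\<lambda>x. f x * cnj (g x))"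
    by (rule Bochner_Integration.integrable_bound[OF L2_mult_integrable[OF assms]])
      (auto simp: norm_mult intro!: torus_measurable borel_measurable_times cnj_measurable)
qed

lemma L2_I_bounded: "torus_fun f \<Longrightarrow> (\<And>x. norm (f x) \<le> C) \<Longrightarrow> f \<in> L2"
proof -
  assume a: "torus_fun f" "\<And>x. norm (f x) \<le> C"
  have "(\<lambda>x. (norm (f x))\<^sup>2) \<in> borel_measurable borel"
    using a by (auto intro!: borel_measurable_power borel_measurable_norm)
  moreover have "norm ((norm (f x))\<^sup>2) \<le> C\<^sup>2" for x
    using a(2)[of x] by (simp add: power_mono)
  ultimately show ?thesis unfolding L2_iff using a(1) torus_integrable_bounded by blast
qed

lemma L2_const [simp]: "(\<lambda>x. c) \<in> L2"
  by (rule L2_I_bounded[of _ "norm c"]) auto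

lemma L2_chi [simp]: "chi n \<in> L2"
  by (rule L2_I_bounded[of _ 1]) auto

lemma L2_cmult: "f \<in> L2 \<Longrightarrow> (\<lambda>x. c * f x) \<in> L2"
  by (auto simp: L2_iff norm_mult power_mult_distrib intro: torus_fun_cmult)

lemma l2sq_add_pointwise: "(norm (a + b))\<^sup>2 \<le> 2 * (norm a)\<^sup>2 + 2 * (norm b)\<^sup>2" for a b :: complex
proof -
  have "(norm (a + b))\<^sup>2 \<le> (norm a + norm b)\<^sup>2"
    by (intro power_mono norm_triangle_ineq) auto
  also have "\<dots> \<le> 2 * (norm a)\<^sup>2 + 2 * (norm b)\<^sup>2"
    using sum_squares_bound[of "norm a" "norm b"] by (simp add: power2_sum)
  finally show ?thesis .
qed

lemma L2_add:
  assumes "f \<in> L2" "g \<in> L2"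
  shows "(\<lambda>x. f x + g x) \<in> L2"
proof -
  have [measurable]: "f \<in> borel_measurable borel" "g \<in> borel_measurable borel"
    using assms by (auto simp: L2_iff)
  have "integrable torus_measure (\<lambda>x. (norm (f x + g x))\<^sup>2)"
  proof (rule Bochner_Integration.integrable_bound)
    show "integrable torus_measure (\<lambda>x. 2 * (norm (f x))\<^sup>2 + 2 * (norm (g x))\<^sup>2)"
      using assms by (intro Bochner_Integration.integrable_add integrable_mult_right L2_integrable_l2sq)
    show "AE x in torus_measure. norm ((norm (f x + g x))\<^sup>2) \<le> norm (2 * (norm (f x))\<^sup>2 + 2 * (norm (g x))\<^sup>2)"
      using l2sq_add_pointwise by (intro AE_I2) simp
  qed (auto intro!: torus_measurable)
  then show ?thesis using assms by (auto simp: L2_iff intro: torus_fun_add)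
qed

lemma L2_diff:
  assumes "f \<in> L2" "g \<in> L2"
  shows "(\<lambda>x. f x - g x) \<in> L2"
  using L2_add[OF assms(1) L2_cmult[OF assms(2), of "- 1"]] by simp

lemma L2_sum: "(\<And>i. i \<in> I \<Longrightarrow> f i \<in> L2) \<Longrightarrow> (\<lambda>x. \<Sum>i\<in>I. f i x) \<in> L2"
  by (induction I rule: infinite_finite_induct) (simp_all add: L2_add)

text \<open>The discriminant argument for the nonnegative quadratic t \<mapsto> l2sq f - 2 t B + t^2
  l2sq g.\<close>

lemma L2_cauchy_schwarz:
  assumes "f \<in> L2" "g \<in> L2"
  shows "(LINT x|torus_measure. norm (f x) * norm (g x)) \<le> sqrt (l2sq f) * sqrt (l2sq g)"
proof -
  define B where "B = (LINT x|torus_measure. norm (f x) * norm (g x))"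
  note [simp] = L2_mult_integrable[OF assms] L2_integrable_l2sq[OF assms(1)] L2_integrable_l2sq[OF assms(2)]
  have *: "0 \<le> l2sq f - 2 * t * B + t\<^sup>2 * l2sq g" for t
  proof -
    have "0 \<le> (LINT x|torus_measure. (norm (f x) - t * norm (g x))\<^sup>2)" by simp
    also have "\<dots> = (LINT x|torus_measure. (norm (f x))\<^sup>2 - 2 * t * (norm (f x) * norm (g x)) + t\<^sup>2 * (norm (g x))\<^sup>2)"
      by (rule Bochner_Integration.integral_cong) (auto simp: power2_diff power_mult_distrib algebra_simps)
    also have "\<dots> = l2sq f - 2 * t * B + t\<^sup>2 * l2sq g"
      by (simp add: l2sq_def B_def)
    finally show ?thesis .
  qed
  have "B\<^sup>2 \<le> l2sq f * l2sq g"
  proof (cases "l2sq g = 0")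
    case True
    have "B = 0"
    proof (rule ccontr)
      assume "B \<noteq> 0"
      \<comment> \<open>Without its quadratic term the expression is affine in t, and at this t it
        equals -1.\<close>
      with *[of "(l2sq f + 1) / (2 * B)"] True show False by simp
    qed
    then show ?thesis using True by simp
  next
    case False
    then have "l2sq g > 0" using l2sq_nonneg[of g] by linarith
    \<comment> \<open>The minimiser of the quadratic.\<close>
    with *[of "B / l2sq g"] have "0 \<le> l2sq f - B\<^sup>2 / l2sq g"
      by (simp add: power2_eq_square field_simps)
    then show ?thesis using \<open>l2sq g > 0\<close> by (simp add: field_simps)
  qed
  then have "sqrt (B\<^sup>2) \<le> sqrt (l2sq f * l2sq g)" by (rule real_sqrt_le_mono)
  then show ?thesis by (simp add: B_def real_sqrt_mult)
qed

lemma L2_integrable: "f \<in> L2 \<Longrightarrow> integrable torus_measure f"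
  using L2_mult_integrable'(1)[of f "\<lambda>x. 1"] by simp

lemma l2sq_one [simp]: "l2sq (\<lambda>x. 1 :: complex) = 1"
  by (simp add: l2sq_def)

lemma l1_le_l2sq: "f \<in> L2 \<Longrightarrow> l1 f \<le> sqrt (l2sq f)"
  using L2_cauchy_schwarz[of f "\<lambda>x. 1"] by (simp add: l1_def)

lemma l1_mult_le: "f \<in> L2 \<Longrightarrow> g \<in> L2 \<Longrightarrow> l1 (\<lambda>x. f x * g x) \<le> sqrt (l2sq f) * sqrt (l2sq g)"
  using L2_cauchy_schwarz[of f g] by (simp add: l1_def norm_mult)

lemma norm_L2_inner_le: "f \<in> L2 \<Longrightarrow> g \<in> L2 \<Longrightarrow> norm (L2_inner f g) \<le> sqrt (l2sq f) * sqrt (l2sq g)"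
  using L2_cauchy_schwarz[of f g] integral_norm_bound[of torus_measure "\<lambda>x. f x * cnj (g x)"]
  by (simp add: L2_inner_def norm_mult)

lemma norm_coef_le_L2:
  assumes "f \<in> L2"
  shows "norm (coef f n) \<le> sqrt (l2sq f)"
  using norm_coef_le[OF L2_integrable[OF assms], of n] l1_le_l2sq[OF assms] unfolding l1_def by (rule order_trans)

lemma l2sq_cmult: "l2sq (\<lambda>x. c * f x) = (norm c)\<^sup>2 * l2sq f"
  by (simp add: l2sq_def norm_mult power_mult_distrib)

lemma l2sq_add_le:
  assumes "f \<in> L2" "g \<in> L2"
  shows "l2sq (\<lambda>x. f x + g x) \<le> 2 * l2sq f + 2 * l2sq g"
proof -
  have "l2sq (\<lambda>x. f x + g x) \<le> (LINT x|torus_measure. 2 * (norm (f x))\<^sup>2 + 2 * (norm (g x))\<^sup>2)"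
    unfolding l2sq_def using assms L2_add[OF assms]
    by (intro integral_mono)
      (auto intro!: l2sq_add_pointwise L2_integrable_l2sq Bochner_Integration.integrable_add integrable_mult_right)
  then show ?thesis using assms by (simp add: l2sq_def L2_integrable_l2sq)
qed

lemma L2_inner_self: "f \<in> L2 \<Longrightarrow> L2_inner f f = of_real (l2sq f)"
  by (simp add: L2_inner_def l2sq_def complex_norm_square[symmetric] integral_complex_of_real flip: of_real_power)

lemma L2_inner_chi: "L2_inner f (chi n) = coef f n"
  by (simp add: L2_inner_def coef_def chi_minus)

lemma L2_inner_sym: "L2_inner g f = cnj (L2_inner f g)"
  by (simp add: L2_inner_def mult.commute flip: Bochner_Integration.integral_cnj)

lemma L2_inner_diff_left:
  "f \<in> L2 \<Longrightarrow> g \<in> L2 \<Longrightarrow> h \<in> L2 \<Longrightarrow> L2_inner (\<lambda>x. f x - g x) h = L2_inner f h - L2_inner g h"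
  by (simp add: L2_inner_def algebra_simps L2_mult_integrable')

lemma L2_inner_diff_right:
  "f \<in> L2 \<Longrightarrow> g \<in> L2 \<Longrightarrow> h \<in> L2 \<Longrightarrow> L2_inner h (\<lambda>x. f x - g x) = L2_inner h f - L2_inner h g"
  by (simp add: L2_inner_def algebra_simps L2_mult_integrable')

lemma L2_inner_cmult_left: "L2_inner (\<lambda>x. c * f x) h = c * L2_inner f h"
  by (simp add: L2_inner_def mult.assoc)

lemma L2_inner_sum_left:
  "(\<And>i. i \<in> I \<Longrightarrow> f i \<in> L2) \<Longrightarrow> h \<in> L2 \<Longrightarrow> L2_inner (\<lambda>x. \<Sum>i\<in>I. f i x) h = (\<Sum>i\<in>I. L2_inner (f i) h)"
  by (simp add: L2_inner_def sum_distrib_right L2_mult_integrable')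

section \<open>Bessel, Riesz-Fischer and Parseval for the orthonormal system of characters\<close>

definition trig :: "(int ^ 'd \<Rightarrow> complex) \<Rightarrow> (int ^ 'd) set \<Rightarrow> 'd::finite tfun" where
  "trig c F x = (\<Sum>n\<in>F. c n * chi n x)"

lemma trig_L2 [simp]: "trig c F \<in> L2"
  unfolding trig_def[abs_def] by (intro L2_sum L2_cmult L2_chi)

lemma L2_inner_trig: "f \<in> L2 \<Longrightarrow> L2_inner (trig c F) f = (\<Sum>n\<in>F. c n * cnj (coef f n))"
  unfolding trig_def[abs_def]
  by (simp add: L2_inner_sum_left L2_cmult L2_inner_cmult_left L2_inner_sym[of "chi _"] L2_inner_chi)

lemma coef_trig: "finite F \<Longrightarrow> coef (trig c F) n = (if n \<in> F then c n else 0)"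
  unfolding trig_def[abs_def]
  by (simp add: coef_sum L2_integrable L2_cmult coef_cmult coef_chi if_distrib cong: if_cong)

lemma l2sq_trig: "finite F \<Longrightarrow> l2sq (trig c F) = (\<Sum>n\<in>F. (norm (c n))\<^sup>2)"
proof -
  assume F: "finite F"
  have "complex_of_real (l2sq (trig c F)) = L2_inner (trig c F) (trig c F)"
    by (simp add: L2_inner_self)
  also have "\<dots> = (\<Sum>n\<in>F. c n * cnj (c n))"
    using F by (simp add: L2_inner_trig coef_trig)
  also have "\<dots> = complex_of_real (\<Sum>n\<in>F. (norm (c n))\<^sup>2)"
    by (simp add: complex_norm_square del: of_real_power)
  finally show ?thesis by (simp only: of_real_eq_iff)
qed

text \<open>The remainder f - p after the partial sum p is orthogonal to p, so its squared norm is
  l2sq f minus the sum.\<close>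

lemma bessel:
  assumes "f \<in> L2" "finite F"
  shows "(\<Sum>n\<in>F. (norm (coef f n))\<^sup>2) \<le> l2sq f"
proof -
  define p where "p = trig (coef f) F"
  define S where "S = (\<Sum>n\<in>F. (norm (coef f n))\<^sup>2)"
  have p: "p \<in> L2" by (simp add: p_def)
  have "L2_inner p f = complex_of_real S"
    using assms by (simp add: p_def L2_inner_trig S_def complex_norm_square del: of_real_power)
  then have "L2_inner (\<lambda>x. f x - p x) f = complex_of_real (l2sq f - S)"
    using assms p by (simp add: L2_inner_diff_left L2_inner_self)
  moreover have "L2_inner (\<lambda>x. f x - p x) p = 0"
  proof -
    have "L2_inner p (\<lambda>x. f x - p x) = 0"
      using assms p unfolding p_def
      by (simp add: L2_inner_trig L2_diff coef_diff L2_integrable coef_trig)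
    then show ?thesis by (simp add: L2_inner_sym[of "\<lambda>x. f x - p x"])
  qed
  moreover have "L2_inner (\<lambda>x. f x - p x) (\<lambda>x. f x - p x) =
      L2_inner (\<lambda>x. f x - p x) f - L2_inner (\<lambda>x. f x - p x) p"
    using assms p by (intro L2_inner_diff_right L2_diff)
  ultimately have "complex_of_real (l2sq (\<lambda>x. f x - p x)) = complex_of_real (l2sq f - S)"
    using assms p by (simp add: L2_inner_self L2_diff)
  then have "l2sq (\<lambda>x. f x - p x) = l2sq f - S" by (simp only: of_real_eq_iff)
  with l2sq_nonneg[of "\<lambda>x. f x - p x"] show ?thesis by (simp add: S_def)
qed

text \<open>A finite set whose sum comes within e of the supremum leaves at most e to any finite set
  disjoint from it. This is the Cauchy criterion for unordered sums.\<close>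

lemma small_tail:
  fixes a :: "'a \<Rightarrow> real"
  assumes "\<And>n. 0 \<le> a n" "\<And>F. finite F \<Longrightarrow> sum a F \<le> C" "e > 0"
  obtains F where "finite F" "\<And>G. finite G \<Longrightarrow> G \<inter> F = {} \<Longrightarrow> sum a G \<le> e"
proof -
  define s where "s = (SUP F\<in>{F. finite F}. sum a F)"
  have bdd: "bdd_above (sum a ` {F. finite F})" using assms(2) by (auto simp: bdd_above_def)
  have "\<exists>F\<in>{F. finite F}. s - e < sum a F"
    unfolding s_def by (subst less_cSUP_iff[symmetric]) (use bdd \<open>e > 0\<close> in auto)
  then obtain F where F: "finite F" "s - e < sum a F" by auto
  show ?thesis
  proof (rule that[OF F(1)])
    fix G :: "'a set" assume G: "finite G" "G \<inter> F = {}"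
    have "sum a (G \<union> F) \<le> s" unfolding s_def using G F by (intro cSUP_upper bdd) auto
    then show "sum a G \<le> e" using G F by (simp add: sum.union_disjoint)
  qed
qed

text \<open>Fatou's lemma gives both the norm bound and the square integrability of the pointwise
  limit.\<close>

lemma fatou_l2sq:
  assumes "\<And>j. u j \<in> L2" "torus_fun v" "AE x in torus_measure. (\<lambda>j. u j x) \<longlonglongrightarrow> v x"
    and "\<And>j. j \<ge> N \<Longrightarrow> l2sq (u j) \<le> B"
  shows "v \<in> L2 \<and> l2sq v \<le> B"
proof -
  have [measurable]: "v \<in> borel_measurable borel" "\<And>j. u j \<in> borel_measurable borel"
    using assms by (auto simp: L2_iff)
  have "0 \<le> B" using assms(4)[of N] l2sq_nonneg[of "u N"] by linarith
  have "(\<integral>\<^sup>+x. ennreal ((norm (v x))\<^sup>2) \<partial>torus_measure)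
      = (\<integral>\<^sup>+x. liminf (\<lambda>j. ennreal ((norm (u j x))\<^sup>2)) \<partial>torus_measure)"
  proof (rule nn_integral_cong_AE, use assms(3) in \<open>rule eventually_mono\<close>)
    fix x assume "(\<lambda>j. u j x) \<longlonglongrightarrow> v x"
    then have "(\<lambda>j. ennreal ((norm (u j x))\<^sup>2)) \<longlonglongrightarrow> ennreal ((norm (v x))\<^sup>2)"
      by (intro tendsto_ennrealI tendsto_intros)
    then show "ennreal ((norm (v x))\<^sup>2) = liminf (\<lambda>j. ennreal ((norm (u j x))\<^sup>2))"
      using lim_imp_Liminf[OF sequentially_bot] by metis
  qed
  also have "\<dots> \<le> liminf (\<lambda>j. \<integral>\<^sup>+x. ennreal ((norm (u j x))\<^sup>2) \<partial>torus_measure)"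
    by (rule nn_integral_liminf) (auto intro!: torus_measurable)
  also have "\<dots> = liminf (\<lambda>j. ennreal (l2sq (u j)))"
    unfolding l2sq_def using assms(1) by (simp add: nn_integral_eq_integral L2_integrable_l2sq)
  also have "\<dots> \<le> liminf (\<lambda>j. ennreal B)"
    using assms(4) by (intro Liminf_mono) (auto simp: eventually_sequentially intro!: ennreal_leI)
  also have "\<dots> = ennreal B" by (simp add: Liminf_const)
  finally have *: "(\<integral>\<^sup>+x. ennreal ((norm (v x))\<^sup>2) \<partial>torus_measure) \<le> ennreal B" .
  have int: "integrable torus_measure (\<lambda>x. (norm (v x))\<^sup>2)"
    by (rule integrableI_bounded) (use * in \<open>auto intro!: torus_measurable simp: le_less_trans\<close>)
  then have "ennreal (l2sq v) \<le> ennreal B"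
    using * unfolding l2sq_def by (simp add: nn_integral_eq_integral)
  then have "l2sq v \<le> B" using \<open>0 \<le> B\<close> by (simp add: ennreal_le_iff)
  then show ?thesis using int assms(2) by (simp add: L2_iff)
qed

text \<open>Partial sums with squared tails at most 4^-k differ by at most 2^-k in L1, so their
  increments are absolutely summable almost everywhere. Fatou bounds the distance from the limit to
  each partial sum, which identifies its coefficients.\<close>

theorem riesz_fischer:
  fixes c :: "int ^ 'd::finite \<Rightarrow> complex"
  assumes C: "\<And>F. finite F \<Longrightarrow> (\<Sum>n\<in>F. (norm (c n))\<^sup>2) \<le> C"
  obtains h where "h \<in> L2" "\<And>n. coef h n = c n" "l2sq h \<le> C"
proof -
  have "\<exists>F. finite F \<and> (\<forall>G. finite G \<longrightarrow> G \<inter> F = {} \<longrightarrow> (\<Sum>n\<in>G. (norm (c n))\<^sup>2) \<le> (1/4) ^ k)" for k :: nat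
    by (rule small_tail[of "\<lambda>n. (norm (c n))\<^sup>2" C "(1/4) ^ k"]) (use C in auto)
  then obtain F0 where F0: "\<And>k. finite (F0 k)"
    "\<And>k G. finite G \<Longrightarrow> G \<inter> F0 k = {} \<Longrightarrow> (\<Sum>n\<in>G. (norm (c n))\<^sup>2) \<le> (1/4) ^ k" by metis
  \<comment> \<open>Unions make the sets increasing, so \<open>h j - h k\<close> is a sum over
    \<open>F j - F k\<close>, a set disjoint from \<open>F0 k\<close>.\<close>
  define F where "F k = (\<Union>j\<le>k. F0 j)" for k :: nat
  have F: "finite (F k)" "F0 k \<subseteq> F k" for k using F0(1) by (auto simp: F_def)
  have mono: "F k \<subseteq> F j" if "k \<le> j" for k j using that unfolding F_def by (intro UN_mono) auto
  define h where "h k = trig c (F k)" for k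
  have h: "h k \<in> L2" for k by (simp add: h_def)
  have diff: "h j x - h k x = trig c (F j - F k) x" if "k \<le> j" for j k x
    unfolding h_def trig_def using sum_diff[OF F(1) mono[OF that], of "\<lambda>n. c n * chi n x"] by simp
  have sqd: "l2sq (\<lambda>x. h j x - h k x) \<le> (1/4) ^ k" if "k \<le> j" for j k
  proof -
    have "l2sq (\<lambda>x. h j x - h k x) = (\<Sum>n\<in>F j - F k. (norm (c n))\<^sup>2)"
      unfolding diff[OF that] using F(1) by (subst l2sq_trig) auto
    also have "\<dots> \<le> (1/4) ^ k" using F by (intro F0(2)) auto
    finally show ?thesis .
  qed
  have l1d: "l1 (\<lambda>x. h (Suc k) x - h k x) \<le> (1/2) ^ k" for k
  proof -
    have "l1 (\<lambda>x. h (Suc k) x - h k x) \<le> sqrt (l2sq (\<lambda>x. h (Suc k) x - h k x))"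
      by (intro l1_le_l2sq L2_diff h)
    also have "\<dots> \<le> sqrt ((1/4) ^ k)" by (intro real_sqrt_le_mono sqd) simp
    also have "\<dots> = (1/2) ^ k" by (simp add: real_sqrt_power real_sqrt_divide)
    finally show ?thesis .
  qed
  have [measurable]: "h k \<in> borel_measurable borel" for k using h by (auto simp: L2_iff)
  have "AE x in torus_measure. (\<Sum>k. ennreal (norm (h (Suc k) x - h k x))) \<noteq> \<infinity>"
  proof (rule nn_integral_PInf_AE)
    have "(\<integral>\<^sup>+x. (\<Sum>k. ennreal (norm (h (Suc k) x - h k x))) \<partial>torus_measure)
        = (\<Sum>k. \<integral>\<^sup>+x. ennreal (norm (h (Suc k) x - h k x)) \<partial>torus_measure)"
      by (rule nn_integral_suminf) (auto intro!: torus_measurable)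
    also have "\<dots> = (\<Sum>k. ennreal (l1 (\<lambda>x. h (Suc k) x - h k x)))"
      unfolding l1_def using h
      by (intro arg_cong[where f=suminf] ext nn_integral_eq_integral integrable_norm L2_integrable L2_diff) auto
    also have "\<dots> \<le> (\<Sum>k. ennreal ((1/2) ^ k))"
      by (intro suminf_le ennreal_leI l1d) auto
    also have "\<dots> = ennreal (\<Sum>k. (1/2) ^ k)"
      by (rule suminf_ennreal2) (auto simp: summable_geometric)
    also have "\<dots> < \<infinity>" by simp
    finally show "(\<integral>\<^sup>+x. (\<Sum>k. ennreal (norm (h (Suc k) x - h k x))) \<partial>torus_measure) \<noteq> \<infinity>" by simp
  qed (auto intro!: torus_measurable)
  then have conv: "AE x in torus_measure. convergent (\<lambda>k. h k x)"
  proof (rule eventually_mono)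
    fix x assume "(\<Sum>k. ennreal (norm (h (Suc k) x - h k x))) \<noteq> \<infinity>"
    then have "summable (\<lambda>k. norm (h (Suc k) x - h k x))"
      by (intro summable_suminf_not_top) auto
    then have "summable (\<lambda>k. h (Suc k) x - h k x)" by (rule summable_norm_cancel)
    then have "convergent (\<lambda>n. \<Sum>k<n. h (Suc k) x - h k x)" by (simp add: summable_iff_convergent)
    moreover have "(\<Sum>k<n. h (Suc k) x - h k x) = h n x - h 0 x" for n
      by (rule sum_lessThan_telescope[of "\<lambda>k. h k x"])
    ultimately have "convergent (\<lambda>n. h n x - h 0 x)" by (simp only:)
    from convergent_add[OF this convergent_const[of "h 0 x"]] show "convergent (\<lambda>k. h k x)" by simp
  qed
  \<comment> \<open>\<open>lim\<close> is taken at every point: where the sequence diverges its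
    value is arbitrary but depends only on the sequence, which is the same at x and at its lattice
    translates. So g is exactly periodic.\<close>
  define g where "g x = lim (\<lambda>k. h k x)" for x
  have lim: "AE x in torus_measure. (\<lambda>k. h k x) \<longlonglongrightarrow> g x"
    using conv by (rule eventually_mono) (simp add: g_def convergent_LIMSEQ_iff)
  have "torus_fun g"
  proof -
    have "g (x + k) = g x" if "\<forall>i. k $ i \<in> \<int>" for x k
    proof -
      have "h j (x + k) = h j x" for j using h[of j] that unfolding L2_iff torus_fun_def by blast
      then show ?thesis by (simp add: g_def)
    qed
    moreover have "g \<in> borel_measurable borel" unfolding g_def[abs_def] by measurable
    ultimately show ?thesis by (auto simp: torus_fun_def)
  qed
  have g: "g \<in> L2 \<and> l2sq g \<le> C"
    by (rule fatou_l2sq[OF h \<open>torus_fun g\<close> lim]) (simp add: h_def l2sq_trig F(1) C)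
  have gd: "l2sq (\<lambda>x. g x - h k x) \<le> (1/4) ^ k" for k
  proof -
    have "(\<lambda>x. g x - h k x) \<in> L2 \<and> l2sq (\<lambda>x. g x - h k x) \<le> (1/4) ^ k"
    proof (rule fatou_l2sq[where u="\<lambda>j x. h j x - h k x"])
      show "AE x in torus_measure. (\<lambda>j. h j x - h k x) \<longlonglongrightarrow> g x - h k x"
        using lim by (rule eventually_mono) (intro tendsto_intros)
      show "torus_fun (\<lambda>x. g x - h k x)" using \<open>torus_fun g\<close> h[of k] L2_torus_fun torus_fun_diff by blast
      show "(\<lambda>x. h j x - h k x) \<in> L2" for j by (rule L2_diff[OF h h])
      show "l2sq (\<lambda>x. h j x - h k x) \<le> (1/4) ^ k" if "j \<ge> k" for j by (rule sqd[OF that])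
    qed
    then show ?thesis by blast
  qed
  have "coef g n = c n" for n
  proof -
    have "norm (coef g n - c n) \<le> 2 * (1/2) ^ k" for k
    proof -
      have "norm (coef g n - coef (h k) n) = norm (coef (\<lambda>x. g x - h k x) n)"
        using g h by (simp add: coef_diff L2_integrable)
      also have "\<dots> \<le> sqrt (l2sq (\<lambda>x. g x - h k x))" using g h by (intro norm_coef_le_L2 L2_diff) auto
      also have "\<dots> \<le> sqrt ((1/4) ^ k)" by (intro real_sqrt_le_mono gd)
      also have "\<dots> = (1/2) ^ k" by (simp add: real_sqrt_power real_sqrt_divide)
      finally have 1: "norm (coef g n - coef (h k) n) \<le> (1/2) ^ k" .
      have 2: "norm (coef (h k) n - c n) \<le> (1/2) ^ k"
      proof (cases "n \<in> F k")
        case False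
        then have "(norm (c n))\<^sup>2 \<le> (1/4) ^ k" using F0(2)[of "{n}" k] F(2)[of k] by auto
        then have "sqrt ((norm (c n))\<^sup>2) \<le> sqrt ((1/4) ^ k)" by (rule real_sqrt_le_mono)
        then show ?thesis using False F(1) by (simp add: h_def coef_trig real_sqrt_power real_sqrt_divide)
      qed (simp add: h_def coef_trig F(1))
      have "norm (coef g n - c n) \<le> norm (coef g n - coef (h k) n) + norm (coef (h k) n - c n)"
        using norm_triangle_ineq[of "coef g n - coef (h k) n" "coef (h k) n - c n"] by simp
      with 1 2 show ?thesis by linarith
    qed
    note * = this
    have "(\<lambda>k. 2 * (1/2) ^ k :: real) \<longlonglongrightarrow> 2 * 0"
      by (intro tendsto_mult tendsto_const LIMSEQ_power_zero) simp
    from LIMSEQ_le_const[OF this] * have "norm (coef g n - c n) \<le> 2 * 0" by blast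
    then show ?thesis by simp
  qed
  with g show ?thesis using that by blast
qed

lemma L2_ae_eqI: "f \<in> L2 \<Longrightarrow> g \<in> L2 \<Longrightarrow> (\<And>n. coef f n = coef g n) \<Longrightarrow> ae_eq f g"
  by (rule coef_eq_imp_ae_eq) (auto simp: L2_torus_fun L2_integrable)

text \<open>The converse of Bessel, that is, completeness of the characters: the Riesz-Fischer
  function with the same coefficients obeys the bound, and by uniqueness it is f almost
  everywhere.\<close>

lemma l2sq_le_coef:
  assumes "f \<in> L2" "\<And>F. finite F \<Longrightarrow> (\<Sum>n\<in>F. (norm (coef f n))\<^sup>2) \<le> C"
  shows "l2sq f \<le> C"
proof -
  obtain h where h: "h \<in> L2" "\<And>n. coef h n = coef f n" "l2sq h \<le> C"
    using riesz_fischer[OF assms(2)] by metis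
  then have "ae_eq h f" using assms by (intro L2_ae_eqI) auto
  then show ?thesis using h assms l2sq_cong[of h f] by (simp add: L2_torus_fun)
qed

text \<open>The error has coefficients only outside G, so a small tail means a small norm. Allowing
  every larger G is the form that unordered convergence in \<open>parseval\<close> asks for.\<close>

lemma L2_trig_approx:
  assumes "f \<in> L2" "e > 0"
  obtains F where "finite F" "\<And>G. finite G \<Longrightarrow> F \<subseteq> G \<Longrightarrow> l2sq (\<lambda>x. f x - trig (coef f) G x) \<le> e"
proof -
  obtain F where F: "finite F" "\<And>G. finite G \<Longrightarrow> G \<inter> F = {} \<Longrightarrow> (\<Sum>n\<in>G. (norm (coef f n))\<^sup>2) \<le> e"
    using small_tail[of "\<lambda>n. (norm (coef f n))\<^sup>2" "l2sq f" e] bessel[OF assms(1)] assms(2) by (metis zero_le_power2)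
  show ?thesis
  proof (rule that[OF F(1)])
    fix G :: "(int ^ 'a) set" assume G: "finite G" "F \<subseteq> G"
    show "l2sq (\<lambda>x. f x - trig (coef f) G x) \<le> e"
    proof (rule l2sq_le_coef)
      fix H :: "(int ^ 'a) set" assume H: "finite H"
      have "(\<Sum>n\<in>H. (norm (coef (\<lambda>x. f x - trig (coef f) G x) n))\<^sup>2) = (\<Sum>n\<in>H. if n \<in> G then 0 else (norm (coef f n))\<^sup>2)"
        using G assms(1) by (intro sum.cong) (auto simp: coef_diff L2_integrable coef_trig)
      also have "\<dots> = (\<Sum>n\<in>H - G. (norm (coef f n))\<^sup>2)"
        using H by (intro sum.mono_neutral_cong_right) auto
      also have "\<dots> \<le> e" using F G H by (intro F(2)) auto
      finally show "(\<Sum>n\<in>H. (norm (coef (\<lambda>x. f x - trig (coef f) G x) n))\<^sup>2) \<le> e" .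
    qed (use assms in \<open>auto intro: L2_diff\<close>)
  qed
qed

theorem parseval:
  assumes "f \<in> L2" "g \<in> L2"
  shows "((\<lambda>n. coef f n * cnj (coef g n)) has_sum L2_inner f g) UNIV"
  unfolding has_sum_def tendsto_iff eventually_finite_subsets_at_top
proof (intro allI impI)
  fix e :: real assume e: "e > 0"
  \<comment> \<open>The added 1 keeps the denominator positive when g vanishes; the factor 2 makes
    the final inequality strict.\<close>
  define \<delta> where "\<delta> = (e / (2 * (sqrt (l2sq g) + 1)))\<^sup>2"
  have gp: "sqrt (l2sq g) + 1 > 0" by (simp add: add_nonneg_pos)
  then have "\<delta> > 0" using e by (simp add: \<delta>_def)
  then obtain F where F: "finite F" "\<And>G. finite G \<Longrightarrow> F \<subseteq> G \<Longrightarrow> l2sq (\<lambda>x. f x - trig (coef f) G x) \<le> \<delta>"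
    using L2_trig_approx[OF assms(1)] by metis
  show "\<exists>X. finite X \<and> X \<subseteq> UNIV \<and> (\<forall>Y. finite Y \<and> X \<subseteq> Y \<and> Y \<subseteq> UNIV \<longrightarrow>
      dist (\<Sum>n\<in>Y. coef f n * cnj (coef g n)) (L2_inner f g) < e)"
  proof (intro exI[of _ F] conjI allI impI)
    fix Y assume Y: "finite Y \<and> F \<subseteq> Y \<and> Y \<subseteq> UNIV"
    have "dist (\<Sum>n\<in>Y. coef f n * cnj (coef g n)) (L2_inner f g) = norm (L2_inner (\<lambda>x. f x - trig (coef f) Y x) g)"
      using assms by (simp add: L2_inner_diff_left L2_inner_trig dist_norm norm_minus_commute)
    also have "\<dots> \<le> sqrt (l2sq (\<lambda>x. f x - trig (coef f) Y x)) * sqrt (l2sq g)"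
      using assms by (intro norm_L2_inner_le L2_diff) auto
    also have "\<dots> \<le> sqrt \<delta> * sqrt (l2sq g)"
      using F(2) Y by (intro mult_right_mono real_sqrt_le_mono) auto
    also have "\<dots> \<le> sqrt \<delta> * (sqrt (l2sq g) + 1)"
      by (intro mult_left_mono) (auto simp: \<delta>_def)
    also have "\<dots> = e / 2"
    proof -
      have "sqrt \<delta> = e / (2 * (sqrt (l2sq g) + 1))" using gp e by (simp add: \<delta>_def)
      moreover have "sqrt (l2sq g) + 1 \<noteq> 0" using gp by linarith
      moreover have "e / (2 * s) * s = e / 2" if "s \<noteq> 0" for s :: real using that by simp
      ultimately show ?thesis by (simp only:)
    qed
    also have "\<dots> < e" using e by simp
    finally show "dist (\<Sum>n\<in>Y. coef f n * cnj (coef g n)) (L2_inner f g) < e" .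
  qed (use F in auto)
qed

section \<open>Weak derivatives and Fourier multipliers\<close>

lemma partial_eqI:
  assumes "\<And>x. (f has_derivative D x) (at x)"
  shows "partial j f x = D x (axis j 1)"
  unfolding partial_def using frechet_derivative_at[OF assms] by metis

lemma has_derivative_chi:
  fixes n :: "int ^ 'd::finite"
  shows "(chi n has_derivative (\<lambda>v. chi n x * (\<i> * of_real (2 * pi * (\<Sum>i\<in>UNIV. of_int (n $ i) * v $ i))))) (at x)"
proof -
  define L where "L v = 2 * pi * (\<Sum>i\<in>UNIV. of_int (n $ i) * v $ i)" for v :: "real ^ 'd"
  have "bounded_linear (\<lambda>v. \<i> * complex_of_real (L v))"
    unfolding L_def by (intro bounded_linear_intros bounded_linear_sum bounded_linear_vec_nth
      bounded_linear_const_mult bounded_linear_of_real[THEN bounded_linear_compose])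
  then have 1: "((\<lambda>v. \<i> * complex_of_real (L v)) has_derivative (\<lambda>v. \<i> * complex_of_real (L v))) (at x)"
    by (rule bounded_linear_imp_has_derivative)
  have 2: "(exp has_derivative (\<lambda>h. exp z * h)) (at z)" for z :: complex
    using DERIV_exp[of z] by (simp add: has_field_derivative_def)
  have 3: "chi n = (\<lambda>v. exp (\<i> * complex_of_real (L v)))"
    by (simp add: fun_eq_iff chi_def cis_conv_exp L_def)
  show ?thesis
    using has_derivative_compose[OF 1 2] unfolding 3 L_def by simp
qed

lemma has_derivative_cmult_chi:
  fixes n :: "int ^ 'd::finite"
  shows "((\<lambda>x. c * chi n x) has_derivative
    (\<lambda>v. c * (chi n x * (\<i> * of_real (2 * pi * (\<Sum>i\<in>UNIV. of_int (n $ i) * v $ i)))))) (at x)"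
  by (intro has_derivative_mult_right has_derivative_chi)

lemma sum_axis: "(\<Sum>i\<in>UNIV. of_int (n $ i) * axis j 1 $ i) = real_of_int (n $ j)" for n :: "int ^ 'd::finite"
  by (subst sum.remove[of _ j]) (auto simp: axis_def intro!: sum.neutral)

lemma partial_cmult_chi: "partial j (\<lambda>x. c * chi n x) = (\<lambda>x. (c * (2 * pi * \<i> * of_int (n $ j))) * chi n x)"
  by (rule ext, subst partial_eqI[OF has_derivative_cmult_chi]) (simp add: sum_axis)

lemma test_fun_chi: "test_fun (chi n)"
proof -
  \<comment> \<open>Scalar multiples make the induction close: each partial derivative of a multiple
    of \<open>chi n\<close> is again one.\<close>
  have "C_k k (\<lambda>x. c * chi n x)" for k c
  proof (induction k arbitrary: c)
    case 0
    show ?case by (auto intro!: continuous_intros)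
  next
    case (Suc k)
    then show ?case
      using has_derivative_cmult_chi unfolding C_k.simps partial_cmult_chi differentiable_def by blast
  qed
  from this[of _ 1] show ?thesis by (simp add: test_fun_def)
qed

text \<open>Step lengths of difference quotients. Being at most 1, they keep points that start in
  the unit cube inside \<open>cbox 0 2\<close>, where a continuous derivative is bounded.\<close>

definition recip :: "nat \<Rightarrow> real" where "recip k = 1 / real (Suc k)"

lemma recip: "recip k > 0" "recip k \<le> 1" "recip \<longlonglongrightarrow> 0"
  using LIMSEQ_inverse_real_of_nat by (auto simp: recip_def[abs_def] inverse_eq_divide)

lemma difference_quotient_tendsto:
  fixes f :: "'d::finite tfun"
  assumes "(f has_derivative D) (at x)" and e: "norm e = 1"
  shows "(\<lambda>k. (f (x + recip k *\<^sub>R e) - f x) / of_real (recip k)) \<longlonglongrightarrow> D e"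
proof -
  have D: "bounded_linear D" "(\<lambda>h. norm (f (x + h) - f x - D h) / norm h) \<midarrow>0\<rightarrow> 0"
    using assms(1) by (auto simp: has_derivative_at)
  have "filterlim (\<lambda>k. recip k *\<^sub>R e) (at 0) sequentially"
    unfolding filterlim_at
  proof
    show "\<forall>\<^sub>F k in sequentially. recip k *\<^sub>R e \<in> UNIV \<and> recip k *\<^sub>R e \<noteq> 0"
      using recip(1) e by (intro always_eventually) (auto simp: less_imp_neq[symmetric])
    show "(\<lambda>k. recip k *\<^sub>R e) \<longlonglongrightarrow> 0"
      using tendsto_scaleR[OF recip(3) tendsto_const[of e]] by simp
  qed
  from filterlim_compose[OF D(2) this]
  have "(\<lambda>k. norm (f (x + recip k *\<^sub>R e) - f x - D (recip k *\<^sub>R e)) / norm (recip k *\<^sub>R e)) \<longlonglongrightarrow> 0" .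
  moreover have "norm (f (x + recip k *\<^sub>R e) - f x - D (recip k *\<^sub>R e)) / norm (recip k *\<^sub>R e)
      = norm ((f (x + recip k *\<^sub>R e) - f x) / of_real (recip k) - D e)" for k
  proof -
    have "D (recip k *\<^sub>R e) = of_real (recip k) * D e"
    proof -
      have "D (recip k *\<^sub>R e) = recip k *\<^sub>R D e" using D(1) by (simp add: linear_simps)
      also have "\<dots> = of_real (recip k) * D e" by (rule scaleR_conv_of_real)
      finally show ?thesis .
    qed
    moreover have "recip k \<noteq> 0" using recip(1)[of k] by simp
    ultimately have "(f (x + recip k *\<^sub>R e) - f x) / of_real (recip k) - D e
        = (f (x + recip k *\<^sub>R e) - f x - D (recip k *\<^sub>R e)) / of_real (recip k)"
      by (simp add: field_simps)
    then show ?thesis using e recip(1)[of k] by (simp add: norm_divide)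
  qed
  ultimately have "(\<lambda>k. norm ((f (x + recip k *\<^sub>R e) - f x) / of_real (recip k) - D e)) \<longlonglongrightarrow> 0" by simp
  then show ?thesis by (simp add: tendsto_norm_zero_iff LIM_zero_iff)
qed

lemma difference_bound:
  fixes f :: "'d::finite tfun"
  assumes "\<And>y. (f has_derivative D y) (at y)" "t \<ge> 0"
    and "\<And>s. 0 \<le> s \<Longrightarrow> s \<le> t \<Longrightarrow> norm (D (x + s *\<^sub>R e) e) \<le> C"
  shows "norm (f (x + t *\<^sub>R e) - f x) \<le> C * t"
proof -
  have "norm (f (x + t *\<^sub>R e) - f (x + 0 *\<^sub>R e)) \<le> C * norm (t - 0)"
  proof (rule differentiable_bound[of "{0..t}" "\<lambda>s. f (x + s *\<^sub>R e)" "\<lambda>s h. D (x + s *\<^sub>R e) (h *\<^sub>R e)"])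
    fix s assume s: "s \<in> {0..t}"
    have "((\<lambda>s. x + s *\<^sub>R e) has_derivative (\<lambda>h. h *\<^sub>R e)) (at s within {0..t})"
      by (auto intro!: derivative_eq_intros)
    from has_derivative_compose[OF this assms(1)]
    show "((\<lambda>s. f (x + s *\<^sub>R e)) has_derivative (\<lambda>h. D (x + s *\<^sub>R e) (h *\<^sub>R e))) (at s within {0..t})" .
    show "onorm (\<lambda>h. D (x + s *\<^sub>R e) (h *\<^sub>R e)) \<le> C"
    proof (rule onorm_le)
      fix h :: real
      have "D (x + s *\<^sub>R e) (h *\<^sub>R e) = h *\<^sub>R D (x + s *\<^sub>R e) e"
        using has_derivative_bounded_linear[OF assms(1)[of "x + s *\<^sub>R e"]] by (simp add: linear_simps)
      then show "norm (D (x + s *\<^sub>R e) (h *\<^sub>R e)) \<le> C * norm h"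
        using assms(3)[of s] s by (simp add: mult.commute[of "\<bar>h\<bar>"] mult_right_mono)
    qed
  qed (use assms(2) in auto)
  then show ?thesis using assms(2) by simp
qed

lemma test_fun_partial:
  assumes "test_fun \<phi>"
  shows "continuous_on UNIV (partial j \<phi>)" "(\<phi> has_derivative frechet_derivative \<phi> (at x)) (at x)"
proof -
  have "C_k (Suc 0) \<phi>" using assms unfolding test_fun_def by blast
  then show "continuous_on UNIV (partial j \<phi>)" "(\<phi> has_derivative frechet_derivative \<phi> (at x)) (at x)"
    by (auto simp: frechet_derivative_works)
qed

lemma test_fun_torus_fun: "test_fun \<phi> \<Longrightarrow> torus_fun \<phi>"
  by (simp add: test_fun_def)

lemma continuous_bounded_on_box:
  fixes f :: "'d::finite tfun"
  assumes "continuous_on UNIV f"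
  obtains C where "\<And>x. x \<in> cbox 0 2 \<Longrightarrow> norm (f x) \<le> C"
proof -
  have "compact (f ` cbox 0 2)"
    using assms by (intro compact_continuous_image) (auto intro: continuous_on_subset)
  then have "bounded (f ` cbox 0 2)" by (rule compact_imp_bounded)
  then show ?thesis using that unfolding bounded_iff by auto
qed

lemma space_torus: "space torus_measure = cbox (0 :: real ^ 'd::finite) 1"
  by (simp add: torus_measure_def space_restrict_space)

lemma cbox_1_2: "x \<in> cbox 0 1 \<Longrightarrow> 0 \<le> t \<Longrightarrow> t \<le> 1 \<Longrightarrow> x + t *\<^sub>R axis j 1 \<in> cbox 0 (2 :: real ^ 'd::finite)"
  unfolding mem_box_cart
proof
  fix i assume "\<forall>i. 0 $ i \<le> x $ i \<and> x $ i \<le> 1 $ i" "0 \<le> t" "t \<le> 1"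
  then have "0 \<le> x $ i" "x $ i \<le> 1" "0 \<le> t" "t \<le> 1" by auto
  then show "0 $ i \<le> (x + t *\<^sub>R axis j 1) $ i \<and> (x + t *\<^sub>R axis j 1) $ i \<le> 2 $ i"
    by (cases "i = j") (auto simp: axis_def)
qed

lemma continuous_torus_integrable:
  fixes f :: "'d::finite tfun"
  assumes "continuous_on UNIV f"
  shows "integrable torus_measure f"
proof -
  obtain C where C: "\<And>x. x \<in> cbox 0 2 \<Longrightarrow> norm (f x) \<le> C"
    using continuous_bounded_on_box[OF assms] by blast
  have "norm (f x) \<le> C" if "x \<in> cbox 0 1" for x
    using C[of x] cbox_1_2[OF that, of 0] by simp
  then show ?thesis
    using assms by (intro torus.integrable_const_bound[where B=C])
      (auto simp: space_torus intro!: AE_I2 torus_measurable borel_measurable_continuous_onI)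
qed

text \<open>Integration by parts without boundary terms: by translation invariance, the coefficient
  of a difference quotient of \<phi> is the difference quotient of \<open>chi n\<close> at 0 times
  \<open>coef \<phi> n\<close>. Both sides converge, the former by dominated convergence.\<close>

lemma coef_partial:
  assumes "test_fun \<phi>"
  shows "coef (partial j \<phi>) n = 2 * pi * \<i> * of_int (n $ j) * coef \<phi> n"
proof -
  let ?e = "axis j 1 :: real ^ 'a"
  define D where "D k x = (\<phi> (x + recip k *\<^sub>R ?e) - \<phi> x) / of_real (recip k)" for k x
  have tf: "torus_fun \<phi>" using assms by (rule test_fun_torus_fun)
  have [measurable]: "\<phi> \<in> borel_measurable borel" using tf by simp
  have cont: "continuous_on UNIV (partial j \<phi>)" and der: "\<And>x. (\<phi> has_derivative frechet_derivative \<phi> (at x)) (at x)"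
    using test_fun_partial[OF assms] by auto
  have contphi: "continuous_on UNIV \<phi>" using der by (meson has_derivative_continuous_on has_derivative_at_withinI)
  have [measurable]: "partial j \<phi> \<in> borel_measurable borel" using cont by (rule borel_measurable_continuous_onI)
  obtain C where C: "\<And>x. x \<in> cbox 0 2 \<Longrightarrow> norm (partial j \<phi> x) \<le> C"
    using continuous_bounded_on_box[OF cont] by blast
  have "(\<lambda>k. coef (D k) n) \<longlonglongrightarrow> coef (partial j \<phi>) n"
    unfolding coef_def
  proof (rule integral_dominated_convergence[where w="\<lambda>x. C"])
    show "AE x in torus_measure. (\<lambda>k. D k x * chi (- n) x) \<longlonglongrightarrow> partial j \<phi> x * chi (- n) x"
      unfolding D_def partial_def
      by (intro AE_I2 tendsto_intros difference_quotient_tendsto der) simp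
    show "AE x in torus_measure. norm (D k x * chi (- n) x) \<le> C" for k
    proof (rule AE_I2)
      fix x :: "real ^ 'a" assume "x \<in> space torus_measure"
      then have x: "x \<in> cbox 0 1" by (simp add: space_torus)
      have "norm (\<phi> (x + recip k *\<^sub>R ?e) - \<phi> x) \<le> C * recip k"
      proof (rule difference_bound[OF der])
        fix s assume "0 \<le> s" "s \<le> recip k"
        then have "x + s *\<^sub>R ?e \<in> cbox 0 2" using cbox_1_2[OF x] recip(2)[of k] by auto
        from C[OF this] show "norm (frechet_derivative \<phi> (at (x + s *\<^sub>R ?e)) ?e) \<le> C"
          by (simp add: partial_def)
      qed (use recip(1)[of k] in simp)
      then show "norm (D k x * chi (- n) x) \<le> C"
        using recip(1)[of k] by (simp add: D_def norm_mult norm_divide divide_le_eq)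
    qed
    show "(\<lambda>x. D k x * chi (- n) x) \<in> borel_measurable torus_measure" for k
      unfolding D_def by (intro torus_measurable) measurable
    show "(\<lambda>x. partial j \<phi> x * chi (- n) x) \<in> borel_measurable torus_measure"
      by (intro torus_measurable) measurable
  qed simp
  moreover have "coef (D k) n = (chi n (0 + recip k *\<^sub>R ?e) - chi n 0) / of_real (recip k) * coef \<phi> n" for k
  proof -
    have i1: "integrable torus_measure \<phi>" by (rule continuous_torus_integrable[OF contphi])
    have "coef (D k) n = coef (\<lambda>x. (1 / of_real (recip k)) * (translate (- (recip k *\<^sub>R ?e)) \<phi> x - \<phi> x)) n"
    proof -
      have "D k = (\<lambda>x. (1 / of_real (recip k)) * (translate (- (recip k *\<^sub>R ?e)) \<phi> x - \<phi> x))"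
        by (simp add: fun_eq_iff D_def translate_def)
      then show ?thesis by (simp only:)
    qed
    also have "\<dots> = (1 / of_real (recip k)) * (coef (translate (- (recip k *\<^sub>R ?e)) \<phi>) n - coef \<phi> n)"
      using i1 torus_integrable_shift_imp[OF tf i1, of "recip k *\<^sub>R ?e"]
      unfolding coef_cmult by (subst coef_diff) (simp_all add: translate_def)
    also have "\<dots> = (1 / of_real (recip k)) * (chi n (recip k *\<^sub>R ?e) * coef \<phi> n - coef \<phi> n)"
      by (simp add: coef_translate[OF tf])
    finally show ?thesis by (simp add: chi_def algebra_simps diff_divide_distrib)
  qed
  moreover have "(\<lambda>k. (chi n (0 + recip k *\<^sub>R ?e) - chi n 0) / of_real (recip k) * coef \<phi> n) \<longlonglongrightarrow>
      (chi n 0 * (\<i> * of_real (2 * pi * (\<Sum>i\<in>UNIV. of_int (n $ i) * ?e $ i)))) * coef \<phi> n"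
    by (intro tendsto_intros difference_quotient_tendsto has_derivative_chi) simp
  ultimately have "coef (partial j \<phi>) n = (chi n 0 * (\<i> * of_real (2 * pi * (\<Sum>i\<in>UNIV. of_int (n $ i) * ?e $ i)))) * coef \<phi> n"
    using LIMSEQ_unique by auto
  moreover have "chi n 0 = 1" by (simp add: chi_def)
  ultimately show ?thesis by (simp add: sum_axis)
qed

lemma tpoly_integral_partial:
  assumes \<phi>: "test_fun \<phi>" and "tpoly f F"
  shows "integrable torus_measure (\<lambda>x. f x * partial l \<phi> x) \<and> integrable torus_measure (\<lambda>x. F l x * \<phi> x) \<and>
    (LINT x|torus_measure. f x * partial l \<phi> x) = - (LINT x|torus_measure. F l x * \<phi> x)"
  using assms(2)
proof induction
  case (tpoly_chi n)
  have cont: "continuous_on UNIV (partial l \<phi>)" and der: "\<And>x. (\<phi> has_derivative frechet_derivative \<phi> (at x)) (at x)"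
    using test_fun_partial[OF \<phi>] by auto
  then have "continuous_on UNIV \<phi>" by (meson has_derivative_continuous_on has_derivative_at_withinI)
  with cont have i: "integrable torus_measure \<phi>" "integrable torus_measure (partial l \<phi>)"
    by (auto intro: continuous_torus_integrable)
  \<comment> \<open>Reading \<open>coef_partial\<close> at the frequency -n turns the conjugate
    character into \<open>chi n\<close> and produces the minus sign of integration by parts.\<close>
  have "(LINT x|torus_measure. chi n x * partial l \<phi> x) = - (LINT x|torus_measure. 2 * pi * \<i> * of_int (n $ l) * chi n x * \<phi> x)"
    using coef_partial[OF \<phi>, of l "- n"] by (simp add: coef_def mult.assoc mult.commute[of "chi n _"])
  then show ?case using integrable_mult_chi[OF i(1), of n] integrable_mult_chi[OF i(2), of n]
    by (simp add: mult.assoc mult.commute[of "chi n _"])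
next
  case (tpoly_add f F g G)
  then show ?case by (simp add: algebra_simps)
next
  case (tpoly_cmult f F c)
  then show ?case by (simp add: mult.assoc)
qed

lemma tpoly_weak_partial: "tpoly f F \<Longrightarrow> is_weak_partial l f (F l)"
  unfolding is_weak_partial_def L1_iff
  using tpoly_integral_partial tpoly_torus_fun' tpoly_integrable' by blast

text \<open>The character \<open>chi (- n)\<close> is a test function. Consequently a weak
  derivative is determined up to \<open>ae_eq\<close> by the coefficients of f.\<close>

lemma coef_weak_partial:
  assumes "is_weak_partial l f g"
  shows "coef g n = 2 * pi * \<i> * of_int (n $ l) * coef f n"
proof -
  have "(LINT x|torus_measure. f x * partial l (chi (- n)) x) = - coef g n"
    using assms test_fun_chi[of "- n"] by (simp add: is_weak_partial_def coef_def)
  moreover have "f x * partial l (chi (- n)) x = (- 2 * pi * \<i> * of_int (n $ l)) * (f x * chi (- n) x)" for x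
    using partial_cmult_chi[of l 1 "- n"] by simp
  ultimately show ?thesis by (simp add: coef_def)
qed

lemma Sobolev11_iff: "f \<in> elems Sobolev11 \<longleftrightarrow> f \<in> elems (Lp 1) \<and> (\<forall>j. \<exists>g. is_weak_partial j f g)"
  by (simp add: Sobolev11_def)

lemma Sobolev11_torus_fun: "f \<in> elems Sobolev11 \<Longrightarrow> torus_fun f"
  and Sobolev11_integrable: "f \<in> elems Sobolev11 \<Longrightarrow> integrable torus_measure f"
  unfolding Sobolev11_iff L1_iff by auto

lemma weak_partial_works: "f \<in> elems Sobolev11 \<Longrightarrow> is_weak_partial j f (weak_partial j f)"
  unfolding weak_partial_def Sobolev11_iff by (metis someI)

lemma tpoly_Sobolev11: "tpoly f F \<Longrightarrow> f \<in> elems Sobolev11"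
  unfolding Sobolev11_iff L1_iff using tpoly_weak_partial tpoly_torus_fun tpoly_integrable by blast

lemma size_of_Sobolev11: "size_of Sobolev11 f = l1 f + (\<Sum>j\<in>UNIV. l1 (weak_partial j f))"
  by (simp add: Sobolev11_def size_of_L1)

text \<open>\<open>weak_partial\<close> is an arbitrary choice, but it has the coefficients of the
  explicit gradient and therefore the same L1 norm.\<close>

lemma tpoly_size_of_Sobolev11:
  assumes "tpoly f F"
  shows "size_of Sobolev11 f = l1 f + (\<Sum>j\<in>UNIV. l1 (F j))"
proof -
  have "l1 (weak_partial j f) = l1 (F j)" for j
  proof -
    have w: "is_weak_partial j f (weak_partial j f)" "is_weak_partial j f (F j)"
      using assms tpoly_Sobolev11 weak_partial_works tpoly_weak_partial by blast+
    then have "torus_fun (weak_partial j f)" "integrable torus_measure (weak_partial j f)"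
      "torus_fun (F j)" "integrable torus_measure (F j)"
      unfolding is_weak_partial_def L1_iff by auto
    then show ?thesis
      using w by (intro l1_cong coef_eq_imp_ae_eq) (auto simp: coef_weak_partial)
  qed
  then show ?thesis by (simp add: size_of_Sobolev11)
qed

text \<open>Coefficients of an integrable derivative are bounded by its L1 norm. Applied to the
  images of characters under the first factor, this is the source of the decay of its
  multipliers.\<close>

lemma norm_coef_le_Sobolev11:
  assumes f: "f \<in> elems Sobolev11"
  shows "2 * pi * \<bar>real_of_int (n $ j)\<bar> * norm (coef f n) \<le> size_of Sobolev11 f"
proof -
  have w: "is_weak_partial j f (weak_partial j f)" using f by (rule weak_partial_works)
  then have "integrable torus_measure (weak_partial j f)"
    unfolding is_weak_partial_def L1_iff by auto
  then have "norm (coef (weak_partial j f) n) \<le> l1 (weak_partial j f)"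
    unfolding l1_def by (rule norm_coef_le)
  also have "\<dots> \<le> (\<Sum>j\<in>UNIV. l1 (weak_partial j f))" by (intro member_le_sum) auto
  also have "\<dots> \<le> size_of Sobolev11 f" by (simp add: size_of_Sobolev11)
  finally show ?thesis by (simp add: coef_weak_partial[OF w] norm_mult)
qed

section \<open>Translation invariant operators as Fourier multipliers\<close>

lemma bounded_operatorD:
  assumes "bounded_operator X Y T"
  shows "f \<in> elems X \<Longrightarrow> T f \<in> elems Y"
    "f \<in> elems X \<Longrightarrow> g \<in> elems X \<Longrightarrow> ae_eq f g \<Longrightarrow> ae_eq (T f) (T g)"
    "f \<in> elems X \<Longrightarrow> g \<in> elems X \<Longrightarrow> ae_eq (T (\<lambda>x. f x + g x)) (\<lambda>x. T f x + T g x)"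
    "f \<in> elems X \<Longrightarrow> ae_eq (T (\<lambda>x. c * f x)) (\<lambda>x. c * T f x)"
  using assms unfolding bounded_operator_def by auto

lemma bounded_operator_bound:
  assumes "bounded_operator X Y T" "\<And>f. f \<in> elems X \<Longrightarrow> 0 \<le> size_of X f"
  obtains C where "C > 0" "\<And>f. f \<in> elems X \<Longrightarrow> size_of Y (T f) \<le> C * size_of X f"
proof -
  obtain C where C: "\<forall>f\<in>elems X. size_of Y (T f) \<le> C * size_of X f"
    using assms unfolding bounded_operator_def by auto
  have "size_of Y (T f) \<le> (\<bar>C\<bar> + 1) * size_of X f" if "f \<in> elems X" for f
  proof -
    have "C * size_of X f \<le> (\<bar>C\<bar> + 1) * size_of X f"
      using assms(2)[OF that] by (intro mult_right_mono) auto
    then show ?thesis using C that by fastforce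
  qed
  then show ?thesis using that[of "\<bar>C\<bar> + 1"] by auto
qed

text \<open>Translation multiplies \<open>chi n\<close> by a phase, hence it multiplies the image by
  the same phase. At k different from n a shift that separates the two characters forces the
  coefficient of the image to vanish.\<close>

lemma translation_invariant_chi:
  assumes T: "bounded_operator X Y T" and ti: "translation_invariant X T" and chi: "chi n \<in> elems X"
    and X: "\<And>c. (\<lambda>x. c * chi n x) \<in> elems X"
    and Y: "\<And>g. g \<in> elems Y \<Longrightarrow> torus_fun g \<and> integrable torus_measure g"
  shows "ae_eq (T (chi n)) (\<lambda>x. coef (T (chi n)) n * chi n x)"
proof -
  define g where "g = T (chi n)"
  have g: "torus_fun g" "integrable torus_measure g"
    using Y bounded_operatorD(1)[OF T chi] by (auto simp: g_def)
  have "coef g k = 0" if "k \<noteq> n" for k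
  proof -
    obtain h where h: "chi (k - n) h = - 1" using chi_eq_minus_1[of "k - n"] \<open>k \<noteq> n\<close> by auto
    have tr: "translate (- h) (chi n) = (\<lambda>x. chi n h * chi n x)"
      by (simp add: translate_def chi_shift mult.commute)
    have "ae_eq (T (translate (- h) (chi n))) (translate (- h) g)"
      using ti chi by (simp add: translation_invariant_def g_def)
    moreover have "ae_eq (T (translate (- h) (chi n))) (\<lambda>x. chi n h * g x)"
      unfolding tr g_def by (rule bounded_operatorD(4)[OF T chi])
    ultimately have "ae_eq (translate (- h) g) (\<lambda>x. chi n h * g x)"
      using ae_eq_sym ae_eq_trans by blast
    then have "coef (translate (- h) g) k = coef (\<lambda>x. chi n h * g x) k"
      by (intro coef_cong torus_fun_translate torus_fun_cmult g)
    then have "chi k h * coef g k = chi n h * coef g k"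
      by (simp add: coef_translate[OF g(1)] coef_cmult)
    moreover have "chi k h = - chi n h"
      using chi_add[of "k - n" n h] h by simp
    ultimately show ?thesis by simp
  qed
  then have "ae_eq g (\<lambda>x. coef g n * chi n x)"
    using g by (intro coef_eq_imp_ae_eq)
      (auto intro: torus_fun_cmult simp: coef_cmult coef_chi L2_integrable)
  then show ?thesis by (simp add: g_def)
qed

lemma cmult_chi_Sobolev11: "(\<lambda>x. c * chi n x) \<in> elems Sobolev11"
  by (rule tpoly_Sobolev11[OF tpoly_cmult[OF tpoly_chi]])

lemma chi_Sobolev11: "chi n \<in> elems Sobolev11"
  by (rule tpoly_Sobolev11[OF tpoly_chi])

lemma coef_operator_tpoly:
  assumes B: "bounded_operator Sobolev11 (Lp 2) B"
    and b: "\<And>n. ae_eq (B (chi n)) (\<lambda>x. b n * chi n x)" and "tpoly f F"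
  shows "coef (B f) n = b n * coef f n"
  using assms(3)
proof induction
  case (tpoly_chi m)
  have "coef (B (chi m)) n = coef (\<lambda>x. b m * chi m x) n"
    using bounded_operatorD(1)[OF B chi_Sobolev11] by (intro coef_cong b) (auto intro: L2_torus_fun torus_fun_cmult)
  then show ?case by (simp add: coef_cmult coef_chi)
next
  case (tpoly_add f F g G)
  have fg: "f \<in> elems Sobolev11" "g \<in> elems Sobolev11" "(\<lambda>x. f x + g x) \<in> elems Sobolev11"
    using tpoly_add.hyps tpoly.tpoly_add tpoly_Sobolev11 by blast+
  note Bfg = fg[THEN bounded_operatorD(1)[OF B]]
  have "coef (B (\<lambda>x. f x + g x)) n = coef (\<lambda>x. B f x + B g x) n"
    using Bfg by (intro coef_cong bounded_operatorD(3)[OF B] fg) (auto intro: L2_torus_fun torus_fun_add)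
  also have "\<dots> = coef (B f) n + coef (B g) n" using Bfg by (simp add: coef_add L2_integrable)
  finally show ?case using fg tpoly_add.IH by (simp add: coef_add Sobolev11_integrable algebra_simps)
next
  case (tpoly_cmult f F c)
  have fg: "f \<in> elems Sobolev11" "(\<lambda>x. c * f x) \<in> elems Sobolev11"
    using tpoly_cmult.hyps tpoly.tpoly_cmult tpoly_Sobolev11 by blast+
  note Bfg = fg[THEN bounded_operatorD(1)[OF B]]
  have "coef (B (\<lambda>x. c * f x)) n = coef (\<lambda>x. c * B f x) n"
    using Bfg by (intro coef_cong bounded_operatorD(4)[OF B] fg) (auto intro: L2_torus_fun torus_fun_cmult)
  then show ?case using tpoly_cmult.IH by (simp add: coef_cmult)
qed

lemma bounded_operator_L2_bound:
  assumes "bounded_operator (Lp 2) (Lp 2) T"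
  obtains C where "C > 0" "\<And>f. f \<in> L2 \<Longrightarrow> sqrt (l2sq (T f)) \<le> C * sqrt (l2sq f)"
  using bounded_operator_bound[OF assms] unfolding size_of_L2 by auto

lemma coef_operator_trig:
  assumes T: "bounded_operator (Lp 2) (Lp 2) T"
    and m: "\<And>n. ae_eq (T (chi n)) (\<lambda>x. m n * chi n x)" and "finite F"
  shows "coef (T (trig c F)) n = m n * coef (trig c F) n"
  using assms(3)
proof induction
  case empty
  \<comment> \<open>Written as a scalar multiple, the zero function is covered by homogeneity with
    factor 0, which gives its image up to \<open>ae_eq\<close>.\<close>
  have 0: "trig c {} = (\<lambda>x. 0 * 0)" by (simp add: trig_def fun_eq_iff)
  have "ae_eq (T (\<lambda>x. 0 * 0)) (\<lambda>x. 0 * T (\<lambda>x. 0) x)"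
    using bounded_operatorD(4)[OF T L2_const[of 0], of 0] .
  then have "coef (T (trig c {})) n = coef (\<lambda>x. 0 * T (\<lambda>x. 0) x) n"
    unfolding 0 by (intro coef_cong) (auto intro!: L2_torus_fun bounded_operatorD(1)[OF T] L2_cmult)
  moreover have "coef (\<lambda>x. 0 * T (\<lambda>x. 0) x) n = 0" by (simp add: coef_def)
  ultimately show ?case by (simp add: coef_trig)
next
  case (insert k F)
  have 1: "trig c (insert k F) = (\<lambda>x. c k * chi k x + trig c F x)"
    using insert by (simp add: trig_def fun_eq_iff)
  have mem: "(\<lambda>x. c k * chi k x) \<in> L2" "trig c F \<in> L2" "(\<lambda>x. c k * chi k x + trig c F x) \<in> L2"
    by (intro L2_cmult L2_add L2_chi trig_L2)+
  note Tm = mem[THEN bounded_operatorD(1)[OF T]]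
  have "coef (T (\<lambda>x. c k * chi k x + trig c F x)) n = coef (\<lambda>x. T (\<lambda>x. c k * chi k x) x + T (trig c F) x) n"
    using Tm by (intro coef_cong bounded_operatorD(3)[OF T] mem) (auto intro: L2_torus_fun torus_fun_add)
  also have "\<dots> = coef (T (\<lambda>x. c k * chi k x)) n + coef (T (trig c F)) n"
    using Tm by (simp add: coef_add L2_integrable)
  also have "coef (T (\<lambda>x. c k * chi k x)) n = coef (\<lambda>x. c k * (m k * chi k x)) n"
    using Tm ae_eq_trans[OF bounded_operatorD(4)[OF T L2_chi] ae_eq_cmult[OF m]]
    by (intro coef_cong) (auto intro!: L2_torus_fun L2_cmult)
  also have "\<dots> = m n * coef (\<lambda>x. c k * chi k x) n" by (simp add: coef_cmult coef_chi)
  finally show ?case using mem unfolding 1 insert.IH by (simp add: coef_add L2_integrable algebra_simps)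
qed

text \<open>On trigonometric sums this is linearity; boundedness of T makes the contribution of the
  remainder arbitrarily small.\<close>

lemma coef_operator_L2:
  assumes T: "bounded_operator (Lp 2) (Lp 2) T"
    and m: "\<And>n. ae_eq (T (chi n)) (\<lambda>x. m n * chi n x)" and f: "f \<in> L2"
  shows "coef (T f) n = m n * coef f n"
proof -
  obtain C where C: "C > 0" "\<And>f. f \<in> L2 \<Longrightarrow> sqrt (l2sq (T f)) \<le> C * sqrt (l2sq f)"
    using bounded_operator_L2_bound[OF T] by blast
  have "norm (coef (T f) n - m n * coef f n) \<le> e" if "e > 0" for e
  proof -
    define \<delta> where "\<delta> = (e / C)\<^sup>2"
    have "\<delta> > 0" using that C(1) by (simp add: \<delta>_def)
    then obtain F where F: "finite F" "\<And>G. finite G \<Longrightarrow> F \<subseteq> G \<Longrightarrow> l2sq (\<lambda>x. f x - trig (coef f) G x) \<le> \<delta>"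
      using L2_trig_approx[OF f] by metis
    define p where "p = trig (coef f) (insert n F)"
    have p: "p \<in> L2" "(\<lambda>x. f x - p x) \<in> L2" using f by (auto simp: p_def intro: L2_diff)
    note Tp = p[THEN bounded_operatorD(1)[OF T]]
    have "ae_eq (T (\<lambda>x. (f x - p x) + p x)) (\<lambda>x. T (\<lambda>x. f x - p x) x + T p x)"
      by (rule bounded_operatorD(3)[OF T p(2,1)])
    then have "coef (T f) n = coef (\<lambda>x. T (\<lambda>x. f x - p x) x + T p x) n"
      using Tp bounded_operatorD(1)[OF T f] by (intro coef_cong) (auto intro: L2_torus_fun torus_fun_add)
    also have "\<dots> = coef (T (\<lambda>x. f x - p x)) n + coef (T p) n" using Tp by (simp add: coef_add L2_integrable)
    also have "coef (T p) n = m n * coef f n"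
      unfolding p_def using F(1) by (subst coef_operator_trig[OF T m]) (auto simp: coef_trig)
    finally have "norm (coef (T f) n - m n * coef f n) = norm (coef (T (\<lambda>x. f x - p x)) n)" by simp
    also have "\<dots> \<le> sqrt (l2sq (T (\<lambda>x. f x - p x)))" using Tp by (intro norm_coef_le_L2)
    also have "\<dots> \<le> C * sqrt (l2sq (\<lambda>x. f x - p x))" using p by (intro C)
    also have "\<dots> \<le> C * sqrt \<delta>" using F C(1) by (intro mult_left_mono real_sqrt_le_mono) (auto simp: p_def)
    also have "\<dots> = e" using C(1) that by (simp add: \<delta>_def)
    finally show ?thesis .
  qed
  then have "norm (coef (T f) n - m n * coef f n) \<le> 0" by (rule field_le_epsilon) auto
  then show ?thesis by simp
qed

text \<open>All that the estimates retain of the factorization. The decay of \<open>a\<close> holds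
  because A maps the unit vectors \<open>chi n\<close> boundedly into the Sobolev space; the factor
  2 pi from differentiation exceeds 1 and is dropped.\<close>

lemma factorization_multiplier:
  assumes T: "bounded_operator (Lp 2) (Lp 2) T" and "admits_invariant_factorization (Lp 2) Sobolev11 (Lp 2) T"
  obtains a b B CA CB where "bounded_operator Sobolev11 (Lp 2) B" "CA > 0" "CB > 0"
    "\<And>n. ae_eq (B (chi n)) (\<lambda>x. b n * chi n x)"
    "\<And>n. ae_eq (T (chi n)) (\<lambda>x. a n * b n * chi n x)"
    "\<And>n j. \<bar>real_of_int (n $ j)\<bar> * norm (a n) \<le> CA"
    "\<And>f. f \<in> elems Sobolev11 \<Longrightarrow> sqrt (l2sq (B f)) \<le> CB * size_of Sobolev11 f"
proof -
  obtain A B where A: "bounded_operator (Lp 2) Sobolev11 A" "translation_invariant (Lp 2) A"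
    and B: "bounded_operator Sobolev11 (Lp 2) B" "translation_invariant Sobolev11 B"
    and TBA: "\<forall>f\<in>L2. ae_eq (T f) (B (A f))"
    using assms unfolding admits_invariant_factorization_def by blast
  define a where "a n = coef (A (chi n)) n" for n
  define b where "b n = coef (B (chi n)) n" for n
  have a: "ae_eq (A (chi n)) (\<lambda>x. a n * chi n x)" for n
    unfolding a_def by (rule translation_invariant_chi[OF A])
      (auto simp: L2_cmult Sobolev11_torus_fun Sobolev11_integrable)
  have b: "ae_eq (B (chi n)) (\<lambda>x. b n * chi n x)" for n
    unfolding b_def by (rule translation_invariant_chi[OF B])
      (auto simp: chi_Sobolev11 cmult_chi_Sobolev11 L2_torus_fun L2_integrable)
  have "ae_eq (T (chi n)) (\<lambda>x. a n * b n * chi n x)" for n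
  proof -
    have "ae_eq (T (chi n)) (B (A (chi n)))" using TBA by simp
    also have "ae_eq (B (A (chi n))) (B (\<lambda>x. a n * chi n x))"
      by (intro bounded_operatorD(2)[OF B(1)] a bounded_operatorD(1)[OF A(1)] L2_chi cmult_chi_Sobolev11)
    also have "ae_eq (B (\<lambda>x. a n * chi n x)) (\<lambda>x. a n * B (chi n) x)"
      by (intro bounded_operatorD(4)[OF B(1)] chi_Sobolev11)
    also have "ae_eq (\<lambda>x. a n * B (chi n) x) (\<lambda>x. a n * (b n * chi n x))"
      by (intro ae_eq_cmult b)
    finally show ?thesis by (simp add: mult.assoc)
  qed
  moreover obtain CA where CA: "CA > 0" "\<And>f. f \<in> L2 \<Longrightarrow> size_of Sobolev11 (A f) \<le> CA * size_of (Lp 2) f"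
    using bounded_operator_bound[OF A(1)] by (metis size_of_L2 real_sqrt_ge_zero l2sq_nonneg)
  moreover have "\<bar>real_of_int (n $ j)\<bar> * norm (a n) \<le> CA" for n j
  proof -
    have "l2sq (chi n) = 1" by (simp add: l2sq_def)
    then have "2 * pi * \<bar>real_of_int (n $ j)\<bar> * norm (a n) \<le> CA"
      using norm_coef_le_Sobolev11[OF bounded_operatorD(1)[OF A(1) L2_chi], of n j n] CA(2)[OF L2_chi, of n]
      by (simp add: a_def size_of_L2)
    moreover have "1 * (\<bar>real_of_int (n $ j)\<bar> * norm (a n)) \<le> 2 * pi * (\<bar>real_of_int (n $ j)\<bar> * norm (a n))"
      using pi_gt3 by (intro mult_right_mono) auto
    ultimately show ?thesis by simp
  qed
  moreover obtain CB where "CB > 0" "\<And>f. f \<in> elems Sobolev11 \<Longrightarrow> sqrt (l2sq (B f)) \<le> CB * size_of Sobolev11 f"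
  proof (rule bounded_operator_bound[OF B(1)])
    show "0 \<le> size_of Sobolev11 f" for f :: "'a tfun"
      by (auto simp: size_of_Sobolev11 intro!: add_nonneg_nonneg sum_nonneg)
  qed (use that in \<open>auto simp: size_of_L2\<close>)
  ultimately show ?thesis using that[OF B(1) _ _ b, of CA CB a] by blast
qed

section \<open>Test functions for multipliers on the Sobolev space\<close>

text \<open>The maximum norm. Some coordinate attains it, so the quotients by that coordinate lie in
  [-1,1] and can encode the direction of a frequency.\<close>

definition snorm :: "int ^ 'd::finite \<Rightarrow> nat" where
  "snorm n = Max (range (\<lambda>i. nat \<bar>n $ i\<bar>))"

lemma snorm_le_iff: "snorm n \<le> L \<longleftrightarrow> (\<forall>i. \<bar>n $ i\<bar> \<le> int L)"
  by (auto simp: snorm_def nat_le_iff)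

lemma abs_le_snorm: "\<bar>n $ i\<bar> \<le> int (snorm n)"
  using snorm_le_iff[of n "snorm n"] by simp

lemma snorm_attained: "\<exists>i. \<bar>n $ i\<bar> = int (snorm n)"
proof -
  have "snorm n \<in> range (\<lambda>i. nat \<bar>n $ i\<bar>)"
    unfolding snorm_def by (rule Max_in) auto
  then show ?thesis by auto
qed

lemma snorm_add_le: "snorm (a + b) \<le> snorm a + snorm b"
  unfolding snorm_le_iff
proof
  fix i show "\<bar>(a + b) $ i\<bar> \<le> int (snorm a + snorm b)"
    using abs_le_snorm[of a i] abs_le_snorm[of b i] by simp
qed

lemma snorm_uminus [simp]: "snorm (- a) = snorm a"
  by (simp add: snorm_def)

lemma snorm_diff_le: "snorm (a - b) \<le> snorm a + snorm b"
  using snorm_add_le[of a "- b"] by simp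

lemma snorm_zero [simp]: "snorm 0 = 0"
  by (simp add: snorm_def)

lemma snorm_eq_0_iff [simp]: "snorm n = 0 \<longleftrightarrow> n = 0"
  using snorm_le_iff[of n 0] by (auto simp: vec_eq_iff)

definition cube_set :: "nat \<Rightarrow> (int ^ 'd::finite) set" where
  "cube_set L = {n. snorm n \<le> L}"

lemma bij_cube_set:
  "bij_betw (\<lambda>n. \<lambda>i\<in>UNIV. n $ i) (cube_set L :: (int ^ 'd::finite) set) (Pi\<^sub>E UNIV (\<lambda>_. {- int L..int L}))"
  by (rule bij_betw_byWitness[where f'="\<lambda>f. \<chi> i. f i"])
    (auto simp: cube_set_def snorm_le_iff vec_eq_iff fun_eq_iff PiE_iff abs_le_iff minus_le_iff)

lemma finite_cube_set [simp]: "finite (cube_set L :: (int ^ 'd::finite) set)"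
  using bij_betw_finite[OF bij_cube_set[of L, where ?'d='d]] by (simp add: finite_PiE)

lemma card_cube_set: "card (cube_set L :: (int ^ 'd::finite) set) = (2 * L + 1) ^ CARD('d)"
  using bij_betw_same_card[OF bij_cube_set[of L, where ?'d='d]] by (simp add: card_PiE nat_add_distrib nat_mult_distrib)

lemma tpoly_trig: "tpoly (trig c F) (\<lambda>l. trig (\<lambda>n. 2 * pi * \<i> * of_int (n $ l) * c n) F)"
  by (rule tpoly_cong[OF tpoly_sum[OF tpoly_cmult[OF tpoly_chi]]]) (auto simp: trig_def mult_ac)

lemma tpoly_L2: "tpoly f F \<Longrightarrow> f \<in> L2" "tpoly f F \<Longrightarrow> F l \<in> L2"
  using tpoly_bounded tpoly_torus_fun tpoly_bounded' tpoly_torus_fun' L2_I_bounded by blast+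

text \<open>Boundedness from \<open>W\<^sub>1\<^sup>1\<close> to \<open>L\<^sub>2\<close>, tested on trigonometric polynomials only.\<close>

definition sobolev_multiplier :: "(int ^ 'd::finite \<Rightarrow> complex) \<Rightarrow> real \<Rightarrow> bool" where
  "sobolev_multiplier b C \<longleftrightarrow> (\<forall>f F S. tpoly f F \<longrightarrow> finite S \<longrightarrow>
     (\<Sum>n\<in>S. (norm (b n) * norm (coef f n))\<^sup>2) \<le> (C * (l1 f + (\<Sum>j\<in>UNIV. l1 (F j))))\<^sup>2)"

lemma l1_triangle:
  "integrable torus_measure f \<Longrightarrow> integrable torus_measure g \<Longrightarrow> l1 (\<lambda>x. f x + g x) \<le> l1 f + l1 g"
proof -
  assume fg: "integrable torus_measure f" "integrable torus_measure g"
  have "l1 (\<lambda>x. f x + g x) \<le> (LINT x|torus_measure. norm (f x) + norm (g x))"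
    unfolding l1_def using fg by (intro integral_mono) (auto intro: norm_triangle_ineq)
  then show ?thesis using fg by (simp add: l1_def)
qed

lemma l1_cmult: "l1 (\<lambda>x. c * f x) = norm c * l1 f"
  by (simp add: l1_def norm_mult)

lemma l1_sum_le:
  "finite I \<Longrightarrow> (\<And>i. i \<in> I \<Longrightarrow> integrable torus_measure (f i)) \<Longrightarrow> l1 (\<lambda>x. \<Sum>i\<in>I. f i x) \<le> (\<Sum>i\<in>I. l1 (f i))"
proof (induction I rule: finite_induct)
  case empty
  then show ?case by (simp add: l1_def)
next
  case (insert i I)
  have "l1 (\<lambda>x. f i x + (\<Sum>i\<in>I. f i x)) \<le> l1 (f i) + l1 (\<lambda>x. \<Sum>i\<in>I. f i x)"
    using insert by (intro l1_triangle) auto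
  then show ?case using insert by simp
qed

lemma l1_mult_bounded:
  assumes "integrable torus_measure f" "integrable torus_measure (\<lambda>x. f x * g x)" "\<And>x. norm (g x) \<le> c"
  shows "l1 (\<lambda>x. f x * g x) \<le> c * l1 f"
proof -
  have "l1 (\<lambda>x. f x * g x) \<le> (LINT x|torus_measure. c * norm (f x))"
    unfolding l1_def
  proof (rule integral_mono)
    fix x show "norm (f x * g x) \<le> c * norm (f x)"
      using assms(3)[of x] by (simp add: norm_mult mult.commute[of c] mult_left_mono)
  qed (use assms in auto)
  then show ?thesis by (simp add: l1_def)
qed

text \<open>The kernel \<open>P * Q / N\<close> below has Fourier coefficients 1 on \<open>cube_set (2 * L)\<close>, and by the
  Cauchy-Schwarz inequality it is bounded in \<open>L\<^sub>1\<close> uniformly in \<open>L\<close>, its gradient being \<open>O(L)\<close>.\<close>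

lemma shell_sum:
  fixes b :: "int ^ 'd::finite \<Rightarrow> complex"
  assumes "sobolev_multiplier b C"
  obtains C1 where "C1 \<ge> 0"
    "\<And>L S. L \<ge> 1 \<Longrightarrow> finite S \<Longrightarrow> S \<subseteq> cube_set (2 * L) \<Longrightarrow> (\<Sum>n\<in>S. (norm (b n))\<^sup>2) \<le> C1 * (real L)\<^sup>2"
proof -
  \<comment> \<open>The square root of a bound for the ratio of the cube sizes: 6 L + 1 \<le> 3 (2 L
    + 1) in every coordinate.\<close>
  define K where "K = sqrt (3 ^ CARD('d))"
  \<comment> \<open>In each coordinate 8 pi = 2 pi + 3 * 2 pi collects the derivatives of Q
    (frequencies up to L) and of P (up to 3 L); the 1 accounts for the function itself, with L \<ge>
    1.\<close>
  define C1 where "C1 = (C * (K * (1 + 8 * pi * CARD('d))))\<^sup>2"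
  have "(\<Sum>n\<in>S. (norm (b n))\<^sup>2) \<le> C1 * (real L)\<^sup>2" if L: "L \<ge> 1" and S: "finite S" "S \<subseteq> cube_set (2 * L)" for L S
  proof -
    define P where "P = trig (\<lambda>_. 1) (cube_set (3 * L) :: (int ^ 'd) set)"
    define Q where "Q = trig (\<lambda>_. 1) (cube_set L :: (int ^ 'd) set)"
    define P' where "P' l = trig (\<lambda>n. 2 * pi * \<i> * of_int (n $ l) * 1) (cube_set (3 * L) :: (int ^ 'd) set)" for l
    define Q' where "Q' l = trig (\<lambda>n. 2 * pi * \<i> * of_int (n $ l) * 1) (cube_set L :: (int ^ 'd) set)" for l
    define N where "N = card (cube_set L :: (int ^ 'd) set)"
    have N: "real N > 0" by (simp add: N_def card_cube_set)
    have tpP: "tpoly P P'" unfolding P_def P'_def[abs_def] by (rule tpoly_trig)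
    have tpQ: "tpoly Q Q'" unfolding Q_def Q'_def[abs_def] by (rule tpoly_trig)
    define f where "f x = (1 / of_nat N) * (P x * Q x)" for x
    define F where "F l x = (1 / of_nat N) * (P x * Q' l x + P' l x * Q x)" for l x
    have tpf: "tpoly f F" unfolding f_def[abs_def] F_def[abs_def] by (intro tpoly_cmult tpoly_mult tpP tpQ)
    have c3: "sqrt (card (cube_set (3 * L) :: (int ^ 'd) set)) * sqrt N \<le> K * N"
    proof -
      have "card (cube_set (3 * L) :: (int ^ 'd) set) \<le> 3 ^ CARD('d) * N"
        unfolding N_def card_cube_set power_mult_distrib[symmetric] by (intro power_mono) auto
      then have "real (card (cube_set (3 * L) :: (int ^ 'd) set)) \<le> 3 ^ CARD('d) * real N"
        by (metis of_nat_le_iff of_nat_mult of_nat_numeral of_nat_power)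
      then have "sqrt (card (cube_set (3 * L) :: (int ^ 'd) set)) \<le> K * sqrt N"
        unfolding K_def real_sqrt_mult[symmetric] by (rule real_sqrt_le_mono)
      then have "sqrt (card (cube_set (3 * L) :: (int ^ 'd) set)) * sqrt N \<le> K * sqrt N * sqrt N"
        by (rule mult_right_mono) simp
      then show ?thesis by (simp add: mult.assoc)
    qed
    have sqP: "l2sq P = card (cube_set (3 * L) :: (int ^ 'd) set)" and sqQ: "l2sq Q = N"
      by (simp_all add: P_def Q_def l2sq_trig N_def)
    have sqd: "sqrt (l2sq (trig (\<lambda>n. 2 * pi * \<i> * of_int (n $ l) * 1) (cube_set M :: (int ^ 'd) set)))
        \<le> 2 * pi * M * sqrt (card (cube_set M :: (int ^ 'd) set))" for l M
    proof -
      have "l2sq (trig (\<lambda>n. 2 * pi * \<i> * of_int (n $ l) * 1) (cube_set M :: (int ^ 'd) set))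
          = (\<Sum>n\<in>(cube_set M :: (int ^ 'd) set). (2 * pi * \<bar>real_of_int (n $ l)\<bar>)\<^sup>2)"
        by (simp add: l2sq_trig norm_mult)
      also have "\<dots> \<le> (\<Sum>n\<in>(cube_set M :: (int ^ 'd) set). (2 * pi * M)\<^sup>2)"
      proof (intro sum_mono power_mono mult_left_mono)
        fix n :: "int ^ 'd" assume "n \<in> cube_set M"
        then have "\<bar>n $ l\<bar> \<le> int M" by (simp add: cube_set_def snorm_le_iff)
        then show "\<bar>real_of_int (n $ l)\<bar> \<le> real M" by linarith
      qed auto
      also have "\<dots> = (2 * pi * M)\<^sup>2 * card (cube_set M :: (int ^ 'd) set)" by simp
      finally have "sqrt (l2sq (trig (\<lambda>n. 2 * pi * \<i> * of_int (n $ l) * 1) (cube_set M :: (int ^ 'd) set)))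
        \<le> sqrt ((2 * pi * M)\<^sup>2 * card (cube_set M :: (int ^ 'd) set))" by (rule real_sqrt_le_mono)
      then show ?thesis by (simp add: real_sqrt_mult)
    qed
    have sP': "sqrt (l2sq (P' l)) \<le> 2 * pi * (3 * L) * sqrt (card (cube_set (3 * L) :: (int ^ 'd) set))"
      and sQ': "sqrt (l2sq (Q' l)) \<le> 2 * pi * L * sqrt N" for l
      using sqd[of l "3 * L"] sqd[of l L] by (simp_all add: P'_def Q'_def N_def)
    have lf: "l1 f \<le> K"
    proof -
      have "l1 f = (1 / real N) * l1 (\<lambda>x. P x * Q x)"
        unfolding f_def[abs_def] l1_cmult by (simp add: norm_divide)
      also have "\<dots> \<le> (1 / real N) * (K * N)"
        using l1_mult_le[of P Q] tpoly_L2(1)[OF tpP] tpoly_L2(1)[OF tpQ] c3 unfolding sqP sqQ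
        by (intro mult_left_mono) auto
      finally show ?thesis using N by simp
    qed
    have lF: "l1 (F l) \<le> 8 * pi * L * K" for l
    proof -
      have i: "P \<in> L2" "Q \<in> L2" "P' l \<in> L2" "Q' l \<in> L2" using tpoly_L2 tpP tpQ by blast+
      have "l1 (F l) = (1 / real N) * l1 (\<lambda>x. P x * Q' l x + P' l x * Q x)"
        unfolding F_def[abs_def] l1_cmult by (simp add: norm_divide)
      also have "\<dots> \<le> (1 / real N) * (2 * pi * L * (K * N) + 2 * pi * (3 * L) * (K * N))"
      proof (rule mult_left_mono)
        have "l1 (\<lambda>x. P x * Q' l x + P' l x * Q x) \<le> l1 (\<lambda>x. P x * Q' l x) + l1 (\<lambda>x. P' l x * Q x)"
          using i by (intro l1_triangle L2_mult_integrable')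
        also have "\<dots> \<le> sqrt (l2sq P) * sqrt (l2sq (Q' l)) + sqrt (l2sq (P' l)) * sqrt (l2sq Q)"
          using i by (intro add_mono l1_mult_le)
        also have "\<dots> \<le> sqrt (l2sq P) * (2 * pi * L * sqrt N) +
            2 * pi * (3 * L) * sqrt (card (cube_set (3 * L) :: (int ^ 'd) set)) * sqrt (l2sq Q)"
          by (intro add_mono mult_left_mono mult_right_mono sP' sQ') auto
        also have "\<dots> = 2 * pi * L * (sqrt (card (cube_set (3 * L) :: (int ^ 'd) set)) * sqrt N) +
            2 * pi * (3 * L) * (sqrt (card (cube_set (3 * L) :: (int ^ 'd) set)) * sqrt N)"
          unfolding sqP sqQ by (simp only: mult_ac)
        also have "\<dots> \<le> 2 * pi * L * (K * N) + 2 * pi * (3 * L) * (K * N)"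
          by (intro add_mono mult_left_mono c3) auto
        finally show "l1 (\<lambda>x. P x * Q' l x + P' l x * Q x) \<le> 2 * pi * L * (K * N) + 2 * pi * (3 * L) * (K * N)" .
      qed simp
      also have "\<dots> = 8 * pi * L * K" using N by (simp add: field_simps)
      finally show ?thesis .
    qed
    \<comment> \<open>The coefficient of P * Q at n counts the k in the small cube with n - k in the
      large one. Since 2 L + L = 3 L these are all k, and division by N gives 1.\<close>
    have fcf: "coef f n = 1" if "n \<in> cube_set (2 * L)" for n
    proof -
      have "coef (\<lambda>x. P x * Q x) n = coef (\<lambda>x. \<Sum>k\<in>cube_set L. P x * chi k x) n"
        by (simp add: Q_def trig_def sum_distrib_left)
      also have "\<dots> = (\<Sum>k\<in>cube_set L. coef P (n - k))"
        using tpoly_integrable[OF tpP] by (simp add: coef_sum coef_mult_chi)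
      also have "\<dots> = (\<Sum>k\<in>(cube_set L :: (int ^ 'd) set). 1)"
      proof (rule sum.cong)
        fix k :: "int ^ 'd" assume "k \<in> cube_set L"
        then have "n - k \<in> cube_set (3 * L)"
          using snorm_diff_le[of n k] \<open>n \<in> cube_set (2 * L)\<close> by (simp add: cube_set_def)
        then show "coef P (n - k) = 1" by (simp add: P_def coef_trig)
      qed simp
      finally show ?thesis using N unfolding f_def[abs_def] coef_cmult by (simp add: N_def card_gt_0_iff)
    qed
    have "(\<Sum>n\<in>S. (norm (b n))\<^sup>2) = (\<Sum>n\<in>S. (norm (b n) * norm (coef f n))\<^sup>2)"
      using S fcf by (intro sum.cong) auto
    also have "\<dots> \<le> (C * (l1 f + (\<Sum>j\<in>UNIV. l1 (F j))))\<^sup>2"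
      using assms tpf S unfolding sobolev_multiplier_def by blast
    also have "\<dots> = C\<^sup>2 * (l1 f + (\<Sum>j\<in>UNIV. l1 (F j)))\<^sup>2" by (simp add: power_mult_distrib)
    also have "\<dots> \<le> C\<^sup>2 * (K * (1 + 8 * pi * CARD('d)) * L)\<^sup>2"
    proof (intro mult_left_mono power_mono)
      have "(\<Sum>j\<in>UNIV. l1 (F j)) \<le> (\<Sum>j\<in>(UNIV :: 'd set). 8 * pi * L * K)"
        by (intro sum_mono lF)
      moreover have "K * 1 \<le> K * real L" using L by (intro mult_left_mono) (auto simp: K_def)
      ultimately show "l1 f + (\<Sum>j\<in>UNIV. l1 (F j)) \<le> K * (1 + 8 * pi * CARD('d)) * L"
        using lf by (simp add: algebra_simps)
    qed (auto intro!: add_nonneg_nonneg sum_nonneg)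
    also have "\<dots> = C1 * (real L)\<^sup>2" by (simp add: C1_def power_mult_distrib mult.assoc)
    finally show ?thesis .
  qed
  moreover have "C1 \<ge> 0" by (simp add: C1_def)
  ultimately show ?thesis using that by blast
qed

section \<open>Riesz products and the lacunary test function\<close>

definition cosf :: "int ^ 'd \<Rightarrow> 'd::finite tfun" where
  "cosf n x = complex_of_real (Re (chi n x))"

definition sinf :: "int ^ 'd \<Rightarrow> 'd::finite tfun" where
  "sinf n x = complex_of_real (Im (chi n x))"

lemma cosf_eq: "cosf n x = (1/2) * chi n x + (1/2) * chi (- n) x"
  by (simp add: cosf_def chi_minus complex_eq_iff)

lemma sinf_eq: "sinf n x = (- \<i> / 2) * chi n x + (\<i> / 2) * chi (- n) x"
  by (simp add: sinf_def chi_minus complex_eq_iff)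

lemma tpoly_cosf: "tpoly (cosf n) (\<lambda>l x. - (2 * pi * of_int (n $ l)) * sinf n x)"
  by (rule tpoly_cong[OF tpoly_add[OF tpoly_cmult[OF tpoly_chi[of n], of "1/2"] tpoly_cmult[OF tpoly_chi[of "- n"], of "1/2"]]])
    (auto simp: cosf_eq sinf_eq algebra_simps)

lemma tpoly_sinf: "tpoly (sinf n) (\<lambda>l x. 2 * pi * of_int (n $ l) * cosf n x)"
  by (rule tpoly_cong[OF tpoly_add[OF tpoly_cmult[OF tpoly_chi[of n], of "- \<i> / 2"] tpoly_cmult[OF tpoly_chi[of "- n"], of "\<i> / 2"]]])
    (auto simp: cosf_eq sinf_eq algebra_simps)

lemma norm_cosf_le: "norm (cosf n x) \<le> 1" and norm_sinf_le: "norm (sinf n x) \<le> 1"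
  using abs_Re_le_cmod[of "chi n x"] abs_Im_le_cmod[of "chi n x"] by (simp_all add: cosf_def sinf_def)

primrec riesz :: "(nat \<Rightarrow> int ^ 'd) \<Rightarrow> nat \<Rightarrow> 'd::finite tfun" where
  "riesz n 0 = (\<lambda>x. 1)"
| "riesz n (Suc k) = (\<lambda>x. riesz n k x * (1 + cosf (n k) x))"

primrec driesz :: "(nat \<Rightarrow> int ^ 'd) \<Rightarrow> nat \<Rightarrow> 'd \<Rightarrow> 'd::finite tfun" where
  "driesz n 0 = (\<lambda>l x. 0)"
| "driesz n (Suc k) = (\<lambda>l x. riesz n k x * (- (2 * pi * of_int (n k $ l)) * sinf (n k) x) + driesz n k l x * (1 + cosf (n k) x))"

lemma tpoly_riesz: "tpoly (riesz n k) (driesz n k)"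
proof (induction k)
  case 0
  show ?case by (simp add: tpoly_const)
next
  case (Suc k)
  show ?case
    by (rule tpoly_cong[OF tpoly_mult[OF Suc tpoly_add[OF tpoly_const[of 1] tpoly_cosf[of "n k"]]]]) auto
qed

lemma riesz_nonneg: "\<exists>r \<ge> 0. riesz n k x = complex_of_real r"
proof (induction k)
  case 0
  show ?case by (intro exI[of _ 1]) simp
next
  case (Suc k)
  then obtain r where r: "r \<ge> 0" "riesz n k x = complex_of_real r" by blast
  have "0 \<le> 1 + Re (chi (n k) x)" using abs_Re_le_cmod[of "chi (n k) x"] by simp
  then have "0 \<le> r * (1 + Re (chi (n k) x))" "riesz n (Suc k) x = complex_of_real (r * (1 + Re (chi (n k) x)))"
    using r by (simp_all add: cosf_def)
  then show ?case by blast
qed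

text \<open>All factors 1 + cos are nonnegative, so the L1 norm is the mean.\<close>

lemma l1_riesz: "complex_of_real (l1 (riesz n k)) = coef (riesz n k) 0"
proof -
  have "complex_of_real (norm (riesz n k x)) = riesz n k x" for x
    using riesz_nonneg[of n k x] by auto
  then have "complex_of_real (l1 (riesz n k)) = (LINT x|torus_measure. riesz n k x)"
    unfolding l1_def by (simp flip: integral_complex_of_real)
  then show ?thesis by (simp add: coef_def)
qed

lemma coef_mult_cosf:
  assumes "integrable torus_measure f"
  shows "coef (\<lambda>x. f x * (1 + cosf n x)) m = coef f m + (1/2) * coef f (m - n) + (1/2) * coef f (m + n)"
proof -
  have "(\<lambda>x. f x * (1 + cosf n x)) = (\<lambda>x. (f x + (1/2) * (f x * chi n x)) + (1/2) * (f x * chi (- n) x))"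
    by (simp add: fun_eq_iff cosf_eq algebra_simps)
  then show ?thesis using assms
    by (simp only: coef_add coef_cmult coef_mult_chi integrable_mult_right integrable_mult_chi
        Bochner_Integration.integrable_add diff_minus_eq_add)
qed

lemma coef_mult_sinf:
  assumes "integrable torus_measure f"
  shows "coef (\<lambda>x. f x * sinf n x) m = (\<i> / 2) * (coef f (m + n) - coef f (m - n))"
proof -
  have "(\<lambda>x. f x * sinf n x) = (\<lambda>x. (- \<i> / 2) * (f x * chi n x) + (\<i> / 2) * (f x * chi (- n) x))"
    by (simp add: fun_eq_iff sinf_eq algebra_simps)
  then have "coef (\<lambda>x. f x * sinf n x) m = (- \<i> / 2) * coef f (m - n) + (\<i> / 2) * coef f (m + n)" using assms
    by (simp only: coef_add coef_cmult coef_mult_chi integrable_mult_right integrable_mult_chi diff_minus_eq_add)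
  then show ?thesis by (simp add: algebra_simps)
qed

lemma riesz_integrable [simp]: "integrable torus_measure (riesz n k)" "integrable torus_measure (driesz n k l)"
  using tpoly_integrable[OF tpoly_riesz] tpoly_integrable'[OF tpoly_riesz] by blast+

text \<open>The increment from one Riesz product to the next is the product times the new cosine, so
  the sum telescopes. This makes the main term of the gradient bounded independently of the
  length.\<close>

lemma sum_riesz_cosf: "(\<Sum>k<K. riesz n k x * cosf (n k) x) = riesz n K x - 1"
  by (induction K) (auto simp: algebra_simps)

text \<open>A lacunary sequence with almost constant direction: along it the gradient of the sum below
  is, up to a small error, a constant vector times the Riesz product.\<close>

locale lacunary =
  fixes n :: "nat \<Rightarrow> int ^ 'd::finite" and K :: nat and j :: 'd and \<omega> :: "'d \<Rightarrow> real"
  assumes K: "K \<ge> 1"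
    and dominant: "\<And>k. k < K \<Longrightarrow> \<bar>n k $ j\<bar> = int (snorm (n k))"
    and nonzero: "\<And>k. k < K \<Longrightarrow> snorm (n k) \<ge> 1"
    and gap: "\<And>k. Suc k < K \<Longrightarrow> 4 * 2 ^ K * snorm (n k) \<le> snorm (n (Suc k))"
    and omega: "\<And>l. \<bar>\<omega> l\<bar> \<le> 1"
    and direction: "\<And>k l. k < K \<Longrightarrow> \<bar>of_int (n k $ l) / of_int (n k $ j) - \<omega> l\<bar> \<le> 1 / K"
begin

lemma gap4: "Suc k < K \<Longrightarrow> 4 * snorm (n k) \<le> snorm (n (Suc k))"
  using gap[of k] by (metis le_trans mult.assoc mult_le_mono1 mult.commute mult_le_mono2 nat_mult_1_right one_le_numeral one_le_power)

lemma gap_less: "i < k \<Longrightarrow> k < K \<Longrightarrow> 4 * snorm (n i) \<le> snorm (n k)"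
proof (induction k)
  case (Suc k)
  show ?case
  proof (cases "i = k")
    case False
    then have "4 * snorm (n i) \<le> snorm (n k)" using Suc by simp
    also have "\<dots> \<le> snorm (n (Suc k))" using gap4[of k] Suc.prems by simp
    finally show ?thesis .
  qed (use gap4 Suc.prems in auto)
qed simp

text \<open>Step k shifts frequencies by at most |n_k|, so those of the next product stay below 3/2
  |n_k|, whereas |n_(k+1)| \<ge> 4 |n_k|. The resulting factor 2 keeps n_k, and later n_k
  \<plusminus> n_i, out of the spectra concerned.\<close>

lemma spectrum: "k < K \<Longrightarrow> coef (riesz n k) m \<noteq> 0 \<Longrightarrow> 2 * snorm m < snorm (n k)"
proof (induction k arbitrary: m)
  case 0
  have "coef (riesz n 0) m = coef (chi 0) m" by (simp add: coef_def)
  then have "m = 0" using 0(2) by (auto simp: coef_chi split: if_splits)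
  then show ?case using nonzero[of 0] 0 by simp
next
  case (Suc k)
  have "coef (riesz n (Suc k)) m = coef (riesz n k) m + (1/2) * coef (riesz n k) (m - n k) + (1/2) * coef (riesz n k) (m + n k)"
    by (simp add: coef_mult_cosf)
  with Suc.prems(2) consider "coef (riesz n k) m \<noteq> 0" | "coef (riesz n k) (m - n k) \<noteq> 0" | "coef (riesz n k) (m + n k) \<noteq> 0"
    by force
  then have "2 * snorm m < 3 * snorm (n k)"
  proof cases
    case 1
    then show ?thesis using Suc.IH[of m] Suc.prems by simp
  next
    case 2
    then show ?thesis using Suc.IH[of "m - n k"] Suc.prems snorm_add_le[of "m - n k" "n k"] by simp
  next
    case 3
    then show ?thesis using Suc.IH[of "m + n k"] Suc.prems snorm_diff_le[of "m + n k" "n k"] by simp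
  qed
  then show ?case using gap4[OF Suc.prems(1)] by simp
qed

text \<open>The frequencies n_k and -n_k are too large to occur in the k-th product, so a new factor
  leaves the mean unchanged. With positivity, the L1 norm stays 1.\<close>

lemma mean: "k \<le> K \<Longrightarrow> coef (riesz n k) 0 = 1"
proof (induction k)
  case 0
  have "coef (riesz n 0) 0 = coef (chi (0 :: int ^ 'd)) 0" by (simp add: coef_def)
  then show ?case by (simp add: coef_chi)
next
  case (Suc k)
  have "coef (riesz n k) (- n k) = 0" "coef (riesz n k) (n k) = 0"
    using spectrum[of k "- n k"] spectrum[of k "n k"] Suc.prems by auto
  then show ?case using Suc by (simp add: coef_mult_cosf)
qed

lemma l1_riesz_eq: "k \<le> K \<Longrightarrow> l1 (riesz n k) = 1"
  using l1_riesz[of n k] mean[of k] by simp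

lemma tpoly_mult_integrable:
  "tpoly f F \<Longrightarrow> tpoly g G \<Longrightarrow> integrable torus_measure (\<lambda>x. f x * g x)"
  using tpoly_mult tpoly_integrable by blast

lemma real_abs_le_snorm: "\<bar>real_of_int (m $ l)\<bar> \<le> snorm m"
proof -
  have "real_of_int \<bar>m $ l\<bar> \<le> real_of_int (int (snorm m))" by (simp only: of_int_le_iff abs_le_snorm)
  then show ?thesis by simp
qed

text \<open>A new factor contributes at most 2 pi |n_k| to the gradient and at most doubles the old
  one, which gives at most 8 pi |n_k|. The gap 4 * 2^K turns this into a 2^-K fraction of 2 pi
  |n_(k+1)|.\<close>

lemma l1_driesz: "k < K \<Longrightarrow> l1 (driesz n k l) \<le> 2 * pi * snorm (n k) / 2 ^ K"
proof (induction k)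
  case 0
  show ?case by (simp add: l1_def)
next
  case (Suc k)
  have i: "integrable torus_measure (\<lambda>x. riesz n k x * sinf (n k) x)"
    by (rule tpoly_mult_integrable[OF tpoly_riesz tpoly_sinf])
  have i2: "integrable torus_measure (\<lambda>x. driesz n k l x * (1 + cosf (n k) x))"
    using L2_mult_integrable'(1)[OF tpoly_L2(2)[OF tpoly_riesz] tpoly_L2(1)[OF tpoly_add[OF tpoly_const[of 1] tpoly_cosf[of "n k"]]]] .
  have "l1 (driesz n (Suc k) l) = l1 (\<lambda>x. - (2 * pi * of_int (n k $ l)) * (riesz n k x * sinf (n k) x)
      + driesz n k l x * (1 + cosf (n k) x))"
    by (simp add: mult_ac)
  also have "\<dots> \<le> l1 (\<lambda>x. - (2 * pi * of_int (n k $ l)) * (riesz n k x * sinf (n k) x))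
      + l1 (\<lambda>x. driesz n k l x * (1 + cosf (n k) x))"
    using i i2 by (intro l1_triangle) auto
  also have "\<dots> \<le> 2 * pi * snorm (n k) * 1 + 2 * l1 (driesz n k l)"
  proof (rule add_mono)
    have "l1 (\<lambda>x. - (2 * pi * of_int (n k $ l)) * (riesz n k x * sinf (n k) x))
        = 2 * pi * \<bar>real_of_int (n k $ l)\<bar> * l1 (\<lambda>x. riesz n k x * sinf (n k) x)"
      by (subst l1_cmult) (simp add: norm_mult)
    also have "\<dots> \<le> 2 * pi * snorm (n k) * 1"
      using l1_mult_bounded[OF riesz_integrable(1) i, of 1] l1_riesz_eq[of k] Suc.prems
      by (intro mult_mono real_abs_le_snorm) (auto simp: norm_sinf_le)
    finally show "l1 (\<lambda>x. - (2 * pi * of_int (n k $ l)) * (riesz n k x * sinf (n k) x)) \<le> 2 * pi * snorm (n k) * 1" .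
    have "norm (1 + cosf (n k) x) \<le> 2" for x
      using norm_triangle_ineq[of 1 "cosf (n k) x"] norm_cosf_le[of "n k" x] by simp
    then show "l1 (\<lambda>x. driesz n k l x * (1 + cosf (n k) x)) \<le> 2 * l1 (driesz n k l)"
      by (intro l1_mult_bounded i2) auto
  qed
  also have "\<dots> \<le> 2 * pi * snorm (n k) + 2 * (2 * pi * snorm (n k) / 2 ^ K)"
    using Suc by simp
  also have "\<dots> \<le> 2 * pi * snorm (n k) + 2 * (2 * pi * snorm (n k))"
  proof -
    have "2 * pi * snorm (n k) / 2 ^ K \<le> 2 * pi * snorm (n k) / 1"
      by (intro divide_left_mono) auto
    then show ?thesis by simp
  qed
  also have "\<dots> \<le> 2 * pi * (4 * real (snorm (n k)))" by (simp add: algebra_simps)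
  also have "\<dots> \<le> 2 * pi * (snorm (n (Suc k)) / 2 ^ K)"
  proof (rule mult_left_mono)
    have "real (4 * 2 ^ K * snorm (n k)) \<le> real (snorm (n (Suc k)))"
      using gap[OF Suc.prems] by (simp only: of_nat_le_iff)
    then show "4 * real (snorm (n k)) \<le> snorm (n (Suc k)) / 2 ^ K" by (simp add: field_simps)
  qed simp
  finally show ?case by simp
qed

lemma snorm_ge: "k < K \<Longrightarrow> 2 ^ k \<le> snorm (n k)"
proof (induction k)
  case 0
  then show ?case using nonzero by simp
next
  case (Suc k)
  then show ?case using gap4[of k] by simp
qed

text \<open>An approximate primitive: differentiating only the sine in each term gives the vector
  n_k / n_k$j, close to \<omega>, times an increment of the Riesz product. Dividing by the signed
  dominant coordinate treats n and -n as the same direction.\<close>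

definition f :: "'d tfun" where
  "f x = (\<Sum>k<K. (1 / of_int (n k $ j)) * (riesz n k x * sinf (n k) x))"

definition F :: "'d \<Rightarrow> 'd tfun" where
  "F l x = (\<Sum>k<K. (1 / of_int (n k $ j)) *
     (riesz n k x * (2 * pi * of_int (n k $ l) * cosf (n k) x) + driesz n k l x * sinf (n k) x))"

lemma tpoly_f: "tpoly f F"
  unfolding f_def[abs_def] F_def[abs_def]
  by (intro tpoly_sum tpoly_cmult tpoly_mult tpoly_riesz tpoly_sinf)

lemma norm_inverse_nj: "k < K \<Longrightarrow> norm (1 / complex_of_int (n k $ j)) = 1 / snorm (n k)"
proof -
  assume "k < K"
  then have "\<bar>real_of_int (n k $ j)\<bar> = snorm (n k)" using dominant[of k] by (metis of_int_abs of_int_of_nat_eq)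
  then show ?thesis by (simp add: norm_divide)
qed

lemma int_rs: "integrable torus_measure (\<lambda>x. riesz n k x * sinf (n k) x)"
  and int_rc: "integrable torus_measure (\<lambda>x. riesz n k x * cosf (n k) x)"
  and int_ds: "integrable torus_measure (\<lambda>x. driesz n k l x * sinf (n k) x)"
  using tpoly_mult_integrable[OF tpoly_riesz tpoly_sinf] tpoly_mult_integrable[OF tpoly_riesz tpoly_cosf]
    L2_mult_integrable'(1)[OF tpoly_L2(2)[OF tpoly_riesz] tpoly_L2(1)[OF tpoly_sinf]] by blast+

lemma l1_rs: "k < K \<Longrightarrow> l1 (\<lambda>x. riesz n k x * sinf (n k) x) \<le> 1"
  and l1_rc: "k < K \<Longrightarrow> l1 (\<lambda>x. riesz n k x * cosf (n k) x) \<le> 1"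
  using l1_mult_bounded[OF riesz_integrable(1) int_rs norm_sinf_le, of k]
    l1_mult_bounded[OF riesz_integrable(1) int_rc norm_cosf_le, of k] l1_riesz_eq[of k] by auto

lemma l1_f: "l1 f \<le> 2"
proof -
  have "l1 f \<le> (\<Sum>k<K. l1 (\<lambda>x. (1 / of_int (n k $ j)) * (riesz n k x * sinf (n k) x)))"
    unfolding f_def[abs_def] by (intro l1_sum_le integrable_mult_right int_rs) auto
  also have "\<dots> \<le> (\<Sum>k<K. (1/2) ^ k)"
  proof (rule sum_mono)
    fix k assume k: "k \<in> {..<K}"
    have "real (2 ^ k) \<le> real (snorm (n k))" using snorm_ge[of k] k by (simp only: of_nat_le_iff) simp
    then have "1 / real (snorm (n k)) \<le> 1 / 2 ^ k" using nonzero[of k] k by (intro divide_left_mono) auto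
    moreover have "1 / snorm (n k) * l1 (\<lambda>x. riesz n k x * sinf (n k) x) \<le> 1 / snorm (n k) * 1"
      using l1_rs k by (intro mult_left_mono) auto
    moreover have "l1 (\<lambda>x. (1 / of_int (n k $ j)) * (riesz n k x * sinf (n k) x))
        = 1 / snorm (n k) * l1 (\<lambda>x. riesz n k x * sinf (n k) x)"
      using k by (subst l1_cmult, subst norm_inverse_nj) auto
    ultimately show "l1 (\<lambda>x. (1 / of_int (n k $ j)) * (riesz n k x * sinf (n k) x)) \<le> (1/2) ^ k"
      by (simp add: power_one_over)
  qed
  also have "\<dots> = 2 - 2 * (1/2) ^ K" by (subst sum_gp_strict) (simp add: field_simps)
  also have "\<dots> \<le> 2" by simp
  finally show ?thesis .
qed

text \<open>The gradient in three parts: the telescoped main term along \<omega>, the deviation of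
  the directions from \<omega>, and the derivatives that fall on the Riesz products.\<close>

lemma F_eq: "F l x = 2 * pi * (\<omega> l * (riesz n K x - 1)
    + (\<Sum>k<K. of_real (of_int (n k $ l) / of_int (n k $ j) - \<omega> l) * (riesz n k x * cosf (n k) x)))
    + (\<Sum>k<K. (1 / of_int (n k $ j)) * (driesz n k l x * sinf (n k) x))"
proof -
  have "F l x = (\<Sum>k<K. 2 * pi * (\<omega> l * (riesz n k x * cosf (n k) x)
    + of_real (of_int (n k $ l) / of_int (n k $ j) - \<omega> l) * (riesz n k x * cosf (n k) x))
    + (1 / of_int (n k $ j)) * (driesz n k l x * sinf (n k) x))"
    unfolding F_def by (intro sum.cong) (auto simp: algebra_simps add_divide_distrib)
  then show ?thesis
    by (simp only: sum.distrib sum_distrib_left[symmetric] sum_riesz_cosf)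
qed

text \<open>8 pi = 2 pi (2 + 1) + 2 pi. The main term has norm at most 2, the K direction errors of
  size 1/K sum to 1, and the K terms 2 pi / 2^K sum to at most 2 pi.\<close>

lemma l1_F: "l1 (F l) \<le> 8 * pi"
proof -
  define G1 where "G1 x = riesz n K x + (- 1)" for x
  define G2 where "G2 x = (\<Sum>k<K. of_real (of_int (n k $ l) / of_int (n k $ j) - \<omega> l) * (riesz n k x * cosf (n k) x))" for x
  define G3 where "G3 x = (\<Sum>k<K. (1 / of_int (n k $ j)) * (driesz n k l x * sinf (n k) x))" for x
  have i1: "integrable torus_measure G1" unfolding G1_def[abs_def] by simp
  have i2: "integrable torus_measure G2" unfolding G2_def[abs_def]
    by (intro Bochner_Integration.integrable_sum integrable_mult_right int_rc)
  have i3: "integrable torus_measure G3" unfolding G3_def[abs_def]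
    by (intro Bochner_Integration.integrable_sum integrable_mult_right int_ds)
  have "l1 G1 \<le> l1 (riesz n K) + l1 (\<lambda>x :: real ^ 'd. - 1)"
    unfolding G1_def[abs_def] by (intro l1_triangle) auto
  then have g1: "l1 G1 \<le> 2" by (simp add: l1_riesz_eq) (simp add: l1_def)
  have "l1 G2 \<le> (\<Sum>k<K. l1 (\<lambda>x. of_real (of_int (n k $ l) / of_int (n k $ j) - \<omega> l) * (riesz n k x * cosf (n k) x)))"
    unfolding G2_def[abs_def] by (intro l1_sum_le integrable_mult_right int_rc) auto
  also have "\<dots> \<le> (\<Sum>k<K. 1 / real K * 1)"
  proof (rule sum_mono)
    fix k assume "k \<in> {..<K}"
    then show "l1 (\<lambda>x. of_real (of_int (n k $ l) / of_int (n k $ j) - \<omega> l) * (riesz n k x * cosf (n k) x)) \<le> 1 / real K * 1"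
      unfolding l1_cmult norm_of_real by (intro mult_mono direction l1_rc) auto
  qed
  also have "\<dots> = 1" using K by simp
  finally have g2: "l1 G2 \<le> 1" .
  have "l1 G3 \<le> (\<Sum>k<K. l1 (\<lambda>x. (1 / of_int (n k $ j)) * (driesz n k l x * sinf (n k) x)))"
    unfolding G3_def[abs_def] by (intro l1_sum_le integrable_mult_right int_ds) auto
  also have "\<dots> \<le> (\<Sum>k<K. 2 * pi / 2 ^ K)"
  proof (rule sum_mono)
    fix k assume k: "k \<in> {..<K}"
    have "l1 (\<lambda>x. driesz n k l x * sinf (n k) x) \<le> 1 * l1 (driesz n k l)"
      by (intro l1_mult_bounded int_ds norm_sinf_le) simp
    also have "\<dots> \<le> 2 * pi * snorm (n k) / 2 ^ K" using l1_driesz[of k l] k by simp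
    finally have "1 / snorm (n k) * l1 (\<lambda>x. driesz n k l x * sinf (n k) x) \<le> 1 / snorm (n k) * (2 * pi * snorm (n k) / 2 ^ K)"
      by (intro mult_left_mono) auto
    also have "\<dots> = 2 * pi / 2 ^ K"
    proof -
      have "n k \<noteq> 0" using nonzero[of k] k by (metis lessThan_iff not_one_le_zero snorm_zero)
      then show ?thesis by simp
    qed
    finally show "l1 (\<lambda>x. (1 / of_int (n k $ j)) * (driesz n k l x * sinf (n k) x)) \<le> 2 * pi / 2 ^ K"
      using k by (subst l1_cmult, subst norm_inverse_nj) auto
  qed
  also have "\<dots> = 2 * pi * (K / 2 ^ K)" by simp
  also have "\<dots> \<le> 2 * pi * 1"
  proof (rule mult_left_mono)
    have "real K \<le> 2 ^ K" using less_exp[of K] by (metis less_imp_le of_nat_le_iff of_nat_numeral of_nat_power)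
    then show "K / 2 ^ K \<le> (1 :: real)" by simp
  qed simp
  finally have g3: "l1 G3 \<le> 2 * pi" by simp
  have "F l = (\<lambda>x. 2 * pi * (\<omega> l * G1 x + G2 x) + G3 x)"
    by (simp add: fun_eq_iff F_eq G1_def G2_def G3_def)
  then have "l1 (F l) \<le> l1 (\<lambda>x. 2 * pi * (\<omega> l * G1 x + G2 x)) + l1 G3"
    using i1 i2 i3 by (auto intro!: l1_triangle integrable_mult_right Bochner_Integration.integrable_add)
  also have "l1 (\<lambda>x. 2 * pi * (\<omega> l * G1 x + G2 x)) = 2 * pi * l1 (\<lambda>x. \<omega> l * G1 x + G2 x)"
    by (subst l1_cmult) (simp add: norm_mult)
  also have "\<dots> \<le> 2 * pi * 3"
  proof (rule mult_left_mono)
    have "l1 (\<lambda>x. \<omega> l * G1 x + G2 x) \<le> l1 (\<lambda>x. \<omega> l * G1 x) + l1 G2"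
      using i1 i2 by (intro l1_triangle integrable_mult_right)
    also have "l1 (\<lambda>x. \<omega> l * G1 x) = \<bar>\<omega> l\<bar> * l1 G1" by (simp add: l1_cmult)
    also have "\<dots> \<le> 1 * 2" by (intro mult_mono omega g1) auto
    finally show "l1 (\<lambda>x. \<omega> l * G1 x + G2 x) \<le> 3" using g2 by simp
  qed simp
  finally show ?thesis using g3 by simp
qed

text \<open>A sine shifts the spectrum of its Riesz product by n_i and -n_i; among all terms only i
  = k reaches n_k, and it does so through the mean 1.\<close>

lemma coef_f:
  assumes k: "k < K"
  shows "norm (coef f (n k)) = 1 / (2 * snorm (n k))"
proof -
  have "coef f (n k) = (\<Sum>i<K. (1 / of_int (n i $ j)) * coef (\<lambda>x. riesz n i x * sinf (n i) x) (n k))"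
    unfolding f_def[abs_def] by (subst coef_sum) (auto intro!: integrable_mult_right int_rs simp only: coef_cmult)
  also have "\<dots> = (\<Sum>i<K. if i = k then (1 / of_int (n k $ j)) * (- \<i> / 2) else 0)"
  proof (rule sum.cong)
    fix i assume i: "i \<in> {..<K}"
    show "(1 / of_int (n i $ j)) * coef (\<lambda>x. riesz n i x * sinf (n i) x) (n k)
        = (if i = k then (1 / of_int (n k $ j)) * (- \<i> / 2) else 0)"
    proof (cases "i = k")
      case True
      \<comment> \<open>The other half of the sine would need the frequency 2 n_k, whose dominant
        coordinate lies outside the spectrum.\<close>
      have "coef (riesz n k) (n k + n k) = 0"
        using spectrum[of k "n k + n k"] k abs_le_snorm[of "n k + n k" j] dominant[of k] by force
      then show ?thesis using True mean[of k] k by (simp add: coef_mult_sinf)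
    next
      case False
      \<comment> \<open>The larger of the two frequencies dominates: n_k \<plusminus> n_i has norm
        at least 3 |n_i| if i < k and at least 3/4 |n_i| if k < i, in both cases more than the
        spectrum of the i-th product allows.\<close>
      have "snorm (n i) \<le> 2 * snorm (n k + n i) \<and> snorm (n i) \<le> 2 * snorm (n k - n i)"
      proof (cases "i < k")
        case True
        then show ?thesis
          using gap_less[of i k] k snorm_diff_le[of "n k + n i" "n i"] snorm_add_le[of "n k - n i" "n i"] by simp
      next
        case False
        then have "k < i" using \<open>i \<noteq> k\<close> by simp
        then show ?thesis
          using gap_less[of k i] i snorm_diff_le[of "n k + n i" "n k"] snorm_diff_le[of "n k" "n k - n i"] by simp
      qed
      then have "coef (riesz n i) (n k + n i) = 0" "coef (riesz n i) (n k - n i) = 0"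
        using spectrum[of i "n k + n i"] spectrum[of i "n k - n i"] i by fastforce+
      then show ?thesis using False by (simp add: coef_mult_sinf)
    qed
  qed simp
  also have "\<dots> = (1 / of_int (n k $ j)) * (- \<i> / 2)" using k by simp
  finally show ?thesis by (simp only: norm_mult norm_inverse_nj[OF k]) simp
qed

text \<open>Tested on \<open>f\<close>, the growth of b at n_k cancels the factor 1 / (2 |n_k|) of
  its coefficient, so each of the K frequencies contributes (\<eta>/2)^2 while the Sobolev norm does
  not depend on K.\<close>

lemma length_bound:
  fixes \<eta> :: real
  assumes b: "sobolev_multiplier b C" and \<eta>: "\<eta> > 0" "\<And>k. k < K \<Longrightarrow> \<eta> * snorm (n k) \<le> norm (b (n k))"
  shows "K * \<eta>\<^sup>2 \<le> 4 * (C * (2 + 8 * pi * CARD('d)))\<^sup>2"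
proof -
  have inj: "inj_on n {..<K}"
  proof (rule linorder_inj_onI')
    fix i k assume "i \<in> {..<K}" "k \<in> {..<K}" "i < k"
    then show "n i \<noteq> n k" using gap_less[of i k] nonzero[of i] by auto
  qed
  have "K * (\<eta> / 2)\<^sup>2 = (\<Sum>k<K. (\<eta> / 2)\<^sup>2)" by simp
  also have "\<dots> \<le> (\<Sum>k<K. (norm (b (n k)) * norm (coef f (n k)))\<^sup>2)"
  proof (intro sum_mono power_mono)
    fix k assume k: "k \<in> {..<K}"
    have s: "real (snorm (n k)) > 0" using nonzero[of k] k by simp
    have "n k \<noteq> 0"
    proof
      assume "n k = 0"
      with s show False by simp
    qed
    then have "\<eta> / 2 = \<eta> * snorm (n k) * (1 / (2 * snorm (n k)))" by simp
    also have "\<dots> \<le> norm (b (n k)) * (1 / (2 * snorm (n k)))"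
      using \<eta>(2)[of k] k by (intro mult_right_mono) auto
    finally show "\<eta> / 2 \<le> norm (b (n k)) * norm (coef f (n k))" using coef_f[of k] k by simp
  qed (use \<eta> in auto)
  also have "\<dots> = (\<Sum>m\<in>n ` {..<K}. (norm (b m) * norm (coef f m))\<^sup>2)"
    by (subst sum.reindex[OF inj]) simp
  also have "\<dots> \<le> (C * (l1 f + (\<Sum>l\<in>UNIV. l1 (F l))))\<^sup>2"
    using b tpoly_f unfolding sobolev_multiplier_def by blast
  also have "\<dots> = C\<^sup>2 * (l1 f + (\<Sum>l\<in>UNIV. l1 (F l)))\<^sup>2" by (simp add: power_mult_distrib)
  also have "\<dots> \<le> C\<^sup>2 * (2 + 8 * pi * CARD('d))\<^sup>2"
  proof (intro mult_left_mono power_mono)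
    have "(\<Sum>l\<in>UNIV. l1 (F l)) \<le> (\<Sum>l\<in>(UNIV :: 'd set). 8 * pi)" by (intro sum_mono l1_F)
    then show "l1 f + (\<Sum>l\<in>UNIV. l1 (F l)) \<le> 2 + 8 * pi * CARD('d)" using l1_f by (simp add: mult.commute)
  qed (auto intro!: add_nonneg_nonneg sum_nonneg)
  finally show ?thesis by (simp add: power_divide power_mult_distrib)
qed

end

section \<open>Counting large multipliers\<close>

text \<open>In a class of equal \<open>color\<close> at most K shells are occupied: otherwise one
  frequency from each of K shells would form a \<open>lacunary\<close> family, and
  \<open>length_bound\<close> would contradict the choice of K. The total is the number of classes
  times K times the bound for one shell.\<close>

lemma counting:
  fixes b :: "int ^ 'd::finite \<Rightarrow> complex"
  assumes b: "sobolev_multiplier b C"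
  obtains C3 where "C3 \<ge> 0"
    "\<And>(\<eta> :: real) S. 0 < \<eta> \<Longrightarrow> \<eta> \<le> 1 \<Longrightarrow> finite S \<Longrightarrow> (\<And>n. n \<in> S \<Longrightarrow> n \<noteq> 0 \<and> \<eta> * snorm n \<le> norm (b n)) \<Longrightarrow>
       card S \<le> C3 * (1 / \<eta>) ^ (2 * CARD('d) + 4)"
proof -
  obtain C1 where C1: "C1 \<ge> 0"
    "\<And>L S. L \<ge> 1 \<Longrightarrow> finite S \<Longrightarrow> S \<subseteq> cube_set (2 * L) \<Longrightarrow> (\<Sum>n\<in>S. (norm (b n))\<^sup>2) \<le> C1 * (real L)\<^sup>2"
    using shell_sum[OF b] by metis
  define C2 where "C2 = 4 * (C * (2 + 8 * pi * CARD('d)))\<^sup>2"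
  \<comment> \<open>Chosen so that K \<le> \<kappa> / \<eta>^2: rounding adds at most 1, which is
    absorbed since \<eta> \<le> 1.\<close>
  define \<kappa> where "\<kappa> = C2 + 2"
  define C3 where "C3 = CARD('d) * (3 ^ (CARD('d) - 1) * \<kappa> ^ (CARD('d) - 1) * (4 * \<kappa>)) * (\<kappa> * C1)"
  have C2: "C2 \<ge> 0" by (simp add: C2_def)
  have "\<exists>s. 2 ^ s \<le> snorm n \<and> snorm n < 2 ^ (s + 1)" if "n \<noteq> 0" for n :: "int ^ 'd"
  proof -
    have "1 \<le> snorm n" using that by (metis less_one not_le snorm_eq_0_iff)
    then show ?thesis using ex_power_ivl1[of 2 "snorm n"] by auto
  qed
  then obtain sh where sh: "\<And>n :: int ^ 'd. n \<noteq> 0 \<Longrightarrow> 2 ^ sh n \<le> snorm n \<and> snorm n < 2 ^ (sh n + 1)"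
    by metis
  obtain dom where dom: "\<And>n :: int ^ 'd. \<bar>n $ dom n\<bar> = int (snorm n)" using snorm_attained by metis
  have "card S \<le> C3 * (1 / \<eta>) ^ (2 * CARD('d) + 4)"
    if \<eta>: "0 < \<eta>" "\<eta> \<le> 1" and S: "finite S" "\<And>n. n \<in> S \<Longrightarrow> n \<noteq> 0 \<and> \<eta> * snorm n \<le> norm (b n)" for \<eta> :: real and S
  proof -
    \<comment> \<open>The smallest integer above C2 / \<eta>^2, hence a length that
      \<open>length_bound\<close> excludes.\<close>
    define K where "K = nat \<lfloor>C2 / \<eta>\<^sup>2\<rfloor> + 1"
    have K1: "K \<ge> 1" by (simp add: K_def)
    have "0 \<le> C2 / \<eta>\<^sup>2" using C2 by simp
    then have K2: "C2 / \<eta>\<^sup>2 < K" unfolding K_def by linarith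
    have K3: "real K \<le> \<kappa> * (1 / \<eta>)\<^sup>2"
    proof -
      have "real K \<le> C2 / \<eta>\<^sup>2 + 1" unfolding K_def using \<open>0 \<le> C2 / \<eta>\<^sup>2\<close> by linarith
      also have "\<dots> \<le> C2 / \<eta>\<^sup>2 + 2 * (1 / \<eta>)\<^sup>2"
      proof -
        have "1 \<le> (1 / \<eta>)\<^sup>2" using \<eta> by (intro one_le_power) simp
        then show ?thesis by simp
      qed
      finally show ?thesis by (simp add: \<kappa>_def algebra_simps power_divide add_divide_distrib)
    qed
    \<comment> \<open>Each member of shell s has |b n| \<ge> \<eta> 2^s, while the squares sum to at
      most C1 4^s; the scale cancels.\<close>
    have shell: "card {n\<in>S. sh n = s} \<le> C1 * (1 / \<eta>)\<^sup>2" for s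
    proof -
      have "card {n\<in>S. sh n = s} * (\<eta> * 2 ^ s)\<^sup>2 = (\<Sum>n\<in>{n\<in>S. sh n = s}. (\<eta> * 2 ^ s)\<^sup>2)" by simp
      also have "\<dots> \<le> (\<Sum>n\<in>{n\<in>S. sh n = s}. (norm (b n))\<^sup>2)"
      proof (intro sum_mono power_mono)
        fix n assume n: "n \<in> {n\<in>S. sh n = s}"
        then have "2 ^ s \<le> snorm n" using S sh by blast
        then have "(2 :: real) ^ s \<le> snorm n" by (metis of_nat_le_iff of_nat_numeral of_nat_power)
        then have "\<eta> * 2 ^ s \<le> \<eta> * snorm n" using \<eta> by (intro mult_left_mono) auto
        also have "\<dots> \<le> norm (b n)" using S n by blast
        finally show "\<eta> * 2 ^ s \<le> norm (b n)" .
      qed (use \<eta> in auto)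
      also have "\<dots> \<le> C1 * (real (2 ^ s))\<^sup>2"
      proof (rule C1(2))
        show "{n\<in>S. sh n = s} \<subseteq> cube_set (2 * 2 ^ s)"
          using S(2) sh by (fastforce simp: cube_set_def)
      qed (use S in auto)
      finally have "card {n\<in>S. sh n = s} * \<eta>\<^sup>2 * (2 ^ s)\<^sup>2 \<le> C1 * (2 ^ s)\<^sup>2"
        by (simp add: power_mult_distrib mult.assoc)
      then have "card {n\<in>S. sh n = s} * \<eta>\<^sup>2 \<le> C1" by (rule mult_right_le_imp_le) simp
      then show ?thesis using \<eta> by (simp add: field_simps)
    qed
    \<comment> \<open>Directions rounded to multiples of 1/K. At the dominant coordinate the
      quotient is 1 and rounds to K for nonzero n; prescribing this value for every n leaves only d
      - 1 free entries in the count of classes.\<close>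
    define g where "g n = (\<lambda>i. if i = dom n then int K else \<lfloor>real K * (of_int (n $ i) / of_int (n $ dom n))\<rfloor>)" for n
    \<comment> \<open>Distinct shells of one class differ by at least K + 3. As |n| < 2^(s+1) in
      shell s, the next norm is at least 2^(s+K+3) = 2^(s+1) * 4 * 2^K, exactly the gap of
      \<open>lacunary\<close>.\<close>
    define color where "color n = (dom n, g n, sh n mod (K + 3))" for n
    define \<Gamma> where "\<Gamma> = Sigma UNIV (\<lambda>j :: 'd. Pi\<^sub>E UNIV (\<lambda>i. if i = j then {int K} else {- int K..int K}) \<times> {..<K + 3})"
    have fin\<Gamma>: "finite \<Gamma>" unfolding \<Gamma>_def by (intro finite_SigmaI finite_PiE finite_cartesian_product) auto
    have ratio: "\<bar>of_int (n $ i) / of_int (n $ dom n)\<bar> \<le> (1 :: real)" for n i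
    proof -
      have "\<bar>n $ i\<bar> \<le> \<bar>n $ dom n\<bar>" using abs_le_snorm[of n i] dom[of n] by simp
      then have "\<bar>real_of_int (n $ i)\<bar> \<le> \<bar>real_of_int (n $ dom n)\<bar>" by linarith
      then show ?thesis by (cases "n $ dom n = 0") (auto simp: abs_divide divide_le_eq)
    qed
    have color: "color n \<in> \<Gamma>" for n
    proof -
      have "\<lfloor>real K * (of_int (n $ i) / of_int (n $ dom n))\<rfloor> \<in> {- int K..int K}" for i
      proof -
        have "\<bar>real K * (of_int (n $ i) / of_int (n $ dom n))\<bar> \<le> real K * 1"
          unfolding abs_mult using ratio by (intro mult_mono) auto
        moreover have "\<lfloor>t\<rfloor> \<in> {- int K..int K}" if "\<bar>t\<bar> \<le> real K * 1" for t
          using that by (auto simp: le_floor_iff floor_le_iff)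
        ultimately show ?thesis by blast
      qed
      then show ?thesis by (auto simp: color_def \<Gamma>_def g_def PiE_iff)
    qed
    have card\<Gamma>: "card \<Gamma> = CARD('d) * ((2 * K + 1) ^ (CARD('d) - 1) * (K + 3))"
    proof -
      have "card (Pi\<^sub>E UNIV (\<lambda>i. if i = j then {int K} else {- int K..int K})) = (2 * K + 1) ^ (CARD('d) - 1)" for j :: 'd
      proof -
        have "card (Pi\<^sub>E UNIV (\<lambda>i. if i = j then {int K} else {- int K..int K}))
            = (\<Prod>i\<in>UNIV. if i = j then 1 else 2 * K + 1)"
          by (subst card_PiE) (auto intro!: prod.cong simp: nat_add_distrib nat_mult_distrib)
        also have "\<dots> = (\<Prod>i\<in>UNIV - {j}. 2 * K + 1)"
          by (subst prod.remove[of _ j]) (auto intro!: prod.cong)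
        finally show ?thesis by simp
      qed
      then show ?thesis unfolding \<Gamma>_def by (subst card_SigmaI) (auto simp: card_cartesian_product finite_PiE)
    qed
    have cls: "card {n\<in>S. color n = c} \<le> K * (C1 * (1 / \<eta>)\<^sup>2)" for c
    proof -
      define Q where "Q = {n\<in>S. color n = c}"
      have finQ: "finite Q" using S by (simp add: Q_def)
      have few: "card (sh ` Q) \<le> K"
      proof (rule ccontr)
        assume "\<not> card (sh ` Q) \<le> K"
        then have cardQ: "K \<le> card (sh ` Q)" by simp
        \<comment> \<open>Sorting the occupied shells orders the chosen representatives by
          size.\<close>
        define xs where "xs = sorted_list_of_set (sh ` Q)"
        have xs: "set xs = sh ` Q" "length xs = card (sh ` Q)" "sorted_wrt (<) xs"
          using finQ by (auto simp: xs_def strict_sorted_list_of_set)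
        have "\<exists>n\<in>Q. sh n = xs ! k" if "k < K" for k
        proof -
          have "xs ! k \<in> set xs" using that cardQ xs(2) by (intro nth_mem) simp
          then show ?thesis using xs(1) by auto
        qed
        then obtain n where n: "\<And>k. k < K \<Longrightarrow> n k \<in> Q" "\<And>k. k < K \<Longrightarrow> sh (n k) = xs ! k" by metis
        have nS: "n k \<in> S" "n k \<noteq> 0" if "k < K" for k using n(1)[OF that] S(2) by (auto simp: Q_def)
        have same: "dom (n k) = dom (n 0)" "g (n k) = g (n 0)" "sh (n k) mod (K + 3) = sh (n 0) mod (K + 3)" if "k < K" for k
        proof -
          have "color (n k) = color (n 0)" using n(1)[OF that] n(1)[of 0] K1 by (simp add: Q_def)
          then show "dom (n k) = dom (n 0)" "g (n k) = g (n 0)" "sh (n k) mod (K + 3) = sh (n 0) mod (K + 3)"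
            by (simp_all add: color_def)
        qed
        define j where "j = dom (n 0)"
        \<comment> \<open>The direction of the first member serves as reference: equal floors mean
          quotients at distance at most 1/K.\<close>
        define \<omega> where "\<omega> l = real_of_int (n 0 $ l) / of_int (n 0 $ j)" for l
        interpret lacunary n K j \<omega>
        proof
          show "K \<ge> 1" by (rule K1)
          show "\<bar>n k $ j\<bar> = int (snorm (n k))" if "k < K" for k
            using dom[of "n k"] same(1)[OF that] by (simp add: j_def)
          show "snorm (n k) \<ge> 1" if "k < K" for k
            using nS(2)[OF that] by (metis less_one not_le snorm_eq_0_iff)
          show "\<bar>\<omega> l\<bar> \<le> 1" for l unfolding \<omega>_def j_def by (rule ratio)
          show "4 * 2 ^ K * snorm (n k) \<le> snorm (n (Suc k))" if k: "Suc k < K" for k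
          proof -
            have "sh (n k) < sh (n (Suc k))"
              using n(2)[of k] n(2)[OF k] k sorted_wrt_nth_less[OF xs(3), of k "Suc k"] xs(2) cardQ by simp
            moreover have "sh (n (Suc k)) mod (K + 3) = sh (n k) mod (K + 3)"
              using same(3)[OF k] same(3)[of k] k by simp
            \<comment> \<open>Two indices with strict inequality and equal residues differ by at
              least the modulus.\<close>
            ultimately have "sh (n k) + (K + 3) \<le> sh (n (Suc k))"
              by (metis add.commute le_add_diff_inverse less_imp_le mod_eq_dvd_iff_nat nat_add_left_cancel_le nat_dvd_not_less not_le zero_less_diff)
            then have "2 ^ (sh (n k) + (K + 3)) \<le> (2 :: nat) ^ sh (n (Suc k))" by (intro power_increasing) auto
            also have "\<dots> \<le> snorm (n (Suc k))" using sh nS(2)[OF k] by blast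
            finally have 1: "2 ^ (sh (n k) + 1) * (4 * 2 ^ K) \<le> snorm (n (Suc k))" by (simp add: power_add mult_ac)
            have "snorm (n k) \<le> 2 ^ (sh (n k) + 1)" using sh[of "n k"] nS(2)[of k] k by simp
            then have "snorm (n k) * (4 * 2 ^ K) \<le> 2 ^ (sh (n k) + 1) * (4 * 2 ^ K)" by (rule mult_right_mono) simp
            from order_trans[OF this 1] show ?thesis by (simp only: mult_ac)
          qed
          show "\<bar>of_int (n k $ l) / of_int (n k $ j) - \<omega> l\<bar> \<le> 1 / K" if k: "k < K" for k l
          proof (cases "l = j")
            case True
            have "n k $ j \<noteq> 0" "n 0 $ j \<noteq> 0"
              using dom[of "n k"] dom[of "n 0"] same(1)[OF k] nS(2)[OF k] nS(2)[of 0] K1 by (auto simp: j_def)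
            then show ?thesis using True by (simp add: \<omega>_def)
          next
            case False
            have "g (n k) l = g (n 0) l" using same(2)[OF k] by simp
            then have "\<lfloor>real K * (of_int (n k $ l) / of_int (n k $ j))\<rfloor> = \<lfloor>real K * \<omega> l\<rfloor>"
              using False same(1)[OF k] by (simp add: g_def j_def \<omega>_def)
            then have "\<bar>real K * (of_int (n k $ l) / of_int (n k $ j)) - real K * \<omega> l\<bar> \<le> 1" by linarith
            then have "real K * \<bar>of_int (n k $ l) / of_int (n k $ j) - \<omega> l\<bar> \<le> 1"
              unfolding right_diff_distrib[symmetric] abs_mult by simp
            then show ?thesis using K1 by (simp add: field_simps)
          qed
        qed
        have "K * \<eta>\<^sup>2 \<le> C2"
          unfolding C2_def by (rule length_bound[OF b \<eta>(1)]) (use nS(1) S(2) in blast)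
        then have "K \<le> C2 / \<eta>\<^sup>2" using \<eta> by (simp add: field_simps)
        then show False using K2 by simp
      qed
      have "Q \<subseteq> (\<Union>s\<in>sh ` Q. {n\<in>S. sh n = s})" by (auto simp: Q_def)
      then have "card Q \<le> card (\<Union>s\<in>sh ` Q. {n\<in>S. sh n = s})"
        using S finQ by (intro card_mono) auto
      also have "\<dots> \<le> (\<Sum>s\<in>sh ` Q. card {n\<in>S. sh n = s})" using finQ by (intro card_UN_le) auto
      finally have "real (card Q) \<le> real (\<Sum>s\<in>sh ` Q. card {n\<in>S. sh n = s})"
        by (simp only: of_nat_le_iff)
      also have "\<dots> = (\<Sum>s\<in>sh ` Q. real (card {n\<in>S. sh n = s}))" by (rule of_nat_sum)
      also have "\<dots> \<le> (\<Sum>s\<in>sh ` Q. C1 * (1 / \<eta>)\<^sup>2)" by (intro sum_mono shell)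
      also have "\<dots> = card (sh ` Q) * (C1 * (1 / \<eta>)\<^sup>2)" by simp
      also have "\<dots> \<le> K * (C1 * (1 / \<eta>)\<^sup>2)" using few C1 by (intro mult_right_mono) auto
      finally show ?thesis by (simp add: Q_def)
    qed
    have "S \<subseteq> (\<Union>c\<in>\<Gamma>. {n\<in>S. color n = c})" using color by auto
    then have "card S \<le> card (\<Union>c\<in>\<Gamma>. {n\<in>S. color n = c})"
      using S fin\<Gamma> by (intro card_mono) auto
    also have "\<dots> \<le> (\<Sum>c\<in>\<Gamma>. card {n\<in>S. color n = c})" using fin\<Gamma> by (rule card_UN_le)
    finally have "real (card S) \<le> real (\<Sum>c\<in>\<Gamma>. card {n\<in>S. color n = c})"
      by (simp only: of_nat_le_iff)
    also have "\<dots> = (\<Sum>c\<in>\<Gamma>. real (card {n\<in>S. color n = c}))" by (rule of_nat_sum)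
    also have "\<dots> \<le> (\<Sum>c\<in>\<Gamma>. K * (C1 * (1 / \<eta>)\<^sup>2))" by (intro sum_mono cls)
    also have "\<dots> = CARD('d) * ((2 * real K + 1) ^ (CARD('d) - 1) * (real K + 3)) * (K * (C1 * (1 / \<eta>)\<^sup>2))"
      unfolding sum_constant card\<Gamma> by (simp add: algebra_simps)
    also have "\<dots> \<le> CARD('d) * ((3 * (\<kappa> * (1 / \<eta>)\<^sup>2)) ^ (CARD('d) - 1) * (4 * (\<kappa> * (1 / \<eta>)\<^sup>2))) * ((\<kappa> * (1 / \<eta>)\<^sup>2) * (C1 * (1 / \<eta>)\<^sup>2))"
    proof (intro mult_mono power_mono)
      have "real K \<ge> 1" using K1 by simp
      then show "2 * real K + 1 \<le> 3 * (\<kappa> * (1 / \<eta>)\<^sup>2)" "real K + 3 \<le> 4 * (\<kappa> * (1 / \<eta>)\<^sup>2)"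
        using K3 by linarith+
    qed (use K3 C1(1) C2 \<eta> in \<open>auto simp: \<kappa>_def\<close>)
    also have "\<dots> = C3 * (((1 / \<eta>)\<^sup>2) ^ (CARD('d) - 1) * (1 / \<eta>)\<^sup>2 * (1 / \<eta>)\<^sup>2 * (1 / \<eta>)\<^sup>2)"
      unfolding C3_def power_mult_distrib by (simp only: mult_ac)
    also have "((1 / \<eta>)\<^sup>2) ^ (CARD('d) - 1) * (1 / \<eta>)\<^sup>2 * (1 / \<eta>)\<^sup>2 * (1 / \<eta>)\<^sup>2 = (1 / \<eta>) ^ (2 * CARD('d) + 4)"
    proof -
      have "2 * CARD('d) + 4 = 2 * (CARD('d) - 1) + 2 + 2 + 2"
      proof -
        have "0 < CARD('d)" by (rule zero_less_card_finite)
        then show ?thesis by arith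
      qed
      then show ?thesis by (simp only: power_add power_mult)
    qed
    finally show ?thesis .
  qed
  moreover have "C3 \<ge> 0" using C1 C2 by (simp add: C3_def \<kappa>_def)
  ultimately show ?thesis using that by blast
qed

text \<open>Dyadic decomposition according to the size of \<open>m\<close>.\<close>

lemma sum_powr_le:
  fixes m :: "'a \<Rightarrow> real" and q :: nat
  assumes m: "\<And>n. 0 \<le> m n" "\<And>n. n \<in> A \<Longrightarrow> m n \<le> 1" and p: "p > real q" and C: "C \<ge> 0"
    and count: "\<And>\<delta> S. 0 < \<delta> \<Longrightarrow> \<delta> \<le> 1 \<Longrightarrow> finite S \<Longrightarrow> S \<subseteq> A \<Longrightarrow> (\<And>n. n \<in> S \<Longrightarrow> \<delta> \<le> m n) \<Longrightarrow>
      card S \<le> C * (1 / \<delta>) ^ q"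
  obtains D where "\<And>S. finite S \<Longrightarrow> S \<subseteq> A \<Longrightarrow> (\<Sum>n\<in>S. m n powr p) \<le> D"
proof -
  \<comment> \<open>The ratio of the geometric series: level k has at most C 2^(q (k+1)) members,
    each contributing at most 2^(-k p), which gives C 2^q r^k.\<close>
  define r where "r = (2 :: real) powr (real q - p)"
  have r: "0 < r" "r < 1" using p by (simp_all add: r_def powr_less_one)
  have "(\<Sum>n\<in>S. m n powr p) \<le> C * 2 ^ q * (1 / (1 - r))" if S: "finite S" "S \<subseteq> A" for S
  proof -
    \<comment> \<open>Zeros have no dyadic level, and they contribute nothing to the sum.\<close>
    define S' where "S' = {n\<in>S. m n \<noteq> 0}"
    have S': "finite S'" "S' \<subseteq> A" using S by (auto simp: S'_def)
    have "\<exists>k. (1/2) ^ Suc k \<le> m n \<and> m n \<le> (1/2) ^ k" if "n \<in> S'" for n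
    proof -
      have pos: "0 < m n" "m n \<le> 1" using that m S' by (auto simp: S'_def less_le)
      define k where "k = (LEAST k. (1/2) ^ Suc k \<le> m n)"
      have "\<exists>k. (1/2 :: real) ^ k < m n" using pos by (intro real_arch_pow_inv) auto
      then obtain k0 where "(1/2 :: real) ^ k0 < m n" by blast
      then have ex: "(1/2 :: real) ^ Suc k0 \<le> m n" by simp (use pos in linarith)
      have 1: "(1/2) ^ Suc k \<le> m n" unfolding k_def using ex by (rule LeastI)
      have "m n \<le> (1/2) ^ k"
      proof (cases k)
        case (Suc i)
        then have "\<not> (1/2) ^ Suc i \<le> m n" using not_less_Least[of i "\<lambda>k. (1/2) ^ Suc k \<le> m n"] by (simp add: k_def)
        then show ?thesis using Suc by simp
      qed (use pos in simp)
      with 1 show ?thesis by blast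
    qed
    then obtain lev where lev: "\<And>n. n \<in> S' \<Longrightarrow> (1/2) ^ Suc (lev n) \<le> m n \<and> m n \<le> (1/2) ^ lev n" by metis
    \<comment> \<open>Inserting 0 keeps the maximum meaningful when S' is empty.\<close>
    define N where "N = Suc (Max (insert 0 (lev ` S')))"
    have N: "lev n < N" if "n \<in> S'" for n
      using that S' by (auto simp: N_def less_Suc_eq_le)
    have "(\<Sum>n\<in>S. m n powr p) = (\<Sum>n\<in>S'. m n powr p)"
      unfolding S'_def using S by (intro sum.mono_neutral_right) auto
    also have "\<dots> = (\<Sum>k<N. \<Sum>n\<in>{n\<in>S'. lev n = k}. m n powr p)"
      using S' N by (intro sum.group[symmetric]) auto
    also have "\<dots> \<le> (\<Sum>k<N. C * 2 ^ q * r ^ k)"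
    proof (rule sum_mono)
      fix k
      have "(\<Sum>n\<in>{n\<in>S'. lev n = k}. m n powr p) \<le> (\<Sum>n\<in>{n\<in>S'. lev n = k}. ((1/2) ^ k) powr p)"
        using lev m p by (intro sum_mono powr_mono2) auto
      also have "\<dots> = card {n\<in>S'. lev n = k} * ((1/2) ^ k) powr p" by simp
      also have "\<dots> \<le> (C * (1 / (1/2) ^ Suc k) ^ q) * ((1/2) ^ k) powr p"
      proof (intro mult_right_mono count)
        show "(1/2 :: real) ^ Suc k \<le> 1" by (intro power_le_one) auto
      qed (use S' lev in auto)
      also have "\<dots> = C * 2 ^ q * r ^ k"
      proof -
        have "(1 / (1/2 :: real) ^ Suc k) ^ q = 2 ^ q * 2 powr (real k * real q)"
          by (simp add: power_one_over powr_realpow[symmetric] power_mult_distrib powr_powr powr_power mult_ac powr_add)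
        moreover have "((1/2 :: real) ^ k) powr p = 2 powr (- (real k * p))"
          by (simp add: power_one_over powr_minus_divide powr_realpow[symmetric] powr_powr powr_divide)
        moreover have "2 powr (real k * real q) * 2 powr (- (real k * p)) = r ^ k"
          by (simp add: r_def powr_add[symmetric] powr_power algebra_simps)
        ultimately show ?thesis by (simp add: mult.assoc)
      qed
      finally show "(\<Sum>n\<in>{n\<in>S'. lev n = k}. m n powr p) \<le> C * 2 ^ q * r ^ k" .
    qed
    also have "\<dots> = C * 2 ^ q * (\<Sum>k<N. r ^ k)" by (simp add: sum_distrib_left)
    also have "\<dots> \<le> C * 2 ^ q * (1 / (1 - r))"
    proof (rule mult_left_mono)
      have "(\<Sum>k<N. r ^ k) = (1 - r ^ N) / (1 - r)" using r by (simp add: sum_gp_strict)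
      also have "\<dots> \<le> 1 / (1 - r)" using r by (intro divide_right_mono) auto
      finally show "(\<Sum>k<N. r ^ k) \<le> 1 / (1 - r)" .
    qed (use C in simp)
    finally show ?thesis .
  qed
  then show ?thesis using that by blast
qed

section \<open>Schatten norms of Fourier multipliers\<close>

text \<open>Gaussian elimination by induction on the equations. It bounds the number of
  \<open>ae_independent\<close> functions whose coefficients live on a finite set of
  frequencies.\<close>

lemma nontrivial_kernel:
  fixes v :: "'i \<Rightarrow> 'a \<Rightarrow> complex"
  assumes "finite N" "finite I" "card N < card I"
  shows "\<exists>c. (\<exists>i\<in>I. c i \<noteq> 0) \<and> (\<forall>n\<in>N. (\<Sum>i\<in>I. c i * v i n) = 0)"
  using assms
proof (induction N arbitrary: I v rule: finite_induct)
  case empty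
  then have "I \<noteq> {}" by auto
  then show ?case by (intro exI[of _ "\<lambda>_. 1"]) auto
next
  case (insert x N)
  show ?case
  proof (cases "\<forall>i\<in>I. v i x = 0")
    case True
    have "card N < card I" using insert by simp
    then obtain c where "\<exists>i\<in>I. c i \<noteq> 0" "\<forall>n\<in>N. (\<Sum>i\<in>I. c i * v i n) = 0"
      using insert.IH[OF insert.prems(1), of v] by auto
    then show ?thesis using True by (intro exI[of _ c]) auto
  next
    case False
    then obtain p where p: "p \<in> I" "v p x \<noteq> 0" by auto
    define J where "J = I - {p}"
    have J: "finite J" "p \<notin> J" "I = insert p J" using insert.prems p by (auto simp: J_def)
    have "card N < card J" using insert J by simp
    from insert.IH[OF J(1) this, of "\<lambda>i n. v i n - v i x / v p x * v p n"]
    obtain c where c: "\<exists>i\<in>J. c i \<noteq> 0" "\<forall>n\<in>N. (\<Sum>i\<in>J. c i * (v i n - v i x / v p x * v p n)) = 0" by blast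
    \<comment> \<open>The pivot coefficient solves equation x; substituting it turns the remaining
      equations into the reduced system.\<close>
    define c' where "c' i = (if i = p then - (\<Sum>i\<in>J. c i * v i x) / v p x else c i)" for i
    have sum: "(\<Sum>i\<in>I. c' i * v i n) = - (\<Sum>i\<in>J. c i * v i x) / v p x * v p n + (\<Sum>i\<in>J. c i * v i n)" for n
    proof -
      have "(\<Sum>i\<in>J. c' i * v i n) = (\<Sum>i\<in>J. c i * v i n)"
        using J(2) by (intro sum.cong) (auto simp: c'_def)
      then show ?thesis using J by (simp add: c'_def)
    qed
    have "(\<Sum>i\<in>I. c' i * v i n) = 0" if "n \<in> N" for n
    proof -
      have "(\<Sum>i\<in>J. c i * (v i n - v i x / v p x * v p n))
          = (\<Sum>i\<in>J. c i * v i n) - (\<Sum>i\<in>J. c i * v i x) / v p x * v p n"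
        by (simp add: right_diff_distrib sum_subtractf sum_distrib_right sum_divide_distrib mult.assoc)
      then show ?thesis using c(2) that unfolding sum by simp
    qed
    moreover have "(\<Sum>i\<in>I. c' i * v i x) = 0" unfolding sum using p(2) by simp
    moreover have "\<exists>i\<in>I. c' i \<noteq> 0" using c(1) J by (auto simp: c'_def)
    ultimately show ?thesis by blast
  qed
qed

lemma l2sq_diff_le: "f \<in> L2 \<Longrightarrow> g \<in> L2 \<Longrightarrow> l2sq (\<lambda>x. f x - g x) \<le> 2 * l2sq f + 2 * l2sq g"
  using l2sq_add_le[of f "\<lambda>x. - 1 * g x"] L2_cmult[of g "- 1"] l2sq_cmult[of "- 1" g] by simp

lemma L2_inner_cong:
  assumes "torus_fun f" "torus_fun g" "ae_eq f g" "torus_fun h"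
  shows "L2_inner f h = L2_inner g h"
  unfolding L2_inner_def using assms
  by (intro integral_cong_AE)
    (auto simp: ae_eq_def elim!: eventually_mono intro!: torus_measurable borel_measurable_times cnj_measurable)

locale fourier_multiplier =
  fixes T :: "'d::finite tfun \<Rightarrow> 'd tfun" and m :: "int ^ 'd \<Rightarrow> complex"
  assumes T: "bounded_operator (Lp 2) (Lp 2) T"
    and m: "ae_eq (T (chi n)) (\<lambda>x. m n * chi n x)"
begin

lemma T_L2: "f \<in> L2 \<Longrightarrow> T f \<in> L2"
  using bounded_operatorD(1)[OF T] .

lemma coef_T: "f \<in> L2 \<Longrightarrow> coef (T f) n = m n * coef f n"
  by (rule coef_operator_L2[OF T m])

lemma multiplier_bounded: "\<exists>C>0. \<forall>n. norm (m n) \<le> C"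
proof -
  obtain C where C: "C > 0" "\<And>f. f \<in> L2 \<Longrightarrow> sqrt (l2sq (T f)) \<le> C * sqrt (l2sq f)"
    using bounded_operator_L2_bound[OF T] by blast
  have "norm (m n) \<le> C" for n
  proof -
    have "norm (coef (T (chi n)) n) \<le> sqrt (l2sq (T (chi n)))" by (intro norm_coef_le_L2 T_L2) simp
    also have "\<dots> \<le> C * sqrt (l2sq (chi n))" by (intro C) simp
    finally show ?thesis by (simp add: coef_T coef_chi) (simp add: l2sq_def)
  qed
  then show ?thesis using C(1) by blast
qed

lemma sum_coef_T_le:
  assumes "\<And>n. norm (m n) \<le> C" "f \<in> L2" "finite F"
  shows "(\<Sum>n\<in>F. (norm (m n * coef f n))\<^sup>2) \<le> C\<^sup>2 * l2sq f"
proof -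
  have "(\<Sum>n\<in>F. (norm (m n * coef f n))\<^sup>2) \<le> (\<Sum>n\<in>F. C\<^sup>2 * (norm (coef f n))\<^sup>2)"
    unfolding norm_mult power_mult_distrib using assms(1) by (intro sum_mono mult_right_mono power_mono) auto
  also have "\<dots> = C\<^sup>2 * (\<Sum>n\<in>F. (norm (coef f n))\<^sup>2)" by (simp add: sum_distrib_left)
  also have "\<dots> \<le> C\<^sup>2 * l2sq f" using assms by (intro mult_left_mono bessel) auto
  finally show ?thesis .
qed

text \<open>The multiplier \<open>cnj (m n)\<close> defines an adjoint: Riesz-Fischer supplies the
  functions and Parseval the duality. Existence is what gives the choice \<open>adjoint_op\<close>
  its meaning.\<close>

lemma adjoint_exists: "\<exists>S. is_adjoint T S"
proof -
  obtain C where C: "C > 0" "\<And>n. norm (m n) \<le> C" using multiplier_bounded by blast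
  have "\<exists>h. h \<in> L2 \<and> (\<forall>n. coef h n = cnj (m n) * coef g n) \<and> l2sq h \<le> C\<^sup>2 * l2sq g" if "g \<in> L2" for g
  proof -
    have "(\<Sum>n\<in>F. (norm (cnj (m n) * coef g n))\<^sup>2) \<le> C\<^sup>2 * l2sq g" if "finite F" for F
      using sum_coef_T_le[OF C(2) \<open>g \<in> L2\<close> that] by (simp add: norm_mult)
    from riesz_fischer[OF this] show ?thesis by metis
  qed
  then obtain S where S: "\<And>g. g \<in> L2 \<Longrightarrow> S g \<in> L2" "\<And>g n. g \<in> L2 \<Longrightarrow> coef (S g) n = cnj (m n) * coef g n"
      "\<And>g. g \<in> L2 \<Longrightarrow> l2sq (S g) \<le> C\<^sup>2 * l2sq g"
    by metis
  have "bounded_operator (Lp 2) (Lp 2) S"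
    unfolding bounded_operator_def
  proof (intro conjI ballI allI impI)
    fix f g :: "'d tfun" assume fg: "f \<in> L2" "g \<in> L2"
    show "ae_eq (S (\<lambda>x. f x + g x)) (\<lambda>x. S f x + S g x)"
      using fg by (intro L2_ae_eqI) (simp_all add: S L2_add coef_add L2_integrable algebra_simps)
    show "ae_eq (S f) (S g)" if "ae_eq f g"
      using fg coef_cong[OF _ _ that] by (intro L2_ae_eqI) (simp_all add: S L2_torus_fun)
  next
    fix c and f :: "'d tfun" assume f: "f \<in> L2"
    show "ae_eq (S (\<lambda>x. c * f x)) (\<lambda>x. c * S f x)"
      using f by (intro L2_ae_eqI) (simp_all add: S L2_cmult coef_cmult)
  next
    have "size_of (Lp 2) (S f) \<le> C * size_of (Lp 2) f" if "f \<in> L2" for f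
    proof -
      have "sqrt (l2sq (S f)) \<le> sqrt (C\<^sup>2 * l2sq f)" using S(3)[OF that] by (rule real_sqrt_le_mono)
      then show ?thesis using C(1) by (simp add: size_of_L2 real_sqrt_mult)
    qed
    then show "\<exists>C. \<forall>f\<in>L2. size_of (Lp 2) (S f) \<le> C * size_of (Lp 2) f" by blast
  qed (rule S)
  moreover have "L2_inner (T f) g = L2_inner f (S g)" if fg: "f \<in> L2" "g \<in> L2" for f g
  proof -
    have "((\<lambda>n. coef (T f) n * cnj (coef g n)) has_sum L2_inner (T f) g) UNIV"
      using fg T_L2 by (intro parseval) auto
    moreover have "((\<lambda>n. coef f n * cnj (coef (S g) n)) has_sum L2_inner f (S g)) UNIV"
      using fg S by (intro parseval) auto
    moreover have "coef (T f) n * cnj (coef g n) = coef f n * cnj (coef (S g) n)" for n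
      using fg by (simp add: coef_T S)
    ultimately show ?thesis by (simp only:) (rule has_sum_unique)
  qed
  ultimately show ?thesis unfolding is_adjoint_def by blast
qed

lemma adjoint: "is_adjoint T (adjoint_op T)"
  unfolding adjoint_op_def using adjoint_exists by (rule someI_ex)

lemma adjoint_L2: "f \<in> L2 \<Longrightarrow> adjoint_op T f \<in> L2"
  using adjoint bounded_operatorD(1) unfolding is_adjoint_def by blast

text \<open>Duality against \<open>chi n\<close> determines each coefficient, whichever adjoint was
  chosen.\<close>

lemma coef_adjoint:
  assumes "f \<in> L2"
  shows "coef (adjoint_op T f) n = cnj (m n) * coef f n"
proof -
  have "L2_inner (chi n) (adjoint_op T f) = L2_inner (T (chi n)) f"
    using adjoint assms unfolding is_adjoint_def by simp
  also have "\<dots> = L2_inner (\<lambda>x. m n * chi n x) f"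
    using assms T_L2[of "chi n"] by (intro L2_inner_cong m) (auto intro!: L2_torus_fun L2_cmult)
  also have "\<dots> = m n * L2_inner (chi n) f" by (rule L2_inner_cmult_left)
  finally have "cnj (L2_inner (chi n) (adjoint_op T f)) = cnj (m n) * cnj (L2_inner (chi n) f)" by simp
  then show ?thesis by (simp flip: L2_inner_sym add: L2_inner_chi)
qed

text \<open>An eigenfunction of the adjoint times T for s^2 has coefficients only where |m n| = s.
  More functions than such frequencies admit a nontrivial combination with vanishing coefficients,
  which is zero almost everywhere.\<close>

lemma singular_mult_le:
  assumes "s > 0" and fin: "finite {n. norm (m n) = s}"
  shows "singular_mult T s \<le> enat (card {n. norm (m n) = s})"
  unfolding singular_mult_def ae_dim_def
proof (rule Sup_least)
  let ?N = "{n. norm (m n) = s}"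
  fix k assume "k \<in> {enat n |n. \<exists>f. (\<forall>i<n. f i \<in> eigenspace (\<lambda>f. adjoint_op T (T f)) (complex_of_real (s\<^sup>2))) \<and> ae_independent n f}"
  then obtain q f where k: "k = enat q" and f: "\<And>i. i < q \<Longrightarrow> f i \<in> eigenspace (\<lambda>f. adjoint_op T (T f)) (complex_of_real (s\<^sup>2))"
    and ind: "ae_independent q f" by blast
  have fL2: "f i \<in> L2" if "i < q" for i using f[OF that] by (simp add: eigenspace_def)
  have zero: "coef (f i) n = 0" if "i < q" "n \<notin> ?N" for i n
  proof -
    have "ae_eq (adjoint_op T (T (f i))) (\<lambda>x. complex_of_real (s\<^sup>2) * f i x)"
      using f[OF that(1)] by (simp add: eigenspace_def)
    then have "coef (adjoint_op T (T (f i))) n = coef (\<lambda>x. complex_of_real (s\<^sup>2) * f i x) n"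
      using fL2[OF that(1)] by (intro coef_cong) (auto intro!: L2_torus_fun adjoint_L2 T_L2 L2_cmult)
    then have "cnj (m n) * (m n * coef (f i) n) = complex_of_real (s\<^sup>2) * coef (f i) n"
      using fL2[OF that(1)] by (simp add: coef_adjoint T_L2 coef_T coef_cmult)
    moreover have "cnj (m n) * m n = complex_of_real ((norm (m n))\<^sup>2)"
      unfolding complex_norm_square by simp
    ultimately have "complex_of_real ((norm (m n))\<^sup>2 - s\<^sup>2) * coef (f i) n = 0"
      by (simp add: left_diff_distrib mult.assoc[symmetric])
    moreover have "(norm (m n))\<^sup>2 - s\<^sup>2 \<noteq> 0"
      using that(2) \<open>s > 0\<close> by (simp add: power2_eq_iff_nonneg)
    ultimately show ?thesis by (simp only: mult_eq_0_iff of_real_eq_0_iff simp_thms)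
  qed
  have "q \<le> card ?N"
  proof (rule ccontr)
    assume "\<not> q \<le> card ?N"
    then have "card ?N < card {..<q}" by simp
    from nontrivial_kernel[OF fin _ this, of "\<lambda>i. coef (f i)"]
    obtain c where c: "\<exists>i\<in>{..<q}. c i \<noteq> 0" "\<forall>n\<in>?N. (\<Sum>i<q. c i * coef (f i) n) = 0" by blast
    have "ae_eq (\<lambda>x. \<Sum>i<q. c i * f i x) (\<lambda>x. 0)"
    proof (rule L2_ae_eqI)
      show "(\<lambda>x. \<Sum>i<q. c i * f i x) \<in> L2" using fL2 by (intro L2_sum L2_cmult) auto
      show "coef (\<lambda>x. \<Sum>i<q. c i * f i x) n = coef (\<lambda>x. 0) n" for n
      proof -
        have "coef (\<lambda>x. \<Sum>i<q. c i * f i x) n = (\<Sum>i<q. c i * coef (f i) n)"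
          using fL2 by (subst coef_sum) (auto intro!: L2_integrable L2_cmult simp: coef_cmult)
        also have "\<dots> = 0" using c(2) zero by (cases "n \<in> ?N") auto
        finally show ?thesis by (simp add: coef_def)
      qed
    qed simp
    then show False using ind c(1) unfolding ae_independent_def by auto
  qed
  then show "k \<le> enat (card ?N)" by (simp add: k)
qed

text \<open>Along a subsequence all coefficients converge, and Riesz-Fischer turns the limits into a
  function h. In the images the finitely many frequencies with large multipliers converge
  individually, and all others are damped uniformly.\<close>

lemma compactI:
  assumes fin: "\<And>e. e > 0 \<Longrightarrow> finite {n. norm (m n) \<ge> e}"
  shows "compact_operator T"
  unfolding compact_operator_def
proof (intro conjI T allI impI)
  fix f :: "nat \<Rightarrow> 'd tfun" assume f: "\<forall>n. f n \<in> L2 \<and> size_of (Lp 2) (f n) \<le> 1"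
  then have fL2: "f k \<in> L2" and fsq: "l2sq (f k) \<le> 1" for k by (auto simp: size_of_L2)
  have "norm (coef (f k) n) \<le> 1" for k n
    using norm_coef_le_L2[OF fL2[of k], of n] f by (auto simp: size_of_L2 intro: order_trans)
  \<comment> \<open>A diagonal subsequence over the countable set of frequencies, available as each
    coefficient is bounded by 1.\<close>
  then obtain r where r: "strict_mono (r :: nat \<Rightarrow> nat)" "\<And>n. \<exists>l. (\<lambda>k. coef (f (r k)) n) \<longlonglongrightarrow> l"
    using function_convergent_subsequence[of "UNIV :: (int ^ 'd) set" "\<lambda>k. coef (f k)" 1]
    by (metis UNIV_I countable_int_vec)
  then obtain c where c: "\<And>n. (\<lambda>k. coef (f (r k)) n) \<longlonglongrightarrow> c n" by metis
  have "(\<Sum>n\<in>F. (norm (c n))\<^sup>2) \<le> 1" if "finite F" for F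
  proof (rule LIMSEQ_le_const2)
    show "(\<lambda>k. \<Sum>n\<in>F. (norm (coef (f (r k)) n))\<^sup>2) \<longlonglongrightarrow> (\<Sum>n\<in>F. (norm (c n))\<^sup>2)"
      by (intro tendsto_intros c)
    show "\<exists>N. \<forall>k\<ge>N. (\<Sum>n\<in>F. (norm (coef (f (r k)) n))\<^sup>2) \<le> 1"
      using bessel[OF fL2 that] fsq by (auto intro: order_trans)
  qed
  then obtain h where h: "h \<in> L2" "\<And>n. coef h n = c n" "l2sq h \<le> 1"
    using riesz_fischer by metis
  define u where "u k x = T (f (r k)) x - T h x" for k x
  have uL2: "u k \<in> L2" for k unfolding u_def[abs_def] by (intro L2_diff T_L2 fL2 h)
  have fcu: "coef (u k) n = m n * coef (\<lambda>x. f (r k) x - h x) n" for k n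
    unfolding u_def[abs_def] using fL2 h(1) T_L2 by (simp add: coef_diff L2_integrable coef_T algebra_simps)
  have "(\<lambda>k. l2sq (u k)) \<longlonglongrightarrow> 0"
  proof (rule LIMSEQ_I)
    fix e :: real assume "e > 0"
    \<comment> \<open>The squared norm of f (r k) - h is at most 2 + 2 = 4, so the frequencies
      outside F contribute at most 4 * e/8 = e/2.\<close>
    define F where "F = {n. norm (m n) \<ge> sqrt (e / 8)}"
    have F: "finite F" unfolding F_def using fin \<open>e > 0\<close> by simp
    define s where "s k = (\<Sum>n\<in>F. (norm (m n * coef (\<lambda>x. f (r k) x - h x) n))\<^sup>2)" for k
    have "s = (\<lambda>k. \<Sum>n\<in>F. (norm (m n * (coef (f (r k)) n - c n)))\<^sup>2)"
      unfolding s_def[abs_def] using fL2 h by (simp add: coef_diff L2_integrable)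
    moreover have "(\<lambda>k. \<Sum>n\<in>F. (norm (m n * (coef (f (r k)) n - c n)))\<^sup>2) \<longlonglongrightarrow> (\<Sum>n\<in>F. (norm (m n * (c n - c n)))\<^sup>2)"
      by (intro tendsto_intros c)
    ultimately have "s \<longlonglongrightarrow> 0" by simp
    then obtain N where N: "\<And>k. k \<ge> N \<Longrightarrow> norm (s k) < e / 2"
      using LIMSEQ_D[of s 0 "e / 2"] \<open>e > 0\<close> by auto
    have "l2sq (u k) \<le> s k + e / 2" for k
    proof (rule l2sq_le_coef[OF uL2])
      fix G :: "(int ^ 'd) set" assume G: "finite G"
      define w where "w n = (norm (coef (\<lambda>x. f (r k) x - h x) n))\<^sup>2" for n
      have d: "(\<lambda>x. f (r k) x - h x) \<in> L2" by (intro L2_diff fL2 h)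
      have "(\<Sum>n\<in>G. (norm (coef (u k) n))\<^sup>2) = (\<Sum>n\<in>G \<inter> F. (norm (coef (u k) n))\<^sup>2) + (\<Sum>n\<in>G - F. (norm (coef (u k) n))\<^sup>2)"
        using G by (subst sum.union_disjoint[symmetric]) (auto intro!: sum.cong)
      also have "\<dots> \<le> s k + (\<Sum>n\<in>G - F. e / 8 * w n)"
      proof (rule add_mono)
        show "(\<Sum>n\<in>G \<inter> F. (norm (coef (u k) n))\<^sup>2) \<le> s k"
          unfolding s_def fcu using F by (intro sum_mono2) auto
        show "(\<Sum>n\<in>G - F. (norm (coef (u k) n))\<^sup>2) \<le> (\<Sum>n\<in>G - F. e / 8 * w n)"
        proof (rule sum_mono)
          fix n assume "n \<in> G - F"
          then have "norm (m n) \<le> sqrt (e / 8)" by (simp add: F_def)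
          then have "(norm (m n))\<^sup>2 \<le> (sqrt (e / 8))\<^sup>2" by (intro power_mono) auto
          then have "(norm (m n))\<^sup>2 \<le> e / 8" using \<open>e > 0\<close> by simp
          then show "(norm (coef (u k) n))\<^sup>2 \<le> e / 8 * w n"
            unfolding fcu w_def norm_mult power_mult_distrib by (rule mult_right_mono) simp
        qed
      qed
      also have "(\<Sum>n\<in>G - F. e / 8 * w n) = e / 8 * (\<Sum>n\<in>G - F. w n)" by (simp add: sum_distrib_left)
      also have "\<dots> \<le> e / 8 * 4"
      proof (rule mult_left_mono)
        have "(\<Sum>n\<in>G - F. w n) \<le> l2sq (\<lambda>x. f (r k) x - h x)"
          unfolding w_def using G by (intro bessel d) auto
        also have "\<dots> \<le> 2 * l2sq (f (r k)) + 2 * l2sq h" by (intro l2sq_diff_le fL2 h)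
        finally show "(\<Sum>n\<in>G - F. w n) \<le> 4" using fsq[of "r k"] h(3) by linarith
      qed (use \<open>e > 0\<close> in simp)
      finally show "(\<Sum>n\<in>G. (norm (coef (u k) n))\<^sup>2) \<le> s k + e / 2" by simp
    qed
    note l2sq_u = this
    have "norm (l2sq (u k) - 0) < e" if "k \<ge> N" for k
    proof -
      have "s k < e / 2" using N[OF that] by simp
      then have "l2sq (u k) < e" using l2sq_u[of k] by linarith
      then show ?thesis by simp
    qed
    then show "\<exists>no. \<forall>k\<ge>no. norm (l2sq (u k) - 0) < e" by blast
  qed
  then have "(\<lambda>k. sqrt (l2sq (u k))) \<longlonglongrightarrow> sqrt 0" by (rule tendsto_real_sqrt)
  moreover have "size_of (Lp 2) (\<lambda>x. T (f (r k)) x - T h x) = sqrt (l2sq (u k))" for k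
    unfolding size_of_L2 u_def by (rule refl)
  ultimately have "(\<lambda>k. size_of (Lp 2) (\<lambda>x. T (f (r k)) x - T h x)) \<longlonglongrightarrow> 0"
    by (simp only: real_sqrt_zero)
  then show "\<exists>(r :: nat \<Rightarrow> nat) g. strict_mono r \<and> g \<in> L2 \<and> (\<lambda>n. size_of (Lp 2) (\<lambda>x. T (f (r n)) x - g x)) \<longlonglongrightarrow> 0"
    using r(1) T_L2[OF h(1)] by blast
qed

text \<open>Grouping frequencies by |m n| bounds the sum over singular values by the sum over
  frequencies. Summability also makes every set |m n| \<ge> e finite, which yields
  compactness.\<close>

theorem schatten_norm_finite:
  assumes p: "p > 0" and D: "\<And>S. finite S \<Longrightarrow> (\<Sum>n\<in>S. norm (m n) powr p) \<le> D"
  shows "schatten_norm p T < \<infinity>"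
proof -
  have fin: "finite {n. norm (m n) \<ge> e}" if "e > 0" for e
  proof (rule ccontr)
    assume inf: "infinite {n. norm (m n) \<ge> e}"
    obtain k :: nat where k: "D / e powr p < k" using reals_Archimedean2 by blast
    obtain S where S: "finite S" "card S = k" "S \<subseteq> {n. norm (m n) \<ge> e}"
      using infinite_arbitrarily_large[OF inf] by metis
    have "k * e powr p = (\<Sum>n\<in>S. e powr p)" using S by simp
    also have "\<dots> \<le> (\<Sum>n\<in>S. norm (m n) powr p)"
      using S(3) that p by (intro sum_mono powr_mono2) auto
    also have "\<dots> \<le> D" by (rule D[OF S(1)])
    finally show False using k that by (simp add: field_simps)
  qed
  have fin_eq: "finite {n. norm (m n) = s}" if "s > 0" for s
    by (rule finite_subset[OF _ fin[OF that]]) auto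
  have "singular_power_sum p T \<le> ennreal D"
    unfolding singular_power_sum_def
  proof (rule infsum_le_finite_sums)
    fix F :: "real set" assume F: "finite F" "F \<subseteq> {0<..}"
    have "(\<Sum>s\<in>F. ennreal_of_enat (singular_mult T s) * ennreal (s powr p))
        \<le> (\<Sum>s\<in>F. ennreal (\<Sum>n\<in>{n. norm (m n) = s}. norm (m n) powr p))"
    proof (rule sum_mono)
      fix s assume "s \<in> F"
      then have "s > 0" using F by auto
      have "ennreal_of_enat (singular_mult T s) \<le> ennreal_of_enat (enat (card {n. norm (m n) = s}))"
        unfolding ennreal_of_enat_le_iff by (rule singular_mult_le[OF _ fin_eq]) (fact \<open>s > 0\<close>)+
      then have "ennreal_of_enat (singular_mult T s) * ennreal (s powr p)
          \<le> of_nat (card {n. norm (m n) = s}) * ennreal (s powr p)"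
        by (intro mult_right_mono) auto
      also have "\<dots> = ennreal (card {n. norm (m n) = s} * s powr p)"
        by (simp add: ennreal_mult ennreal_of_nat_eq_real_of_nat)
      also have "card {n. norm (m n) = s} * s powr p = (\<Sum>n\<in>{n. norm (m n) = s}. norm (m n) powr p)"
        by simp
      finally show "ennreal_of_enat (singular_mult T s) * ennreal (s powr p)
        \<le> ennreal (\<Sum>n\<in>{n. norm (m n) = s}. norm (m n) powr p)" .
    qed
    also have "\<dots> = ennreal (\<Sum>s\<in>F. \<Sum>n\<in>{n. norm (m n) = s}. norm (m n) powr p)"
      by (rule sum_ennreal) (auto intro!: sum_nonneg)
    also have "(\<Sum>s\<in>F. \<Sum>n\<in>{n. norm (m n) = s}. norm (m n) powr p)
        = (\<Sum>n\<in>(\<Union>s\<in>F. {n. norm (m n) = s}). norm (m n) powr p)"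
      using F fin_eq by (intro sum.UNION_disjoint[symmetric]) auto
    also have "ennreal \<dots> \<le> ennreal D"
      using F fin_eq by (intro ennreal_leI D finite_UN_I) auto
    finally show "(\<Sum>s\<in>F. ennreal_of_enat (singular_mult T s) * ennreal (s powr p)) \<le> ennreal D" .
  qed (auto intro!: nonneg_summable_on_complete)
  also have "\<dots> < \<infinity>" by simp
  finally show ?thesis using compactI[OF fin] by (simp add: schatten_norm_def)
qed

end

section \<open>From the counting bound to summability of the multipliers\<close>

theorem theorem1:
  fixes T :: "'d::finite tfun \<Rightarrow> 'd tfun" and p :: real
  assumes "bounded_operator (Lp 2) (Lp 2) T"
    and "admits_invariant_factorization (Lp 2) Sobolev11 (Lp 2) T"
    and "p > 2 * real CARD('d) + 4"
  shows "schatten_norm p T < \<infinity>"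
proof -
  obtain a b B CA CB where B: "bounded_operator Sobolev11 (Lp 2) B" "CA > 0" "CB > 0"
    "\<And>n. ae_eq (B (chi n)) (\<lambda>x. b n * chi n x)"
    and Tm: "\<And>n. ae_eq (T (chi n)) (\<lambda>x. a n * b n * chi n x)"
    and a: "\<And>n j. \<bar>real_of_int (n $ j)\<bar> * norm (a n) \<le> CA"
    and CB: "\<And>f. f \<in> elems Sobolev11 \<Longrightarrow> sqrt (l2sq (B f)) \<le> CB * size_of Sobolev11 f"
    using factorization_multiplier[OF assms(1,2)] by metis
  interpret fourier_multiplier T "\<lambda>n. a n * b n"
    by unfold_locales (use assms(1) Tm in auto)
  \<comment> \<open>Bessel for B f combined with the explicit Sobolev norm of a trigonometric
    polynomial.\<close>
  have "sobolev_multiplier b CB"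
    unfolding sobolev_multiplier_def
  proof (intro allI impI)
    fix f :: "'d tfun" and F and S :: "(int ^ 'd) set"
    assume f: "tpoly f F" and S: "finite S"
    have BL2: "B f \<in> L2" by (rule bounded_operatorD(1)[OF B(1) tpoly_Sobolev11[OF f]])
    have "(\<Sum>n\<in>S. (norm (b n) * norm (coef f n))\<^sup>2) = (\<Sum>n\<in>S. (norm (coef (B f) n))\<^sup>2)"
      by (simp add: coef_operator_tpoly[OF B(1,4) f] norm_mult)
    also have "\<dots> \<le> l2sq (B f)" by (rule bessel[OF BL2 S])
    also have "\<dots> = (sqrt (l2sq (B f)))\<^sup>2" by simp
    also have "\<dots> \<le> (CB * (l1 f + (\<Sum>j\<in>UNIV. l1 (F j))))\<^sup>2"
      using CB[OF tpoly_Sobolev11[OF f]] by (intro power_mono) (auto simp: tpoly_size_of_Sobolev11[OF f])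
    finally show "(\<Sum>n\<in>S. (norm (b n) * norm (coef f n))\<^sup>2) \<le> (CB * (l1 f + (\<Sum>j\<in>UNIV. l1 (F j))))\<^sup>2" .
  qed
  then obtain C3 where C3: "C3 \<ge> 0"
    "\<And>(\<eta> :: real) S. 0 < \<eta> \<Longrightarrow> \<eta> \<le> 1 \<Longrightarrow> finite S \<Longrightarrow> (\<And>n. n \<in> S \<Longrightarrow> n \<noteq> 0 \<and> \<eta> * snorm n \<le> norm (b n)) \<Longrightarrow>
       card S \<le> C3 * (1 / \<eta>) ^ (2 * CARD('d) + 4)"
    using counting by metis
  obtain CT where CT: "CT > 0" "\<And>n. norm (a n * b n) \<le> CT" using multiplier_bounded by blast
  \<comment> \<open>The second entry converts |a n b n| \<ge> \<delta> CT into |b n| \<ge> \<delta>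
    c |n| through |n| |a n| \<le> CA; the cap 1 keeps \<delta> c within the range of the counting
    bound.\<close>
  define c where "c = min 1 (CT / CA)"
  have c: "c > 0" "c \<le> 1" "c * CA \<le> CT" using B CT by (auto simp: c_def min_def field_simps)
  have snorm_a: "snorm n * norm (a n) \<le> CA" for n
  proof -
    obtain j where "\<bar>n $ j\<bar> = int (snorm n)" using snorm_attained by blast
    then have "\<bar>real_of_int (n $ j)\<bar> = snorm n" by (metis of_int_abs of_int_of_nat_eq)
    then show ?thesis using a[of n j] by simp
  qed
  \<comment> \<open>Division by CT brings the multipliers into [0,1]. Frequency 0 is set aside,
    since the decay estimate says nothing about it.\<close>
  obtain D where D: "\<And>S. finite S \<Longrightarrow> S \<subseteq> - {0} \<Longrightarrow> (\<Sum>n\<in>S. (norm (a n * b n) / CT) powr p) \<le> D"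
  proof (rule sum_powr_le[of "\<lambda>n. norm (a n * b n) / CT" "- {0}" "2 * CARD('d) + 4" p "C3 * (1 / c) ^ (2 * CARD('d) + 4)"])
    fix \<delta> :: real and S :: "(int ^ 'd) set"
    assume \<delta>: "0 < \<delta>" "\<delta> \<le> 1" and S: "finite S" "S \<subseteq> - {0}" "\<And>n. n \<in> S \<Longrightarrow> \<delta> \<le> norm (a n * b n) / CT"
    have "card S \<le> C3 * (1 / (\<delta> * c)) ^ (2 * CARD('d) + 4)"
    proof (rule C3(2))
      show "\<delta> * c \<le> 1" using \<delta> c by (simp add: mult_le_one)
      fix n assume n: "n \<in> S"
      have "\<delta> * c * snorm n * CA \<le> \<delta> * CT * snorm n"
      proof -
        have "(\<delta> * snorm n) * (c * CA) \<le> (\<delta> * snorm n) * CT"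
          using c(3) \<delta>(1) by (intro mult_left_mono) auto
        then show ?thesis by (simp only: mult_ac)
      qed
      also have "\<dots> \<le> norm (a n * b n) * snorm n"
        using S(3)[OF n] CT(1) by (intro mult_right_mono) (auto simp: field_simps)
      also have "\<dots> = snorm n * norm (a n) * norm (b n)" by (simp add: norm_mult)
      also have "\<dots> \<le> CA * norm (b n)" by (intro mult_right_mono snorm_a) simp
      finally have "\<delta> * c * snorm n \<le> norm (b n)" using B(2) by (simp add: mult.commute[of _ CA])
      then show "n \<noteq> 0 \<and> \<delta> * c * snorm n \<le> norm (b n)" using S(2) n by auto
    qed (use \<delta> c S in auto)
    then show "card S \<le> C3 * (1 / c) ^ (2 * CARD('d) + 4) * (1 / \<delta>) ^ (2 * CARD('d) + 4)"
      by (simp only: power_one_over power_mult_distrib divide_inverse inverse_mult_distrib mult_ac mult_1_left)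
  qed (use assms(3) C3 c CT in auto)
  have "(\<Sum>n\<in>S. norm (a n * b n) powr p) \<le> CT powr p * D + CT powr p" if S: "finite S" for S
  proof -
    have "(\<Sum>n\<in>S. norm (a n * b n) powr p) = (\<Sum>n\<in>S - {0}. norm (a n * b n) powr p) + (\<Sum>n\<in>S \<inter> {0}. norm (a n * b n) powr p)"
      using S by (subst sum.union_disjoint[symmetric]) (auto intro!: sum.cong)
    also have "\<dots> \<le> CT powr p * D + CT powr p"
    proof (rule add_mono)
      have "(\<Sum>n\<in>S - {0}. norm (a n * b n) powr p) = CT powr p * (\<Sum>n\<in>S - {0}. (norm (a n * b n) / CT) powr p)"
        unfolding sum_distrib_left using CT(1) by (intro sum.cong) (auto simp flip: powr_mult)
      also have "\<dots> \<le> CT powr p * D" using S by (intro mult_left_mono D) auto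
      finally show "(\<Sum>n\<in>S - {0}. norm (a n * b n) powr p) \<le> CT powr p * D" .
      \<comment> \<open>The single frequency 0 costs at most CT powr p.\<close>
      have "norm (a 0 * b 0) powr p \<le> CT powr p" using CT(2) assms(3) by (intro powr_mono2) auto
      then show "(\<Sum>n\<in>S \<inter> {0}. norm (a n * b n) powr p) \<le> CT powr p" by (cases "0 \<in> S") auto
    qed
    finally show ?thesis .
  qed
  then show ?thesis using assms(3) by (intro schatten_norm_finite) auto
qed

end
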